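(* Let $\Omega\subset\mathbb{C}$ be a compact convex set with non-empty interior. For a non-corner point $\sigma\in\partial\Omega$ and $\zeta\in\partial\Omega\setminus\{\sigma\}$, let $R_{\zeta,\sigma}\in(0,\infty]$ be the radius of the unique circle passing through $\zeta$ and tangent to $\partial\Omega$ at $\sigma$ (with $R_{\zeta,\sigma}=\infty$ if $\zeta$ lies on the tangent line to $\partial\Omega$ at $\sigma$), and set $R_\Omega(\sigma):=\sup_{\zeta}R_{\zeta,\sigma}\in(0,\infty]$, the supremum being over $\zeta\in\partial\Omega\setminus\{\sigma\}$. Then $$c(\Omega)\le 1-\frac{1}{2\pi}\int_{\partial\Omega}\frac{ds}{R_\Omega},$$ where $s$ is arclength on $\partial\Omega$ and $1/\infty:=0$.
   Context: Let $\Omega\subset\mathbb{C}$ be a compact convex set with non-empty interior. Its boundary $\partial\Omega$ is a rectifiable simple closed curve, oriented counter-clockwise; $s$ denotes arclength measure on $\partial\Omega$. At every $\zeta\in\partial\Omega$ the one-sided tangent angles $\alpha_-(\zeta)\le\alpha_+(\zeta)$ (incoming and outgoing, with branches chosen so that $0\le\alpha_+(\zeta)-\alpha_-(\zeta)<\pi$) exist; $\zeta$ is called a corner if $\alpha_-(\zeta)<\alpha_+(\zeta)$, and there are at most countably many corners (so $R_\Omega$ is defined $s$-almost everywhere). Put $\theta_\zeta:=\pi-\alpha_+(\zeta)+\alpha_-(\zeta)\in(0,\pi]$ (the interior angle at $\zeta$; it equals $\pi$ if $\zeta$ is not a corner). At a non-corner $\sigma$ let $T(\sigma)$ be the unit tangent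 (in the positive direction) and $N(\sigma)=-iT(\sigma)$ the outward unit normal. For $\zeta\in\partial\Omega$ let $\mu_\zeta$ be the Borel probability measure on $\partial\Omega$ given by $d\mu_\zeta=(1-\theta_\zeta/\pi)\,d\delta_\zeta+\rho_\zeta\,ds$, where $\delta_\zeta$ is the unit point mass at $\zeta$ and $\rho_\zeta(\sigma)=\frac1\pi\operatorname{Re}\Big(\frac{N(\sigma)}{\sigma-\zeta}\Big)$ for non-corners $\sigma\ne\zeta$. Let $C(\partial\Omega)$ be the space of complex-valued continuous functions on $\partial\Omega$. The Neumann–Poincaré operator $K_\Omega:C(\partial\Omega)\to C(\partial\Omega)$ is $K_\Omega f(\zeta):=\int_{\partial\Omega}f\,d\mu_\zeta$, $\zeta\in\partial\Omega$; it fixes the constant function $\mathbf{1}$, so it acts on $C(\partial\Omega)/\mathbb{C}\mathbf{1}$, which has the quotient norm $\|g+\mathbb{C}\mathbf{1}\|=\min_{\lambda\in\mathbb{C}}\max_{\zeta\in\partial\Omega}|g(\zeta)-\lambda|$. The configuration constant $c(\Omega)$ is the operator norm of $K_\Omega$ on $C(\partial\Omega)/\mathbb{C}\mathbf{1}$. *)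

theory Defs
  imports "HOL-Complex_Analysis.Complex_Analysis"
begin

text \<open>Length of \<open>\<gamma>\<close> on \<open>[a, b]\<close>: supremum of the lengths of inscribed polygonal lines.\<close>

definition curve_length :: "(real \<Rightarrow> complex) \<Rightarrow> real \<Rightarrow> real \<Rightarrow> ennreal" where
  "curve_length \<gamma> a b =
     (SUP ts \<in> {ts. sorted ts \<and> set ts \<subseteq> {a..b}}.
        \<Sum>i<length ts - 1. ennreal (dist (\<gamma> (ts ! i)) (\<gamma> (ts ! Suc i))))"

text \<open>\<open>\<gamma>\<close> is a counter-clockwise parametrisation of the boundary by arclength, where \<open>L\<close> is the
  perimeter; \<open>\<gamma>\<close> is extended \<open>L\<close>-periodically so that no boundary point is an end point.\<close>

definition arclength_param :: "complex set \<Rightarrow> real \<Rightarrow> (real \<Rightarrow> complex) \<Rightarrow> bool" where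
  "arclength_param \<Omega> L \<gamma> \<longleftrightarrow>
     0 < L \<and>
     (\<forall>t. \<gamma> (t + L) = \<gamma> t) \<and>
     simple_path (\<lambda>u. \<gamma> (L * u)) \<and>
     path_image (\<lambda>u. \<gamma> (L * u)) = frontier \<Omega> \<and>
     (\<forall>w\<in>interior \<Omega>. winding_number (\<lambda>u. \<gamma> (L * u)) w = 1) \<and>
     (\<forall>a b. a \<le> b \<longrightarrow> curve_length \<gamma> a b = ennreal (b - a))"

text \<open>For a compact convex set with non-empty interior such a parametrisation exists and is unique
  up to a shift of the parameter. None of the notions below depends on this shift.\<close>

definition bd_param :: "complex set \<Rightarrow> real \<times> (real \<Rightarrow> complex)" where
  "bd_param \<Omega> = (SOME p. arclength_param \<Omega> (fst p) (snd p))"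

definition perimeter :: "complex set \<Rightarrow> real" where
  "perimeter \<Omega> = fst (bd_param \<Omega>)"

definition bd_curve :: "complex set \<Rightarrow> real \<Rightarrow> complex" where
  "bd_curve \<Omega> = snd (bd_param \<Omega>)"

text \<open>The measure space is the boundary itself and not the whole plane, so that functions which are
  continuous merely on the boundary are measurable.\<close>

definition arclength_measure :: "complex set \<Rightarrow> complex measure" where
  "arclength_measure \<Omega> =
     distr (restrict_space lborel {0..<perimeter \<Omega>}) (restrict_space borel (frontier \<Omega>))
       (bd_curve \<Omega>)"

text \<open>Unit tangent vectors \<open>cis \<alpha>\<^sub>+\<close> and \<open>cis \<alpha>\<^sub>-\<close>, as limits of normalised secants.\<close>

definition tangent_out :: "complex set \<Rightarrow> complex \<Rightarrow> complex" where
  "tangent_out \<Omega> \<zeta> =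
     (THE v. \<exists>t. bd_curve \<Omega> t = \<zeta> \<and> ((\<lambda>u. sgn (bd_curve \<Omega> u - \<zeta>)) \<longlongrightarrow> v) (at_right t))"

definition tangent_in :: "complex set \<Rightarrow> complex \<Rightarrow> complex" where
  "tangent_in \<Omega> \<zeta> =
     (THE v. \<exists>t. bd_curve \<Omega> t = \<zeta> \<and> ((\<lambda>u. sgn (\<zeta> - bd_curve \<Omega> u)) \<longlongrightarrow> v) (at_left t))"

text \<open>\<open>am\<close> and \<open>ap\<close> are admissible branches of the angles \<open>\<alpha>\<^sub>-\<close> and \<open>\<alpha>\<^sub>+\<close>; they are determined up
  to a common multiple of \<open>2\<pi>\<close>.\<close>

definition tangent_angles :: "complex set \<Rightarrow> complex \<Rightarrow> real \<Rightarrow> real \<Rightarrow> bool" where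
  "tangent_angles \<Omega> \<zeta> am ap \<longleftrightarrow>
     cis am = tangent_in \<Omega> \<zeta> \<and> cis ap = tangent_out \<Omega> \<zeta> \<and> 0 \<le> ap - am \<and> ap - am < pi"

definition corner :: "complex set \<Rightarrow> complex \<Rightarrow> bool" where
  "corner \<Omega> \<zeta> \<longleftrightarrow> (\<exists>am ap. tangent_angles \<Omega> \<zeta> am ap \<and> am < ap)"

definition interior_angle :: "complex set \<Rightarrow> complex \<Rightarrow> real" where
  "interior_angle \<Omega> \<zeta> = (THE \<theta>. \<exists>am ap. tangent_angles \<Omega> \<zeta> am ap \<and> \<theta> = pi - ap + am)"

text \<open>The next two are meaningful at non-corners only.\<close>

definition unit_tangent :: "complex set \<Rightarrow> complex \<Rightarrow> complex" where
  "unit_tangent \<Omega> \<sigma> = tangent_out \<Omega> \<sigma>"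

definition outer_normal :: "complex set \<Rightarrow> complex \<Rightarrow> complex" where
  "outer_normal \<Omega> \<sigma> = - \<i> * unit_tangent \<Omega> \<sigma>"

text \<open>The value \<open>0\<close> at \<open>\<sigma> = \<zeta>\<close> and at the corners is irrelevant: these points form a countable set,
  which has arclength measure zero.\<close>

definition np_density :: "complex set \<Rightarrow> complex \<Rightarrow> complex \<Rightarrow> real" where
  "np_density \<Omega> \<zeta> \<sigma> =
     (if corner \<Omega> \<sigma> \<or> \<sigma> = \<zeta> then 0 else 1 / pi * Re (outer_normal \<Omega> \<sigma> / (\<sigma> - \<zeta>)))"

text \<open>Both coefficients are nonnegative by convexity, so \<open>ennreal\<close> truncates nothing.\<close>

definition np_measure :: "complex set \<Rightarrow> complex \<Rightarrow> complex measure" where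
  "np_measure \<Omega> \<zeta> =
     measure_of (frontier \<Omega>) (sets (restrict_space borel (frontier \<Omega>)))
       (\<lambda>A. ennreal (1 - interior_angle \<Omega> \<zeta> / pi) * indicator A \<zeta>
          + (\<integral>\<^sup>+\<sigma>\<in>A. ennreal (np_density \<Omega> \<zeta> \<sigma>) \<partial>arclength_measure \<Omega>))"

definition np_operator :: "complex set \<Rightarrow> (complex \<Rightarrow> complex) \<Rightarrow> complex \<Rightarrow> complex" where
  "np_operator \<Omega> f \<zeta> = (\<integral>\<sigma>. f \<sigma> \<partial>np_measure \<Omega> \<zeta>)"

text \<open>Norm of the class of \<open>g\<close> in \<open>C(X) / \<complex>1\<close>. For continuous \<open>g\<close> on a compact non-empty \<open>X\<close> the
  infimum and the supremum are attained.\<close>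

definition quotient_norm :: "complex set \<Rightarrow> (complex \<Rightarrow> complex) \<Rightarrow> real" where
  "quotient_norm X g = (INF l. SUP \<zeta>\<in>X. cmod (g \<zeta> - l))"

text \<open>Operator norm on \<open>C(\<partial>\<Omega>) / \<complex>1\<close>, expressed through representatives of the classes.\<close>

definition config_constant :: "complex set \<Rightarrow> real" where
  "config_constant \<Omega> =
     (SUP g \<in> {g. continuous_on (frontier \<Omega>) g \<and> quotient_norm (frontier \<Omega>) g \<le> 1}.
        quotient_norm (frontier \<Omega>) (np_operator \<Omega> g))"

definition tangent_line :: "complex set \<Rightarrow> complex \<Rightarrow> complex set" where
  "tangent_line \<Omega> \<sigma> = {\<sigma> + of_real x * unit_tangent \<Omega> \<sigma> | x. True}"

text \<open>A circle is tangent to the boundary at \<open>\<sigma>\<close> iff it meets the tangent line at \<open>\<sigma>\<close> exactly in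
  \<open>\<sigma>\<close>.\<close>

definition tangent_circle_radius :: "complex set \<Rightarrow> complex \<Rightarrow> complex \<Rightarrow> ennreal" where
  "tangent_circle_radius \<Omega> \<zeta> \<sigma> =
     (if \<zeta> \<in> tangent_line \<Omega> \<sigma> then \<infinity>
      else ennreal (THE r. 0 < r \<and>
             (\<exists>c. \<zeta> \<in> sphere c r \<and> sphere c r \<inter> tangent_line \<Omega> \<sigma> = {\<sigma>})))"

definition max_tangent_radius :: "complex set \<Rightarrow> complex \<Rightarrow> ennreal" where
  "max_tangent_radius \<Omega> \<sigma> = (SUP \<zeta> \<in> frontier \<Omega> - {\<sigma>}. tangent_circle_radius \<Omega> \<zeta> \<sigma>)"

end

theory Submission
  imports Defs
begin

text \<open>For a boundary point \<open>\<sigma>\<close> with a tangent, the circle through \<open>\<zeta>\<close> tangent at \<open>\<sigma>\<close> has curvature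
  \<open>1 / R = 2 Re (N(\<sigma>) / (\<sigma> - \<zeta>))\<close>. Hence every \<open>\<mu>\<^sub>\<zeta>\<close> dominates the one measure
  \<open>\<nu> = ds / (2 \<pi> R\<^sub>\<Omega>)\<close>. Subtracting \<open>\<integral> f d\<nu>\<close>, which does not depend on \<open>\<zeta>\<close>, leaves integrals against
  the positive measures \<open>\<mu>\<^sub>\<zeta> - \<nu>\<close> of mass \<open>1 - \<nu>(\<partial>\<Omega>)\<close>.

  That \<open>\<mu>\<^sub>\<zeta>\<close> is a probability measure comes down to \<open>\<pi> \<rho>\<^sub>\<zeta>\<close> being the derivative of the argument of
  \<open>\<gamma> u - \<zeta>\<close>, which increases by the interior angle along the boundary. By convexity the argument of a
  chord \<open>\<gamma> u - \<gamma> t\<close> is monotone in both parameters. This yields the one-sided tangents, the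
  countability of the corners, and the differentiability of \<open>\<gamma>\<close> at all other points.\<close>

section \<open>The fundamental theorem of calculus with countably many exceptions\<close>

text \<open>The boundary curve comes from a choice operator, so nothing is known about it until some
  parametrisation by arclength exists. One is built from the radial function about an interior
  point, which convexity makes Lipschitz. Everything about the chosen curve then has to come from
  its length, its winding number and convexity; no smoothness is given. Convexity enters through one
  sign, that of the area of a triangle inscribed in the boundary in counter-clockwise order. It says
  that certain differences of chord angles have nonnegative sine, and continuity turns this into
  monotonicity. One branch of the angle serves the whole strip \<open>t < u < t + L\<close>, so that
  angles at different base points can be compared. Corners may be dense, so recovering the argument
  from its derivative takes a fundamental theorem that tolerates a countable exceptional set. The
  constant 1/(2 pi) is the factor 1/pi of the density times the 1/2 in Re (N / (\<sigma> - \<zeta>))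
  = 1 / (2 R).\<close>

theorem fundamental_theorem_of_calculus_interior_countable:
  fixes f :: "real \<Rightarrow> 'a::banach"
  assumes "a \<le> b" and "countable C" and contf: "continuous_on {a..b} f"
    and derf: "\<And>x. x \<in> {a<..<b} - C \<Longrightarrow> (f has_vector_derivative f' x) (at x)"
  shows "(f' has_integral (f b - f a)) {a..b}"
proof -
  define S where "S = C \<union> {a, b}"
  have cS: "countable S" using \<open>countable C\<close> by (auto simp: S_def)
  define n where "n = to_nat_on S"
  have inj_n: "inj_on n S" using cS unfolding n_def by (rule inj_on_to_nat_on)
  show ?thesis unfolding box_real[symmetric] has_integral
  proof (intro allI impI)
    fix e0 :: real assume "e0 > 0"
    \<comment> \<open>The total error will be at most \<open>e * (b - a)\<close> from regular tags
      plus \<open>4 * e\<close> from exceptional ones; the denominator leaves room to spare.\<close>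
    define e where "e = e0 / (2 * (b - a + 8))"
    have "e > 0" using \<open>e0 > 0\<close> \<open>a \<le> b\<close> by (simp add: e_def)
    define w where "w = (\<lambda>x. (1/2::real) ^ (2 * n x + 1))"
    \<comment> \<open>At an exceptional point the left-hand side tends to 0 by continuity, whatever
      value \<open>f' x\<close> has there, so the gauge can keep it below a weight; the weights are
      summable over the countable set.\<close>
    have "\<exists>d>0. \<forall>y\<in>{a..b}. norm (y - x) < d \<longrightarrow>
             norm (f y - f x - (y - x) *\<^sub>R f' x) \<le> (if x \<in> S then e * w x else e * norm (y - x))"
      if x: "x \<in> {a..b}" for x
    proof (cases "x \<in> S")
      case True
      have "((\<lambda>y. f y - f x - (y - x) *\<^sub>R f' x) \<longlongrightarrow> f x - f x - (x - x) *\<^sub>R f' x) (at x within {a..b})"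
        using contf x by (intro tendsto_intros) (auto simp: continuous_on_def)
      then have "((\<lambda>y. f y - f x - (y - x) *\<^sub>R f' x) \<longlongrightarrow> 0) (at x within {a..b})" by simp
      moreover have "e * w x > 0" using \<open>e > 0\<close> by (simp add: w_def)
      ultimately obtain d where "d > 0" "\<forall>y\<in>{a..b}. 0 < dist y x \<and> dist y x < d \<longrightarrow> dist (f y - f x - (y - x) *\<^sub>R f' x) 0 < e * w x"
        unfolding Lim_within by blast
      then show ?thesis using True \<open>e * w x > 0\<close>
        by (intro exI[of _ d]) (force simp: dist_norm intro: less_imp_le)
    next
      case False
      then have "(f has_vector_derivative f' x) (at x)" using x derf by (auto simp: S_def)
      then have "\<exists>d>0. \<forall>y. norm (y - x) < d \<longrightarrow> norm (f y - f x - (y - x) *\<^sub>R f' x) \<le> e * norm (y - x)"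
        using \<open>e > 0\<close> unfolding has_vector_derivative_def has_derivative_at_alt by blast
      then show ?thesis using False by auto
    qed
    then have "\<forall>x\<in>{a..b}. \<exists>d>0. \<forall>y\<in>{a..b}. norm (y - x) < d \<longrightarrow>
             norm (f y - f x - (y - x) *\<^sub>R f' x) \<le> (if x \<in> S then e * w x else e * norm (y - x))"
      by blast
    from bchoice[OF this] obtain d where d: "\<And>x. x \<in> {a..b} \<Longrightarrow> d x > 0"
      "\<And>x y. x \<in> {a..b} \<Longrightarrow> y \<in> {a..b} \<Longrightarrow> norm (y - x) < d x \<Longrightarrow>
             norm (f y - f x - (y - x) *\<^sub>R f' x) \<le> (if x \<in> S then e * w x else e * norm (y - x))"
      by blast
    define g where "g = (\<lambda>x. ball x (if x \<in> {a..b} then d x else 1))"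
    show "\<exists>\<gamma>. gauge \<gamma> \<and> (\<forall>\<D>. \<D> tagged_division_of cbox a b \<and> \<gamma> fine \<D> \<longrightarrow>
            norm ((\<Sum>(x, K)\<in>\<D>. measure lborel K *\<^sub>R f' x) - (f b - f a)) < e0)"
    proof (intro exI[of _ g] conjI allI impI)
      show "gauge g" unfolding g_def using d(1) by (intro gauge_ball_dependent) auto
    next
      fix p assume p: "p tagged_division_of cbox a b \<and> g fine p"
      then have ptag: "p tagged_division_of cbox a b" and fp: "g fine p" by auto
      have finp: "finite p" using ptag by auto
      define q where "q = {(x, K). (x, K) \<in> p \<and> x \<in> S \<and> Inf K < Sup K}"
      have q_sub: "q \<subseteq> p" by (auto simp: q_def)
      have shape: "\<exists>u v. K = {u..v} \<and> u \<le> x \<and> x \<le> v \<and> a \<le> u \<and> v \<le> b" if "(x, K) \<in> p" for x K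
      proof -
        have "x \<in> K" "K \<subseteq> cbox a b" using ptag that by blast+
        moreover have "\<exists>u v. K = cbox u v" using tagged_division_ofD(4)[OF ptag that] .
        then obtain u v where "K = cbox u v" by blast
        ultimately show ?thesis by (intro exI[of _ u] exI[of _ v]) auto
      qed
      have term_le: "norm (measure lborel K *\<^sub>R f' x - (f (Sup K) - f (Inf K)))
            \<le> e * (Sup K - Inf K) + (if (x, K) \<in> q then 2 * (e * w x) else 0)" if xK: "(x, K) \<in> p" for x K
      proof -
        obtain u v where K: "K = {u..v}" "u \<le> x" "x \<le> v" "a \<le> u" "v \<le> b" using shape[OF xK] by auto
        have IS: "Inf K = u" "Sup K = v" "measure lborel K = v - u" using K by auto
        have "K \<subseteq> g x" using fp xK by auto
        then have "u \<in> g x" "v \<in> g x" using K by auto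
        then have du: "norm (u - x) < d x" and dv: "norm (v - x) < d x"
          using K by (auto simp: g_def dist_norm norm_minus_commute)
        let ?B = "\<lambda>y. if x \<in> S then e * w x else e * norm (y - x)"
        have "norm ((v - u) *\<^sub>R f' x - (f v - f u)) = norm ((f u - f x - (u - x) *\<^sub>R f' x) - (f v - f x - (v - x) *\<^sub>R f' x))"
          by (simp add: algebra_simps)
        also have "\<dots> \<le> norm (f u - f x - (u - x) *\<^sub>R f' x) + norm (f v - f x - (v - x) *\<^sub>R f' x)"
          by (rule norm_triangle_ineq4)
        also have "\<dots> \<le> ?B u + ?B v"
          using K du dv by (intro add_mono d(2)) auto
        finally have main: "norm ((v - u) *\<^sub>R f' x - (f v - f u)) \<le> ?B u + ?B v" .
        show ?thesis
        proof (cases "x \<in> S")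
          case False
          then have "?B u + ?B v = e * (v - u)" using K by (simp add: algebra_simps)
          then show ?thesis using main False IS by (simp add: q_def)
        next
          case True
          show ?thesis
          proof (cases "u < v")
            case True
            then have "(x, K) \<in> q" using xK \<open>x \<in> S\<close> IS by (simp add: q_def)
            moreover have "0 \<le> e * (v - u)" using \<open>e > 0\<close> K by simp
            ultimately show ?thesis using main \<open>x \<in> S\<close> IS by simp
          next
            case False
            then have "v = u" using K by simp
            then show ?thesis using IS \<open>e > 0\<close> by (auto simp: w_def)
          qed
        qed
      qed
      \<comment> \<open>A point tags at most two nondegenerate intervals of the division, one that
        reaches to its left and one that starts at it, since interiors are disjoint. Hence the code
        separates the elements of \<open>q\<close>, and each weight \<open>w x\<close> is at most
        the geometric term with that code as exponent.\<close>
      define enc where "enc = (\<lambda>(x, K). 2 * n x + (if Inf K < (x::real) then 1 else 0))"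
      have inj: "inj_on enc q"
      proof (rule inj_onI, clarify)
        fix x K y M assume xK: "(x, K) \<in> q" and yM: "(y, M) \<in> q" and eq: "enc (x, K) = enc (y, M)"
        have "n x = n y" and side: "Inf K < x \<longleftrightarrow> Inf M < y"
          using eq unfolding enc_def by (auto split: if_splits) presburger+
        then have "x = y" using inj_n xK yM by (auto simp: q_def inj_on_def)
        moreover have "K = M"
        proof (rule ccontr)
          assume "K \<noteq> M"
          then have disj: "interior K \<inter> interior M = {}"
            using ptag xK yM \<open>x = y\<close> unfolding tagged_division_of q_def by blast
          obtain u v where K: "K = {u..v}" "u \<le> x" "x \<le> v" using shape[of x K] xK q_sub by auto
          obtain u' v' where M: "M = {u'..v'}" "u' \<le> x" "x \<le> v'" using shape[of y M] yM q_sub \<open>x = y\<close> by auto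
          have uv: "u < v" "u' < v'" using xK yM K M by (auto simp: q_def)
          have "max u u' < min v v'"
            using side K M uv \<open>x = y\<close> by auto
          then have "(max u u' + min v v') / 2 \<in> interior K \<inter> interior M"
            using K M by (auto simp: interior_atLeastAtMost_real)
          then show False using disj by auto
        qed
        ultimately show "x = y \<and> K = M" by simp
      qed
      have "sum (\<lambda>(x, K). w x) q \<le> (\<Sum>z\<in>q. (1/2::real) ^ enc z)"
        by (rule sum_mono) (auto simp: enc_def w_def)
      also have "\<dots> = (\<Sum>i\<in>enc ` q. (1/2::real) ^ i)" using inj by (simp add: sum.reindex)
      also have "\<dots> \<le> (\<Sum>i. (1/2::real) ^ i)"
        using finite_subset[OF q_sub finp] by (intro sum_le_suminf) auto
      also have "\<dots> = 2" by (subst suminf_geometric) auto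
      finally have w2: "sum (\<lambda>(x, K). w x) q \<le> 2" .
      have "f b - f a = (\<Sum>(x,K)\<in>p. f (Sup K) - f (Inf K))" "b - a = (\<Sum>(x,K)\<in>p. Sup K - Inf K)"
        using additive_tagged_division_1[where f = f] additive_tagged_division_1[where f = "\<lambda>x. x"] \<open>a \<le> b\<close> ptag by auto
      then have "norm ((\<Sum>(x, K)\<in>p. measure lborel K *\<^sub>R f' x) - (f b - f a))
          = norm (\<Sum>(x, K)\<in>p. measure lborel K *\<^sub>R f' x - (f (Sup K) - f (Inf K)))"
        by (simp add: sum_subtractf case_prod_unfold)
      also have "\<dots> \<le> (\<Sum>(x, K)\<in>p. e * (Sup K - Inf K) + (if (x, K) \<in> q then 2 * (e * w x) else 0))"
        by (rule sum_norm_le) (use term_le in auto)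
      also have "\<dots> = e * (\<Sum>(x,K)\<in>p. Sup K - Inf K) + (\<Sum>z\<in>p. if z \<in> q then 2 * (e * w (fst z)) else 0)"
        by (simp add: case_prod_unfold sum.distrib sum_distrib_left)
      also have "(\<Sum>z\<in>p. if z \<in> q then 2 * (e * w (fst z)) else 0) = (\<Sum>z\<in>q. 2 * (e * w (fst z)))"
        using finp q_sub by (simp add: sum.inter_restrict[symmetric] Int_absorb1)
      also have "\<dots> = 2 * e * sum (\<lambda>(x, K). w x) q"
        by (simp add: sum_distrib_left case_prod_unfold mult.assoc)
      also have "e * (\<Sum>(x,K)\<in>p. Sup K - Inf K) + 2 * e * sum (\<lambda>(x, K). w x) q \<le> e * (b - a) + 2 * e * 2"
        using w2 \<open>e > 0\<close> \<open>b - a = _\<close> by (intro add_mono mult_left_mono) auto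
      also have "\<dots> = e * (b - a + 4)" by (simp add: algebra_simps)
      also have "\<dots> < e * (2 * (b - a + 8))"
        using \<open>e > 0\<close> \<open>a \<le> b\<close> by (intro mult_strict_left_mono) auto
      also have "\<dots> = e0" using \<open>a \<le> b\<close> by (simp add: e_def)
      finally show "norm ((\<Sum>(x, K)\<in>p. measure lborel K *\<^sub>R f' x) - (f b - f a)) < e0" .
    qed
  qed
qed

section \<open>Lengths of curves\<close>

fun polygon_length :: "(real \<Rightarrow> complex) \<Rightarrow> real list \<Rightarrow> ennreal" where
  "polygon_length g [] = 0"
| "polygon_length g [x] = 0"
| "polygon_length g (x # y # zs) = ennreal (dist (g x) (g y)) + polygon_length g (y # zs)"

lemma polygon_length_eq_sum:
  "polygon_length g ts = (\<Sum>i<length ts - 1. ennreal (dist (g (ts ! i)) (g (ts ! Suc i))))"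
proof (induction g ts rule: polygon_length.induct)
  case (3 g x y zs)
  then show ?case by (simp add: sum.lessThan_Suc_shift del: sum.lessThan_Suc sum_ennreal)
qed auto

lemma curve_length_eq: "curve_length g a b = (SUP ts\<in>{ts. sorted ts \<and> set ts \<subseteq> {a..b}}. polygon_length g ts)"
  by (simp add: curve_length_def polygon_length_eq_sum)

lemma polygon_length_append_ge: "polygon_length g ts + polygon_length g us \<le> polygon_length g (ts @ us)"
proof (induction g ts rule: polygon_length.induct)
  case (2 g x)
  then show ?case by (cases us) auto
qed (auto simp: add.assoc intro: add_left_mono)

lemma polygon_length_split: "polygon_length g (ts @ x # us) = polygon_length g (ts @ [x]) + polygon_length g (x # us)"
  by (induction g ts rule: polygon_length.induct) (auto simp: add.assoc)

lemma polygon_length_insert: "polygon_length g (ts @ us) \<le> polygon_length g (ts @ x # us)"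
proof (induction g ts rule: polygon_length.induct)
  case (1 g)
  then show ?case by (cases us) auto
next
  case (2 g y)
  show ?case
  proof (cases us)
    case (Cons z zs)
    have "ennreal (dist (g y) (g z)) \<le> ennreal (dist (g y) (g x) + dist (g x) (g z))"
      by (intro ennreal_leI dist_triangle)
    also have "\<dots> = ennreal (dist (g y) (g x)) + ennreal (dist (g x) (g z))" by (rule ennreal_plus) auto
    finally have "ennreal (dist (g y) (g z)) + polygon_length g (z # zs)
        \<le> (ennreal (dist (g y) (g x)) + ennreal (dist (g x) (g z))) + polygon_length g (z # zs)"
      by (rule add_right_mono)
    then show ?thesis using Cons by (simp only: append.simps polygon_length.simps add.assoc)
  qed simp
qed (auto intro: add_left_mono)

lemma polygon_length_map: "polygon_length (g \<circ> f) ts = polygon_length g (map f ts)"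
  by (induction ts rule: induct_list012) auto

lemma polygon_le_curve_length: "sorted ts \<Longrightarrow> set ts \<subseteq> {a..b} \<Longrightarrow> polygon_length g ts \<le> curve_length g a b"
  unfolding curve_length_eq by (rule SUP_upper) simp

lemma dist_le_curve_length:
  assumes "a \<le> x" "x \<le> y" "y \<le> b"
  shows "ennreal (dist (g x) (g y)) \<le> curve_length g a b"
  using polygon_le_curve_length[of "[x, y]" a b g] assms by simp

text \<open>One inequality inserts the point \<open>b\<close> into a polygon, which cannot shorten
  it; the other concatenates polygons of the two pieces.\<close>

lemma curve_length_add:
  assumes "a \<le> b" "b \<le> c"
  shows "curve_length g a c = curve_length g a b + curve_length g b c"
proof (rule antisym)
  show "curve_length g a c \<le> curve_length g a b + curve_length g b c"
    unfolding curve_length_eq[of g a c]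
  proof (rule SUP_least, clarify)
    fix ts assume ts: "sorted ts" "set ts \<subseteq> {a..c}"
    define us vs where uv: "us = takeWhile (\<lambda>x. x \<le> b) ts" "vs = dropWhile (\<lambda>x. x \<le> b) ts"
    have split: "ts = us @ vs" by (simp add: uv)
    have us: "\<forall>x\<in>set us. a \<le> x \<and> x \<le> b" using ts(2) by (auto simp: uv dest: set_takeWhileD)
    have vs: "\<forall>x\<in>set vs. b \<le> x \<and> x \<le> c"
    proof (cases vs)
      case (Cons y ys)
      then have "\<not> y \<le> b" unfolding uv by (metis dropWhile_eq_Cons_conv)
      moreover have "sorted (y # ys)" using ts(1) unfolding split Cons by (simp add: sorted_append)
      ultimately show ?thesis using Cons ts(2) split by auto
    qed simp
    have sorted: "sorted us" "sorted vs" using ts(1) unfolding split by (auto simp: sorted_append)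
    have "polygon_length g ts \<le> polygon_length g (us @ b # vs)" unfolding split by (rule polygon_length_insert)
    also have "\<dots> = polygon_length g (us @ [b]) + polygon_length g (b # vs)" by (rule polygon_length_split)
    also have "\<dots> \<le> curve_length g a b + curve_length g b c"
      using sorted us vs assms by (intro add_mono polygon_le_curve_length) (auto simp: sorted_append)
    finally show "polygon_length g ts \<le> curve_length g a b + curve_length g b c" .
  qed
next
  let ?A = "{ts. sorted ts \<and> set ts \<subseteq> {a..b}}" and ?B = "{ts. sorted ts \<and> set ts \<subseteq> {b..c}}"
  have ne: "?A \<noteq> {}" "?B \<noteq> {}" by (auto intro!: exI[of _ "[]"])
  have "polygon_length g ts + curve_length g b c \<le> curve_length g a c" if ts: "ts \<in> ?A" for ts
  proof -
    have "polygon_length g ts + polygon_length g us \<le> curve_length g a c" if us: "us \<in> ?B" for us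
    proof -
      have "sorted (ts @ us)" "set (ts @ us) \<subseteq> {a..c}" using ts us assms by (force simp: sorted_append)+
      then show ?thesis by (intro order_trans[OF polygon_length_append_ge] polygon_le_curve_length)
    qed
    then have "(SUP us\<in>?B. polygon_length g ts + polygon_length g us) \<le> curve_length g a c" by (rule SUP_least)
    then show ?thesis unfolding curve_length_eq[of g b c] using ne by (simp add: ennreal_SUP_add_right)
  qed
  then have "(SUP ts\<in>?A. polygon_length g ts + curve_length g b c) \<le> curve_length g a c" by (rule SUP_least)
  then show "curve_length g a b + curve_length g b c \<le> curve_length g a c"
    unfolding curve_length_eq[of g a b] using ne by (simp add: ennreal_SUP_add_left)
qed

lemma curve_length_le_Lipschitz:
  assumes lip: "\<And>x y. cmod (g x - g y) \<le> C * \<bar>x - y\<bar>" and "a \<le> b"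
  shows "curve_length g a b \<le> ennreal (C * (b - a))"
proof -
  have "0 \<le> cmod (g 1 - g 0)" by simp
  also have "\<dots> \<le> C" using lip[of 1 0] by simp
  finally have "C \<ge> 0" .
  have bound: "polygon_length g ts \<le> ennreal (C * (last ts - hd ts))" if "sorted ts" "ts \<noteq> []" for ts
    using that lip
  proof (induction g ts rule: polygon_length.induct)
    case (3 g x y zs)
    have xy: "x \<le> y" using 3(2) by simp
    have l: "y \<le> last (y # zs)" using 3(2) by (cases zs) auto
    have "ennreal (dist (g x) (g y)) \<le> ennreal (C * (y - x))"
      using 3(4)[of y x] xy by (intro ennreal_leI) (simp add: dist_norm norm_minus_commute)
    moreover have "polygon_length g (y # zs) \<le> ennreal (C * (last (y # zs) - y))"
      using 3 by auto
    ultimately have "polygon_length g (x # y # zs) \<le> ennreal (C * (y - x)) + ennreal (C * (last (y # zs) - y))"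
      by (simp add: add_mono)
    also have "\<dots> = ennreal (C * (y - x) + C * (last (y # zs) - y))"
      using \<open>C \<ge> 0\<close> xy l by (intro ennreal_plus[symmetric] mult_nonneg_nonneg) auto
    also have "C * (y - x) + C * (last (y # zs) - y) = C * (last (x # y # zs) - hd (x # y # zs))"
      by (simp add: algebra_simps)
    finally show ?case .
  qed auto
  show ?thesis unfolding curve_length_eq
  proof (rule SUP_least, clarify)
    fix ts assume ts: "sorted ts" "set ts \<subseteq> {a..b}"
    show "polygon_length g ts \<le> ennreal (C * (b - a))"
    proof (cases "ts = []")
      case False
      then have "last ts \<in> {a..b}" "hd ts \<in> {a..b}" using ts(2) by (meson last_in_set hd_in_set subsetD)+
      then have "last ts \<le> b" "a \<le> hd ts" by auto
      then have "C * (last ts - hd ts) \<le> C * (b - a)" using \<open>C \<ge> 0\<close> by (intro mult_left_mono) auto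
      then show ?thesis by (intro order_trans[OF bound[OF ts(1) False]] ennreal_leI)
    qed simp
  qed
qed

lemma curve_length_reparam:
  assumes "strict_mono \<tau>" "surj \<tau>"
  shows "curve_length (g \<circ> \<tau>) a b = curve_length g (\<tau> a) (\<tau> b)"
proof (rule antisym)
  have mono: "\<tau> x \<le> \<tau> y \<longleftrightarrow> x \<le> y" for x y using assms(1) by (rule strict_mono_less_eq)
  show "curve_length (g \<circ> \<tau>) a b \<le> curve_length g (\<tau> a) (\<tau> b)"
    unfolding curve_length_eq[of "g \<circ> \<tau>"] polygon_length_map
  proof (rule SUP_least, clarify)
    fix ts assume "sorted ts" "set ts \<subseteq> {a..b}"
    then show "polygon_length g (map \<tau> ts) \<le> curve_length g (\<tau> a) (\<tau> b)"
      by (intro polygon_le_curve_length) (auto simp: sorted_map mono sorted_wrt_iff_nth_less)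
  qed
  have inv: "\<tau> (inv \<tau> x) = x" for x using assms(2) by (rule surj_f_inv_f)
  have imono: "inv \<tau> x \<le> inv \<tau> y \<longleftrightarrow> x \<le> y" for x y using mono[of "inv \<tau> x" "inv \<tau> y"] by (simp add: inv)
  show "curve_length g (\<tau> a) (\<tau> b) \<le> curve_length (g \<circ> \<tau>) a b"
    unfolding curve_length_eq[of g]
  proof (rule SUP_least, clarify)
    fix ts assume ts: "sorted ts" "set ts \<subseteq> {\<tau> a..\<tau> b}"
    have "map \<tau> (map (inv \<tau>) ts) = ts" by (simp add: inv map_idI)
    then have "polygon_length g ts = polygon_length (g \<circ> \<tau>) (map (inv \<tau>) ts)"
      unfolding polygon_length_map by simp
    also have "\<dots> \<le> curve_length (g \<circ> \<tau>) a b"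
    proof (rule polygon_le_curve_length)
      show "sorted (map (inv \<tau>) ts)" using ts(1) by (simp add: sorted_wrt_iff_nth_less imono)
      show "set (map (inv \<tau>) ts) \<subseteq> {a..b}"
        using ts(2) mono[of a "inv \<tau> x" for x] mono[of "inv \<tau> x" b for x] by (auto simp: inv)
    qed
    finally show "polygon_length g ts \<le> curve_length (g \<circ> \<tau>) a b" .
  qed
qed

section \<open>Orientation of boundary triples\<close>

lemma cos_ge_quadratic: "1 - e\<^sup>2 / 2 \<le> cos (e::real)"
proof -
  have "\<bar>sin (e / 2)\<bar> \<le> \<bar>e / 2\<bar>" by (rule abs_sin_x_le_abs_x)
  then have "(sin (e / 2))\<^sup>2 \<le> (e / 2)\<^sup>2" unfolding abs_le_square_iff .
  moreover have "cos e = 1 - 2 * (sin (e / 2))\<^sup>2" using cos_double_sin[of "e / 2"] by simp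
  moreover have "(e / 2)\<^sup>2 = e\<^sup>2 / 4" by (simp add: power_divide)
  ultimately show ?thesis by linarith
qed

text \<open>Twice the signed area of the triangle with vertices \<open>a\<close>, \<open>b\<close>,
  \<open>c\<close>, positive for counter-clockwise order.\<close>

definition orient :: "complex \<Rightarrow> complex \<Rightarrow> complex \<Rightarrow> real" where
  "orient a b c = Im (cnj (b - a) * (c - a))"

lemma orient_rotate: "orient b c a = orient a b c"
  by (simp add: orient_def algebra_simps)

text \<open>The recurrent test for contradictions: a boundary point cannot lie strictly between an
  interior point and a point of the set.\<close>

lemma scaled_frontier_point_interior:
  fixes S :: "'a::euclidean_space set"
  assumes "convex S" "w \<in> interior S" "p \<in> S" "0 \<le> x" "x < 1"
  shows "w + x *\<^sub>R (p - w) \<in> interior S"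
proof -
  have "p - (1 - x) *\<^sub>R (p - w) \<in> interior S"
    using assms by (intro mem_interior_convex_shrink) auto
  then show ?thesis by (simp add: algebra_simps)
qed

text \<open>Cramer's rule for the coordinates of \<open>cis b\<close> in the frame
  \<open>cis a\<close>, \<open>cis k\<close>.\<close>

lemma cis_in_cone: "of_real (sin (k - a)) * cis b = of_real (sin (k - b)) * cis a + of_real (sin (b - a)) * cis k"
  by (simp add: complex_eq_iff sin_diff algebra_simps)

text \<open>The summands are twice the signed areas of the triangles that the three sides span with
  \<open>w\<close>.\<close>

lemma orient_polar:
  "orient (w + of_real ra * cis a) (w + of_real rb * cis b) (w + of_real rk * cis k)
     = ra * rb * sin (b - a) + rb * rk * sin (k - b) + ra * rk * sin (a - k)"
proof -
  have "Im (cnj p * q) = Re p * Im q - Im p * Re q" for p q by simp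
  then show ?thesis unfolding orient_def by (simp add: sin_diff) (simp add: algebra_simps)
qed

text \<open>The middle point is \<open>w\<close> plus positive multiples \<open>x\<close> and
  \<open>y\<close> of the two outer vectors. If \<open>x + y < 1\<close>, it would arise by
  shrinking a point of the segment between the outer points towards \<open>w\<close>, hence be
  interior; and the signed area is \<open>(x + y - 1) * D\<close>.\<close>

lemma orient_nonneg_narrow:
  assumes "convex \<Omega>" "w \<in> interior \<Omega>" "0 < ra" "0 < rb" "0 < rk"
    and abk: "a < b" "b < k" "k - a < pi"
    and fr: "w + of_real ra * cis a \<in> \<Omega>" "w + of_real rb * cis b \<in> frontier \<Omega>" "w + of_real rk * cis k \<in> \<Omega>"
  shows "0 \<le> orient (w + of_real ra * cis a) (w + of_real rb * cis b) (w + of_real rk * cis k)"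
proof -
  define D where "D = ra * rk * sin (k - a)"
  define x where "x = rb * rk * sin (k - b) / D"
  define y where "y = ra * rb * sin (b - a) / D"
  have "sin (k - a) > 0" "sin (k - b) > 0" "sin (b - a) > 0" using abk by (auto intro!: sin_gt_zero)
  then have D: "D > 0" and xy: "x > 0" "y > 0" using assms by (auto simp: D_def x_def y_def)
  have "of_real rb * cis b = of_real x * (of_real ra * cis a) + of_real y * (of_real rk * cis k)"
  proof -
    define s1 s2 s3 where s: "s1 = sin (k - a)" "s2 = sin (k - b)" "s3 = sin (b - a)"
    have xD: "x * D = rb * rk * s2" "y * D = ra * rb * s3" using D by (simp_all add: x_def y_def s)
    have "complex_of_real D * (of_real rb * cis b) = of_real (ra * rb * rk) * (of_real s1 * cis b)"
      by (simp add: D_def s mult_ac)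
    also have "of_real s1 * cis b = of_real s2 * cis a + of_real s3 * cis k"
      unfolding s by (rule cis_in_cone)
    also have "of_real (ra * rb * rk) * (of_real s2 * cis a + of_real s3 * cis k)
        = of_real (rb * rk * s2) * (of_real ra * cis a) + of_real (ra * rb * s3) * (of_real rk * cis k)"
      by (simp add: distrib_left mult_ac)
    finally have "complex_of_real D * (of_real rb * cis b) = of_real D * (of_real x * (of_real ra * cis a) + of_real y * (of_real rk * cis k))"
      unfolding xD[symmetric] by (simp add: distrib_left mult_ac)
    then show ?thesis using D by simp
  qed
  then have bxy: "w + of_real rb * cis b = w + x *\<^sub>R (of_real ra * cis a) + y *\<^sub>R (of_real rk * cis k)"
    by (simp add: scaleR_conv_of_real)
  have "x + y \<ge> 1"
  proof (rule ccontr)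
    assume "\<not> x + y \<ge> 1"
    define p where "p = (x / (x + y)) *\<^sub>R (w + of_real ra * cis a) + (y / (x + y)) *\<^sub>R (w + of_real rk * cis k)"
    have "p \<in> \<Omega>" unfolding p_def
      using xy by (intro convexD[OF \<open>convex \<Omega>\<close> fr(1) fr(3)]) (auto simp: add_divide_distrib[symmetric])
    then have "w + (x + y) *\<^sub>R (p - w) \<in> interior \<Omega>"
      using assms xy \<open>\<not> x + y \<ge> 1\<close> by (intro scaled_frontier_point_interior) auto
    moreover have "(x + y) *\<^sub>R p = x *\<^sub>R (w + of_real ra * cis a) + y *\<^sub>R (w + of_real rk * cis k)"
      using xy by (simp add: p_def scaleR_add_right[of "x + y"])
    then have "w + (x + y) *\<^sub>R (p - w) = w + of_real rb * cis b"
      unfolding bxy by (simp add: algebra_simps)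
    ultimately show False using fr(2) by (auto simp: frontier_def)
  qed
  moreover have "orient (w + of_real ra * cis a) (w + of_real rb * cis b) (w + of_real rk * cis k) = (x + y - 1) * D"
  proof -
    have "x * D = rb * rk * sin (k - b)" "y * D = ra * rb * sin (b - a)" using D by (simp_all add: x_def y_def)
    moreover have "ra * rk * sin (a - k) = - D" using sin_minus[of "k - a"] by (simp add: D_def)
    ultimately show ?thesis unfolding orient_polar by (simp add: algebra_simps)
  qed
  ultimately show ?thesis using D by simp
qed

lemma cis_plus_2pi: "cis (x + 2 * pi) = cis x"
  by (simp add: complex_eq_iff)

text \<open>Either one of the three angular gaps exceeds pi, and after a cyclic rotation the
  directions fit into less than a half-turn, or no gap does and every term of
  \<open>orient_polar\<close> is nonnegative.\<close>

lemma orient_nonneg: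
  assumes "convex \<Omega>" "w \<in> interior \<Omega>" "0 < ra" "0 < rb" "0 < rk"
    and abk: "a < b" "b < k" "k < a + 2 * pi" and "closed \<Omega>"
    and fr: "w + of_real ra * cis a \<in> frontier \<Omega>" "w + of_real rb * cis b \<in> frontier \<Omega>" "w + of_real rk * cis k \<in> frontier \<Omega>"
  shows "0 \<le> orient (w + of_real ra * cis a) (w + of_real rb * cis b) (w + of_real rk * cis k)"
proof -
  have mem: "w + of_real ra * cis a \<in> \<Omega>" "w + of_real rb * cis b \<in> \<Omega>" "w + of_real rk * cis k \<in> \<Omega>"
    using fr frontier_subset_closed[OF \<open>closed \<Omega>\<close>] by auto
  consider "k - a < pi" | "a + 2 * pi - b < pi" | "b + 2 * pi - k < pi" | "b - a \<le> pi" "k - b \<le> pi" "a + 2 * pi - k \<le> pi"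
    by linarith
  then show ?thesis
  proof cases
    case 1
    then show ?thesis using assms mem by (intro orient_nonneg_narrow[of \<Omega>]) auto
  next
    case 2
    have "0 \<le> orient (w + of_real rb * cis b) (w + of_real rk * cis k) (w + of_real ra * cis (a + 2 * pi))"
      using assms mem 2 by (intro orient_nonneg_narrow[of \<Omega>]) (auto simp: cis_plus_2pi)
    then show ?thesis by (simp add: orient_rotate cis_plus_2pi)
  next
    case 3
    have "0 \<le> orient (w + of_real rk * cis k) (w + of_real ra * cis (a + 2 * pi)) (w + of_real rb * cis (b + 2 * pi))"
      using assms mem 3 by (intro orient_nonneg_narrow[of \<Omega>]) (auto simp: cis_plus_2pi)
    then show ?thesis by (simp add: orient_rotate cis_plus_2pi)
  next
    case 4
    have "sin (a - k) = sin (a + 2 * pi - k)" by (simp add: sin_diff)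
    then have "sin (b - a) \<ge> 0" "sin (k - b) \<ge> 0" "sin (a - k) \<ge> 0"
      using 4 abk by (auto intro!: sin_ge_zero)
    then show ?thesis unfolding orient_polar using assms by simp
  qed
qed

text \<open>The difference starts at 0 and moves continuously, so it cannot leave
  \<open>[0, pi]\<close> without passing through angles with negative sine.\<close>

lemma continuous_sin_nonneg_imp_mono:
  fixes f :: "real \<Rightarrow> real"
  assumes cont: "continuous_on {a<..<b} f"
    and sin: "\<And>u v. a < u \<Longrightarrow> u < v \<Longrightarrow> v < b \<Longrightarrow> 0 \<le> sin (f v - f u)"
    and uv: "a < u" "u \<le> v" "v < b"
  shows "f u \<le> f v" "f v \<le> f u + pi"
proof -
  have ivt: "\<exists>x. u \<le> x \<and> x \<le> v \<and> f x - f u = y" if "(f u - f u \<le> y \<and> y \<le> f v - f u) \<or> (f v - f u \<le> y \<and> y \<le> f u - f u)" for y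
  proof -
    have "continuous_on {u..v} (\<lambda>x. f x - f u)"
      using uv by (intro continuous_intros continuous_on_subset[OF cont]) auto
    then show ?thesis using that uv IVT'[of "\<lambda>x. f x - f u" u y v] IVT2'[of "\<lambda>x. f x - f u" v y u] by auto
  qed
  have nonneg: "sin y \<ge> 0" if "u \<le> x" "x \<le> v" "f x - f u = y" for x y
    using that sin[of u x] uv by (cases "u = x") auto
  show "f u \<le> f v"
  proof (rule ccontr)
    assume "\<not> f u \<le> f v"
    \<comment> \<open>Clipping at \<open>- pi / 2\<close> selects an intermediate value in
      \<open>(- pi, 0)\<close>, where the sine is negative; the second bound clips at
      \<open>pi + pi / 2\<close> for the same reason.\<close>
    then have *: "f v - f u \<le> max (f v - f u) (- pi / 2)" "max (f v - f u) (- pi / 2) < 0" "- pi < max (f v - f u) (- pi / 2)"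
      using pi_gt_zero by (auto simp: less_max_iff_disj simp del: pi_gt_zero)
    with ivt[of "max (f v - f u) (- pi / 2)"] nonneg have "sin (max (f v - f u) (- pi / 2)) \<ge> 0" by auto
    moreover have "sin (max (f v - f u) (- pi / 2)) < 0"
      using * sin_gt_zero[of "- max (f v - f u) (- pi / 2)"] by auto
    ultimately show False by simp
  qed
  show "f v \<le> f u + pi"
  proof (rule ccontr)
    assume "\<not> f v \<le> f u + pi"
    define y where "y = min (f v - f u) (pi + pi / 2)"
    have *: "pi < y" "y < 2 * pi" "0 \<le> y" "y \<le> f v - f u" using \<open>\<not> f v \<le> f u + pi\<close> pi_gt_zero by (auto simp: y_def min_def simp del: pi_gt_zero)
    with ivt[of y] nonneg have "sin y \<ge> 0" by auto
    moreover have "sin y < 0" using sin_lt_zero[of y] * by simp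
    ultimately show False by simp
  qed
qed

lemma mono_on_tendsto_INF_at_right:
  fixes f :: "real \<Rightarrow> real"
  assumes mono: "mono_on {a<..<b} f" and bdd: "bdd_below (f ` {a<..<b})" and "a < b"
  shows "(f \<longlongrightarrow> (INF x\<in>{a<..<b}. f x)) (at_right a)"
proof (rule order_tendstoI)
  fix y assume y: "y < (INF x\<in>{a<..<b}. f x)"
  have "y < f x" if "x \<in> {a<..<b}" for x using cINF_lower[OF bdd that] y by simp
  then show "eventually (\<lambda>x. y < f x) (at_right a)"
    unfolding eventually_at_right_field using \<open>a < b\<close> by (intro exI[of _ b]) auto
next
  fix y assume "(INF x\<in>{a<..<b}. f x) < y"
  then obtain c where c: "c \<in> {a<..<b}" "f c < y"
    using cINF_less_iff[OF _ bdd] \<open>a < b\<close> by auto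
  have "f x < y" if "a < x" "x < c" for x
    using mono_onD[OF mono, of x c] c that by auto
  then show "eventually (\<lambda>x. f x < y) (at_right a)"
    unfolding eventually_at_right_field using c by (intro exI[of _ c]) auto
qed

lemma mono_on_tendsto_SUP_at_left:
  fixes f :: "real \<Rightarrow> real"
  assumes mono: "mono_on {a<..<b} f" and bdd: "bdd_above (f ` {a<..<b})" and "a < b"
  shows "(f \<longlongrightarrow> (SUP x\<in>{a<..<b}. f x)) (at_left b)"
proof (rule order_tendstoI)
  fix y assume y: "(SUP x\<in>{a<..<b}. f x) < y"
  have "f x < y" if "x \<in> {a<..<b}" for x using cSUP_upper[OF that bdd] y by simp
  then show "eventually (\<lambda>x. f x < y) (at_left b)"
    unfolding eventually_at_left_field using \<open>a < b\<close> by (intro exI[of _ a]) auto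
next
  fix y assume "y < (SUP x\<in>{a<..<b}. f x)"
  then obtain c where c: "c \<in> {a<..<b}" "y < f c"
    using less_cSUP_iff[OF _ bdd] \<open>a < b\<close> by auto
  have "y < f x" if "c < x" "x < b" for x
    using mono_onD[OF mono, of c x] c that by auto
  then show "eventually (\<lambda>x. y < f x) (at_left b)"
    unfolding eventually_at_left_field using c by (intro exI[of _ c]) auto
qed

section \<open>Existence of the parametrisation by arclength\<close>

text \<open>The signed length from 0 is strictly increasing, since no interval collapses to a point,
  and Lipschitz. Its inverse is the reparametrisation, and \<open>\<Lambda>\<close> is the length of
  one period.\<close>

lemma periodic_Lipschitz_arclength:
  fixes g :: "real \<Rightarrow> complex"
  assumes per: "\<And>x. g (x + p) = g x" and "0 < p"
    and lip: "\<And>x y. cmod (g x - g y) \<le> C * \<bar>x - y\<bar>"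
    and nonconst: "\<And>x y. x < y \<Longrightarrow> \<exists>z. x \<le> z \<and> z \<le> y \<and> g z \<noteq> g x"
  obtains \<Lambda> \<tau> where "0 < \<Lambda>" "strict_mono \<tau>" "surj \<tau>" "continuous_on UNIV \<tau>" "\<tau> 0 = 0"
    "\<And>t. \<tau> (t + \<Lambda>) = \<tau> t + p" "\<And>a b. a \<le> b \<Longrightarrow> curve_length (g \<circ> \<tau>) a b = ennreal (b - a)"
proof -
  have fin: "curve_length g a b < top" if "a \<le> b" for a b
    using curve_length_le_Lipschitz[OF lip that] by (auto intro: le_less_trans)
  have pos: "0 < curve_length g a b" if ab: "a < b" for a b
  proof -
    obtain z where z: "a \<le> z" "z \<le> b" "g z \<noteq> g a" using nonconst[OF ab] by blast
    have "0 < ennreal (dist (g a) (g z))" using z by simp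
    also have "\<dots> \<le> curve_length g a b" using z by (intro dist_le_curve_length) auto
    finally show ?thesis .
  qed
  define S where "S = (\<lambda>x. if 0 \<le> x then enn2real (curve_length g 0 x) else - enn2real (curve_length g x 0))"
  have e2r_add: "enn2real (curve_length g a c) = enn2real (curve_length g a b) + enn2real (curve_length g b c)"
    if "a \<le> b" "b \<le> c" for a b c
    unfolding curve_length_add[OF that] using fin that by (intro enn2real_plus) auto
  have S: "S b - S a = enn2real (curve_length g a b)" if "a \<le> b" for a b
    using that e2r_add[of 0 a b] e2r_add[of a b 0] e2r_add[of a 0 b] by (auto simp: S_def)
  have S_len: "curve_length g a b = ennreal (S b - S a)" if "a \<le> b" for a b
    unfolding S[OF that] using fin[OF that] by simp
  have S_mono: "S a < S b" if "a < b" for a b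
  proof -
    have "0 < enn2real (curve_length g a b)" using that pos[OF that] fin[of a b] by (simp add: enn2real_positive_iff)
    then show ?thesis using S[of a b] that by simp
  qed
  then have S_strict: "strict_mono S" by (rule strict_monoI)
  have S0: "S 0 = 0" using curve_length_le_Lipschitz[OF lip, of 0 0] by (simp add: S_def)
  have shift: "S (x + p) = S x + S p" for x
  proof -
    have diff: "S (y + p) - S (x + p) = S y - S x" if "x \<le> y" for x y
    proof -
      have "curve_length g x y = curve_length (g \<circ> (\<lambda>t. t + p)) x y" using per by (simp add: comp_def)
      also have "\<dots> = curve_length g (x + p) (y + p)"
        by (rule curve_length_reparam) (auto intro!: strict_monoI surjI[of _ "\<lambda>t. t - p"])
      finally show ?thesis using S[of x y] S[of "x + p" "y + p"] that by simp
    qed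
    show ?thesis using diff[of 0 x] diff[of x 0] S0 by (cases "0 \<le> x") auto
  qed
  have Sp: "0 < S p" using S_mono[OF \<open>0 < p\<close>] S0 by simp
  have S_lip: "\<bar>S x - S y\<bar> \<le> C * \<bar>x - y\<bar>" for x y
  proof -
    have *: "S y - S x \<le> C * (y - x)" if "x \<le> y" for x y
    proof -
      have "0 \<le> C * (y - x)" using order_trans[OF norm_ge_zero lip[of y x]] that by simp
      then show ?thesis using curve_length_le_Lipschitz[OF lip that] unfolding S_len[OF that] by (simp add: ennreal_le_iff)
    qed
    show ?thesis using *[of x y] *[of y x] strict_mono_less_eq[OF S_strict] by (cases "x \<le> y") auto
  qed
  have S_cont: "continuous_on A S" for A
  proof (rule continuous_on_subset[of UNIV])
    have "C-lipschitz_on UNIV S"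
    proof (rule lipschitz_onI)
      show "0 \<le> C" using S_lip[of 1 0] by simp
    qed (use S_lip in \<open>simp add: dist_real_def\<close>)
    then show "continuous_on UNIV S" by (rule lipschitz_on_continuous_on)
  qed simp
  have S_nat: "S (of_nat k * p) = of_nat k * S p \<and> S (- of_nat k * p) = - of_nat k * S p" for k
  proof (induction k)
    case (Suc k)
    then show ?case using shift[of "of_nat k * p"] shift[of "- of_nat (Suc k) * p"] by (auto simp: algebra_simps)
  qed (simp add: S0)
  have S_surj: "surj S"
  proof (rule surjI)
    fix y
    obtain k :: nat where k: "\<bar>y\<bar> \<le> of_nat k * S p"
      using real_arch_simple[of "\<bar>y\<bar> / S p"] Sp by (auto simp: pos_divide_le_eq)
    have "S (- of_nat k * p) \<le> y" "y \<le> S (of_nat k * p)" using S_nat[of k] k by auto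
    then have "\<exists>x. - of_nat k * p \<le> x \<and> x \<le> of_nat k * p \<and> S x = y"
      using \<open>0 < p\<close> by (intro IVT' S_cont) auto
    then show "S (SOME x. S x = y) = y" by (intro someI_ex[of "\<lambda>x. S x = y"]) blast
  qed
  define \<tau> where "\<tau> = inv S"
  have St: "S (\<tau> t) = t" for t unfolding \<tau>_def by (rule surj_f_inv_f[OF S_surj])
  have tS: "\<tau> (S x) = x" for x unfolding \<tau>_def by (rule inv_f_f[OF strict_mono_imp_inj_on[OF S_strict]])
  have t_mono: "\<tau> a < \<tau> b" if "a < b" for a b
    using that strict_mono_less[OF S_strict, of "\<tau> a" "\<tau> b"] by (simp add: St)
  then have t_strict: "strict_mono \<tau>" by (rule strict_monoI)
  have t_surj: "surj \<tau>" by (rule surjI[of _ S]) (rule tS)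
  show ?thesis
  proof (rule that[OF Sp t_strict t_surj])
    show "continuous_on UNIV \<tau>"
      by (rule continuous_onI_mono) (use t_surj strict_mono_less_eq[OF t_strict] in auto)
    show "\<tau> 0 = 0" using tS[of 0] S0 by simp
    show "\<tau> (t + S p) = \<tau> t + p" for t using tS[of "\<tau> t + p"] by (simp add: shift St)
    show "curve_length (g \<circ> \<tau>) a b = ennreal (b - a)" if "a \<le> b" for a b
      unfolding curve_length_reparam[OF t_strict t_surj]
      using S_len[of "\<tau> a" "\<tau> b"] strict_mono_less_eq[OF t_strict] that by (simp add: St)
  qed
qed

lemma cmod_cis_diff_le: "cmod (cis a - cis b) \<le> \<bar>a - b\<bar>"
proof (rule power2_le_imp_le)
  have "(cmod (cis a - cis b))\<^sup>2 = ((cos a)\<^sup>2 + (sin a)\<^sup>2) + ((cos b)\<^sup>2 + (sin b)\<^sup>2) - 2 * cos (a - b)"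
    unfolding cmod_power2 cos_diff by (simp add: power2_eq_square algebra_simps
      del: sin_cos_squared_add sin_cos_squared_add2 sin_cos_squared_add3)
  also have "\<dots> = 2 - 2 * cos (a - b)" by simp
  also have "\<dots> \<le> (a - b)\<^sup>2" using cos_ge_quadratic[of "a - b"] by simp
  finally show "(cmod (cis a - cis b))\<^sup>2 \<le> \<bar>a - b\<bar>\<^sup>2" by simp
qed simp

lemma cis_eq_iff: "cis a = cis b \<longleftrightarrow> (\<exists>k::int. a = b + 2 * pi * of_int k)"
  using sin_cos_eq_iff[of a b] by (auto simp: complex_eq_iff)

text \<open>Polar coordinates about \<open>w\<close>. The radius is Lipschitz because a disc of
  radius \<open>\<rho>\<close> about \<open>w\<close> lies in the interior: a boundary point much
  nearer to \<open>w\<close> than one in almost the same direction would be interior to the convex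
  hull of the disc and the farther point.\<close>

lemma radial_frontier_param:
  assumes "compact \<Omega>" "convex \<Omega>" and w: "w \<in> interior \<Omega>"
  obtains r C where "\<And>a. 0 < r a" "\<And>a. w + r a *\<^sub>R cis a \<in> frontier \<Omega>"
    "\<And>a. r (a + 2 * pi) = r a" "\<And>z. z \<in> frontier \<Omega> \<Longrightarrow> \<exists>a. z = w + r a *\<^sub>R cis a"
    "\<And>a b. cmod ((w + r a *\<^sub>R cis a) - (w + r b *\<^sub>R cis b)) \<le> C * \<bar>a - b\<bar>"
proof -
  have closed: "closed \<Omega>" using \<open>compact \<Omega>\<close> by (rule compact_imp_closed)
  have fr: "frontier \<Omega> \<subseteq> \<Omega>" by (rule frontier_subset_closed[OF closed])
  have "\<exists>d>0. w + d *\<^sub>R cis a \<in> frontier \<Omega>" for a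
    using ray_to_frontier[OF compact_imp_bounded[OF \<open>compact \<Omega>\<close>] w, of "cis a"] cis_neq_zero by metis
  then obtain r0 where r0: "\<And>a. 0 < r0 a" "\<And>a. w + r0 a *\<^sub>R cis a \<in> frontier \<Omega>" by metis
  have less: False if "w + s *\<^sub>R v \<in> frontier \<Omega>" "w + t *\<^sub>R v \<in> frontier \<Omega>" "0 < s" "s < t" for s t v
  proof -
    have "w + (s / t) *\<^sub>R ((w + t *\<^sub>R v) - w) \<in> interior \<Omega>"
      using that fr by (intro scaled_frontier_point_interior assms) auto
    then show False using that by (simp add: frontier_def)
  qed
  have unique: "s = t" if "w + s *\<^sub>R v \<in> frontier \<Omega>" "w + t *\<^sub>R v \<in> frontier \<Omega>" "0 < s" "0 < t" for s t v
    using less[OF that(1,2)] less[OF that(2,1)] that(3,4) by (cases s t rule: linorder_cases) auto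
  obtain \<rho> where \<rho>: "0 < \<rho>" "ball w \<rho> \<subseteq> interior \<Omega>"
    using openE[OF open_interior w] by blast
  obtain R where R: "\<And>z. z \<in> \<Omega> \<Longrightarrow> dist w z \<le> R"
    using compact_imp_bounded[OF \<open>compact \<Omega>\<close>] bounded_any_center[of \<Omega> w] by auto
  have r_le: "r0 a \<le> R" for a
    using R[of "w + r0 a *\<^sub>R cis a"] r0[of a] fr by (auto simp: dist_norm)
  have "R > 0" using r0(1)[of 0] r_le[of 0] by simp
  have one_sided: "\<rho> * (r0 a - r0 b) \<le> R * R * \<bar>a - b\<bar>" if "r0 b < r0 a" for a b
  proof -
    define l where "l = r0 b / r0 a"
    have l: "0 < l" "l < 1" "l * r0 a = r0 b" using r0(1)[of a] r0(1)[of b] that by (auto simp: l_def)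
    define x where "x = r0 b *\<^sub>R (cis b - cis a)"
    have "\<rho> * (1 - l) \<le> cmod x"
    proof (rule ccontr)
      assume *: "\<not> \<rho> * (1 - l) \<le> cmod x"
      \<comment> \<open>Solved so that the point at angle \<open>b\<close> divides the segment from
        \<open>y\<close> to the point at angle \<open>a\<close> in the ratio given by
        \<open>l\<close>; the contrary assumption puts \<open>y\<close> into the disc.\<close>
      define y where "y = w + (1 / (1 - l)) *\<^sub>R x"
      have "cmod x / (1 - l) < \<rho>" using * l by (simp add: pos_divide_less_eq)
      then have "y \<in> interior \<Omega>" using \<rho>(2) l by (intro subsetD[OF \<rho>(2)]) (simp add: y_def dist_norm)
      then have "y + l *\<^sub>R ((w + r0 a *\<^sub>R cis a) - y) \<in> interior \<Omega>"
        using l r0(2)[of a] fr by (intro scaled_frontier_point_interior assms) auto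
      moreover have "y + l *\<^sub>R ((w + r0 a *\<^sub>R cis a) - y) = w + r0 b *\<^sub>R cis b"
      proof -
        have 1: "y + l *\<^sub>R ((w + r0 a *\<^sub>R cis a) - y) = w + (1 - l) *\<^sub>R (y - w) + (l * r0 a) *\<^sub>R cis a"
          by (simp add: algebra_simps)
        have 2: "(1 - l) *\<^sub>R (y - w) = x" using l by (simp add: y_def)
        show ?thesis unfolding 1 2 l(3) by (simp add: x_def algebra_simps)
      qed
      ultimately show False using r0(2)[of b] by (simp add: frontier_def)
    qed
    then have "r0 a * (\<rho> * (1 - l)) \<le> r0 a * cmod x" using r0(1)[of a] by (intro mult_left_mono) auto
    also have "r0 a * (\<rho> * (1 - l)) = \<rho> * (r0 a - r0 b)" using l(3) by (simp add: algebra_simps)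
    also have "r0 a * cmod x = r0 a * r0 b * cmod (cis b - cis a)" using r0(1)[of b] by (simp add: x_def)
    also have "\<dots> \<le> R * R * \<bar>a - b\<bar>"
      using r_le r0(1)[of a] r0(1)[of b] \<open>R > 0\<close> cmod_cis_diff_le[of b a]
      by (intro mult_mono) (auto simp: less_imp_le abs_minus_commute)
    finally show ?thesis .
  qed
  have r_lip: "\<bar>r0 a - r0 b\<bar> \<le> R * R / \<rho> * \<bar>a - b\<bar>" for a b
  proof -
    have "\<rho> * \<bar>r0 a - r0 b\<bar> \<le> R * R * \<bar>a - b\<bar>"
      using one_sided[of a b] one_sided[of b a] by (cases "r0 a" "r0 b" rule: linorder_cases) (auto simp: abs_minus_commute)
    then show ?thesis using \<rho>(1) by (simp add: field_simps)
  qed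
  \<comment> \<open>In the Lipschitz constant, \<open>R * R / \<rho>\<close> accounts for the change
    of radius and \<open>R\<close> for the rotation of a vector of length at most
    \<open>R\<close>.\<close>
  show ?thesis
  proof (rule that[of r0 "R * R / \<rho> + R"])
    show "0 < r0 a" "w + r0 a *\<^sub>R cis a \<in> frontier \<Omega>" for a by (rule r0)+
    show "r0 (a + 2 * pi) = r0 a" for a
      using r0(2)[of "a + 2 * pi"] r0 by (intro unique[of _ "cis a"]) (auto simp: cis_plus_2pi)
    show "\<exists>a. z = w + r0 a *\<^sub>R cis a" if z: "z \<in> frontier \<Omega>" for z
    proof -
      have "z \<noteq> w" using w z by (auto simp: frontier_def)
      define s where "s = cmod (z - w)"
      have zs: "z = w + s *\<^sub>R cis (Arg (z - w))"
        using \<open>z \<noteq> w\<close> by (simp add: s_def cis_Arg sgn_eq scaleR_conv_of_real)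
      have "s = r0 (Arg (z - w))"
        using z r0 \<open>z \<noteq> w\<close> zs by (intro unique[of _ "cis (Arg (z - w))"]) (auto simp: s_def)
      then show ?thesis using zs by metis
    qed
    show "cmod ((w + r0 a *\<^sub>R cis a) - (w + r0 b *\<^sub>R cis b)) \<le> (R * R / \<rho> + R) * \<bar>a - b\<bar>" for a b
    proof -
      have "(w + r0 a *\<^sub>R cis a) - (w + r0 b *\<^sub>R cis b) = (r0 a - r0 b) *\<^sub>R cis a + r0 b *\<^sub>R (cis a - cis b)"
        by (simp add: algebra_simps)
      also have "cmod \<dots> \<le> cmod ((r0 a - r0 b) *\<^sub>R cis a) + cmod (r0 b *\<^sub>R (cis a - cis b))"
        by (rule norm_triangle_ineq)
      also have "\<dots> = \<bar>r0 a - r0 b\<bar> + r0 b * cmod (cis a - cis b)" using r0(1)[of b] by simp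
      also have "\<dots> \<le> R * R / \<rho> * \<bar>a - b\<bar> + R * \<bar>a - b\<bar>"
        using r_le[of b] \<open>R > 0\<close> by (intro add_mono r_lip mult_mono cmod_cis_diff_le) auto
      finally show ?thesis by (simp add: distrib_right)
    qed
  qed
qed

text \<open>The radial curve is reparametrised by its own length. Its winding number about
  \<open>w\<close> is read off from an explicit logarithm whose imaginary part is the polar angle;
  connectedness of the interior carries the value to all other interior points.\<close>

theorem arclength_param_exists:
  assumes "compact \<Omega>" "convex \<Omega>" "interior \<Omega> \<noteq> {}"
  shows "\<exists>L \<gamma>. arclength_param \<Omega> L \<gamma>"
proof -
  obtain w where w: "w \<in> interior \<Omega>" using assms(3) by auto
  obtain r C where r_pos: "\<And>a. 0 < r a" and r_fr: "\<And>a. w + r a *\<^sub>R cis a \<in> frontier \<Omega>"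
    and r_per: "\<And>a. r (a + 2 * pi) = r a" and r_surj: "\<And>z. z \<in> frontier \<Omega> \<Longrightarrow> \<exists>a. z = w + r a *\<^sub>R cis a"
    and r_lip: "\<And>a b. cmod ((w + r a *\<^sub>R cis a) - (w + r b *\<^sub>R cis b)) \<le> C * \<bar>a - b\<bar>"
    by (rule radial_frontier_param[OF assms(1,2) w]) blast
  define g where "g = (\<lambda>a. w + r a *\<^sub>R cis a)"
  have g_dir: "sgn (g a - w) = cis a" for a
    using r_pos[of a] by (simp add: g_def sgn_eq scaleR_conv_of_real norm_mult)
  have g_eq: "\<exists>k::int. a = b + 2 * pi * of_int k" if "g a = g b" for a b
    using g_dir[of a] g_dir[of b] that by (simp add: cis_eq_iff[symmetric])
  have g_per: "g (a + 2 * pi) = g a" for a by (simp add: g_def r_per cis_plus_2pi)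
  have g_lip: "cmod (g x - g y) \<le> C * \<bar>x - y\<bar>" for x y unfolding g_def by (rule r_lip)
  have nonconst: "\<exists>z. x \<le> z \<and> z \<le> y \<and> g z \<noteq> g x" if "x < y" for x y
  proof (intro exI conjI)
    \<comment> \<open>An increment of at most 1 is less than a full turn, so the direction from
      \<open>w\<close> has changed.\<close>
    let ?z = "min y (x + 1)"
    show "x \<le> ?z" "?z \<le> y" using that by auto
    show "g ?z \<noteq> g x"
    proof
      assume "g ?z = g x"
      then obtain k :: int where k: "?z = x + 2 * pi * of_int k" using g_eq by blast
      have "x < ?z" "?z \<le> x + 1" using that by auto
      then have "0 < 2 * pi * of_int k" "2 * pi * of_int k < 2 * pi * 1" using k pi_gt3 by linarith+
      then have "0 < (of_int k :: real)" "of_int k < (1::real)"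
        by (simp_all only: mult_less_cancel_left_pos zero_less_mult_iff) auto
      then have "0 < k" "k < 1" by auto
      then show False by simp
    qed
  qed
  have param: "\<exists>\<Lambda> \<tau>. 0 < \<Lambda> \<and> strict_mono \<tau> \<and> surj \<tau> \<and> continuous_on UNIV \<tau> \<and> \<tau> 0 = 0 \<and>
      (\<forall>t. \<tau> (t + \<Lambda>) = \<tau> t + 2 * pi) \<and> (\<forall>a b. a \<le> b \<longrightarrow> curve_length (g \<circ> \<tau>) a b = ennreal (b - a))"
  proof (rule periodic_Lipschitz_arclength[OF g_per _ g_lip nonconst])
    fix \<Lambda> \<tau>
    assume *: "0 < \<Lambda>" "strict_mono \<tau>" "surj \<tau>" "continuous_on UNIV \<tau>" "\<tau> 0 = 0"
      "\<And>t. \<tau> (t + \<Lambda>) = \<tau> t + 2 * pi" "\<And>a b. a \<le> b \<Longrightarrow> curve_length (g \<circ> \<tau>) a b = ennreal (b - a)"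
    show "\<exists>\<Lambda> \<tau>. 0 < \<Lambda> \<and> strict_mono \<tau> \<and> surj \<tau> \<and> continuous_on UNIV \<tau> \<and> \<tau> 0 = 0 \<and>
      (\<forall>t. \<tau> (t + \<Lambda>) = \<tau> t + 2 * pi) \<and> (\<forall>a b. a \<le> b \<longrightarrow> curve_length (g \<circ> \<tau>) a b = ennreal (b - a))"
      by (rule exI[of _ \<Lambda>], rule exI[of _ \<tau>]) (intro conjI allI impI *)
  qed auto
  obtain \<Lambda> \<tau> where \<Lambda>: "0 < \<Lambda>" and t: "strict_mono \<tau>" "surj \<tau>" "continuous_on UNIV \<tau>" "\<tau> 0 = 0"
    "\<And>t. \<tau> (t + \<Lambda>) = \<tau> t + 2 * pi" and len: "\<And>a b. a \<le> b \<Longrightarrow> curve_length (g \<circ> \<tau>) a b = ennreal (b - a)"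
    using param by blast
  let ?p = "\<lambda>u. (g \<circ> \<tau>) (\<Lambda> * u)"
  have g_cont: "continuous_on UNIV g"
  proof (rule lipschitz_on_continuous_on)
    show "C-lipschitz_on UNIV g"
    proof (rule lipschitz_onI)
      show "dist (g x) (g y) \<le> C * dist x y" for x y using r_lip[of x y] by (simp add: g_def dist_norm)
      show "0 \<le> C" using r_lip[of 1 0] by (simp add: order_trans[OF norm_ge_zero])
    qed
  qed
  have tL: "continuous_on S (\<lambda>u. \<tau> (\<Lambda> * u))" for S
    by (rule continuous_on_compose2[OF t(3)]) (auto intro!: continuous_intros)
  have p_cont: "continuous_on S ?p" for S
    unfolding comp_def by (rule continuous_on_compose2[OF g_cont tL]) auto
  have t_le: "\<tau> x \<le> \<tau> y \<longleftrightarrow> x \<le> y" for x y by (rule strict_mono_less_eq[OF t(1)])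
  have t\<Lambda>: "\<tau> \<Lambda> = 2 * pi" using t(5)[of 0] t(4) by simp
  have t_range: "0 \<le> \<tau> (\<Lambda> * u) \<and> \<tau> (\<Lambda> * u) \<le> 2 * pi" if "u \<in> {0..1}" for u
    using that \<Lambda> t_le[of 0 "\<Lambda> * u"] t_le[of "\<Lambda> * u" \<Lambda>] t(4) t\<Lambda> by simp
  have path: "path ?p" unfolding path_def by (rule p_cont)
  have loop: "pathfinish ?p = pathstart ?p"
    using g_per[of 0] by (simp add: pathfinish_def pathstart_def t(4) t\<Lambda>)
  have simple: "simple_path ?p" unfolding simple_path_def loop_free_def
  proof (intro conjI ballI impI path)
    fix u v assume uv: "u \<in> {0..1}" "v \<in> {0..1}" "?p u = ?p v"
    then obtain k :: int where k: "\<tau> (\<Lambda> * u) = \<tau> (\<Lambda> * v) + 2 * pi * of_int k" using g_eq by auto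
    have inj: "x = y" if "\<tau> (\<Lambda> * x) = \<tau> (\<Lambda> * y)" for x y
      using strict_mono_eq[OF t(1)] that \<Lambda> by simp
    have ends: "\<tau> (\<Lambda> * 0) = 0" "\<tau> (\<Lambda> * 1) = 2 * pi" using t(4) t\<Lambda> by auto
    have "2 * pi * of_int k \<le> 2 * pi * 1" "2 * pi * (- of_int k) \<le> 2 * pi * 1"
      using k t_range[OF uv(1)] t_range[OF uv(2)] by linarith+
    then have "of_int k \<le> (1::real)" "- of_int k \<le> (1::real)" by (simp_all only: mult_le_cancel_left_pos mult_pos_pos pi_gt_zero zero_less_numeral)
    then have "\<bar>k\<bar> \<le> 1" by linarith
    then consider "k = 0" | "k = 1" | "k = -1" by linarith
    then show "u = v \<or> u = 0 \<and> v = 1 \<or> u = 1 \<and> v = 0"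
    proof cases
      case 1
      then show ?thesis using inj[of u v] k by simp
    next
      case 2
      then have "\<tau> (\<Lambda> * u) = 2 * pi" "\<tau> (\<Lambda> * v) = 0" using k t_range[OF uv(1)] t_range[OF uv(2)] by auto
      then show ?thesis using inj[of u 1] inj[of v 0] ends by simp
    next
      case 3
      then have "\<tau> (\<Lambda> * v) = 2 * pi" "\<tau> (\<Lambda> * u) = 0" using k t_range[OF uv(1)] t_range[OF uv(2)] by auto
      then show ?thesis using inj[of v 1] inj[of u 0] ends by simp
    qed
  qed
  have image: "path_image ?p = frontier \<Omega>"
  proof (intro equalityI subsetI)
    fix z assume "z \<in> path_image ?p"
    then show "z \<in> frontier \<Omega>" using r_fr by (auto simp: path_image_def g_def)
  next
    fix z assume "z \<in> frontier \<Omega>"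
    then obtain a where a: "z = g a" using r_surj by (auto simp: g_def)
    define m where "m = \<lfloor>a / (2 * pi)\<rfloor>"
    define b where "b = a - 2 * pi * of_int m"
    have b: "0 \<le> b" "b \<le> 2 * pi"
      using floor_divide_lower[of "2 * pi" a] floor_divide_upper[of "2 * pi" a] by (auto simp: b_def m_def algebra_simps)
    have g_nat: "g (x + of_nat n * (2 * pi)) = g x" for x n
    proof (induction n)
      case (Suc n)
      then show ?case using g_per[of "x + of_nat n * (2 * pi)"] by (simp add: algebra_simps)
    qed simp
    have "g b = g a"
    proof (cases "m \<ge> 0")
      case True
      then show ?thesis using g_nat[of b "nat m"] by (simp add: b_def algebra_simps)
    next
      case False
      then show ?thesis using g_nat[of a "nat (- m)"] by (simp add: b_def algebra_simps)
    qed
    obtain s where s: "\<tau> s = b" using surjD[OF t(2), of b] by metis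
    have "0 \<le> s" "s \<le> \<Lambda>" using t_le[of 0 s] t_le[of s \<Lambda>] s b t(4) t\<Lambda> by auto
    moreover have "z = ?p (s / \<Lambda>)" using a \<open>g b = g a\<close> s \<Lambda> by simp
    ultimately show "z \<in> path_image ?p" using \<Lambda> unfolding path_image_def by (intro image_eqI[of _ _ "s / \<Lambda>"]) auto
  qed
  have winding_w: "winding_number ?p w = 1"
  proof -
    define q where "q = (\<lambda>u. of_real (ln (cmod (?p u - w))) + \<i> * of_real (\<tau> (\<Lambda> * u)))"
    have nz: "cmod (?p u - w) > 0" for u using r_pos[of "\<tau> (\<Lambda> * u)"] by (simp add: g_def)
    have q_path: "path q" unfolding path_def q_def
      using nz by (intro continuous_intros p_cont tL) (metis less_irrefl)
    have "?p u - w = (exp \<circ> q) u" for u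
    proof -
      have "(exp \<circ> q) u = of_real (cmod (?p u - w)) * cis (\<tau> (\<Lambda> * u))"
        using nz[of u] unfolding q_def comp_def by (simp add: exp_add exp_of_real cis_conv_exp)
      also have "\<dots> = ?p u - w" using r_pos[of "\<tau> (\<Lambda> * u)"] by (simp add: g_def scaleR_conv_of_real norm_mult)
      finally show ?thesis by simp
    qed
    then have "winding_number ?p w = winding_number (exp \<circ> q) 0"
      by (subst winding_number_offset) presburger
    also have "\<dots> = (pathfinish q - pathstart q) / (2 * of_real pi * \<i>)" by (rule winding_number_compose_exp[OF q_path])
    also have "pathfinish q - pathstart q = 2 * of_real pi * \<i>"
      using loop by (simp add: q_def pathfinish_def pathstart_def t(4) t\<Lambda>)
    finally show ?thesis by simp
  qed
  have winding: "winding_number ?p z = 1" if "z \<in> interior \<Omega>" for z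
  proof -
    have "winding_number ?p z = winding_number ?p w"
    proof (rule winding_number_eq[OF path loop that w])
      show "connected (interior \<Omega>)" using assms(2) by (intro convex_connected convex_interior)
      show "interior \<Omega> \<inter> path_image ?p = {}" unfolding image by (auto simp: frontier_def)
    qed
    then show ?thesis using winding_w by simp
  qed
  have "arclength_param \<Omega> \<Lambda> (g \<circ> \<tau>)"
    unfolding arclength_param_def using \<Lambda> simple image winding len t(5) g_per by auto
  then show ?thesis by blast
qed

locale convex_body =
  fixes \<Omega> :: "complex set"
  assumes compact: "compact \<Omega>" and convex: "convex \<Omega>" and interior_nonempty: "interior \<Omega> \<noteq> {}"
begin

abbreviation "L \<equiv> perimeter \<Omega>"
abbreviation "\<gamma> \<equiv> bd_curve \<Omega>"

text \<open>The curve in the definitions is an arbitrary choice; existence makes it a genuine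
  parametrisation, and all later facts about \<open>\<gamma>\<close> rest on this.\<close>

lemma arclength_param: "arclength_param \<Omega> L \<gamma>"
  using arclength_param_exists[OF compact convex interior_nonempty]
  unfolding perimeter_def bd_curve_def bd_param_def
  by (intro someI_ex[of "\<lambda>p. arclength_param \<Omega> (fst p) (snd p)"]) auto

lemma L_pos: "0 < L" and gamma_periodic: "\<gamma> (t + L) = \<gamma> t"
  and gamma_simple: "simple_path (\<lambda>u. \<gamma> (L * u))"
  and gamma_image: "path_image (\<lambda>u. \<gamma> (L * u)) = frontier \<Omega>"
  and gamma_winding: "w \<in> interior \<Omega> \<Longrightarrow> winding_number (\<lambda>u. \<gamma> (L * u)) w = 1"
  and gamma_length: "a \<le> b \<Longrightarrow> curve_length \<gamma> a b = ennreal (b - a)"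
  using arclength_param unfolding arclength_param_def by auto

lemma closed: "closed \<Omega>"
  using compact by (rule compact_imp_closed)

lemma gamma_periodic_nat: "\<gamma> (t + of_nat n * L) = \<gamma> t"
proof (induction n)
  case (Suc n)
  then show ?case using gamma_periodic[of "t + of_nat n * L"] by (simp add: algebra_simps)
qed simp

lemma gamma_periodic_int: "\<gamma> (t + of_int k * L) = \<gamma> t"
proof (cases "k \<ge> 0")
  case True
  then show ?thesis using gamma_periodic_nat[of t "nat k"] by simp
next
  case False
  then show ?thesis using gamma_periodic_nat[of "t + of_int k * L" "nat (- k)"] by (simp add: algebra_simps)
qed

lemma gamma_reduce:
  obtains k :: int where "0 \<le> t - of_int k * L" "t - of_int k * L < L" "\<gamma> (t - of_int k * L) = \<gamma> t"
proof
  show "0 \<le> t - of_int \<lfloor>t / L\<rfloor> * L" "t - of_int \<lfloor>t / L\<rfloor> * L < L"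
    using floor_divide_lower[OF L_pos, of t] floor_divide_upper[OF L_pos, of t] by (simp_all add: algebra_simps)
  show "\<gamma> (t - of_int \<lfloor>t / L\<rfloor> * L) = \<gamma> t"
    using gamma_periodic_int[of t "- \<lfloor>t / L\<rfloor>"] by simp
qed

lemma gamma_image_period: "\<gamma> ` {0..<L} = frontier \<Omega>"
proof -
  have "x \<in> \<gamma> ` {0..<L}" if "x \<in> frontier \<Omega>" for x
  proof -
    have "x \<in> path_image (\<lambda>u. \<gamma> (L * u))" using that gamma_image by simp
    then obtain u where "x = \<gamma> (L * u)" by (auto simp: path_image_def)
    then show ?thesis by (metis gamma_reduce atLeastLessThan_iff image_eqI)
  qed
  moreover have "\<gamma> t \<in> frontier \<Omega>" if "t \<in> {0..<L}" for t
    using that L_pos by (subst gamma_image[symmetric]) (auto simp: path_image_def intro!: image_eqI[of _ _ "t / L"])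
  ultimately show ?thesis by auto
qed

lemma gamma_frontier: "\<gamma> t \<in> frontier \<Omega>"
  by (metis gamma_reduce atLeastLessThan_iff image_eqI gamma_image_period)

lemma gamma_Lipschitz: "a \<le> b \<Longrightarrow> cmod (\<gamma> b - \<gamma> a) \<le> b - a"
proof -
  assume "a \<le> b"
  have "ennreal (dist (\<gamma> a) (\<gamma> b)) = (\<Sum>i<length [a, b] - 1. ennreal (dist (\<gamma> ([a, b] ! i)) (\<gamma> ([a, b] ! Suc i))))"
    by simp
  also have "\<dots> \<le> curve_length \<gamma> a b"
    unfolding curve_length_def using \<open>a \<le> b\<close> by (intro SUP_upper) auto
  finally show ?thesis using gamma_length[OF \<open>a \<le> b\<close>] \<open>a \<le> b\<close>
    by (simp add: dist_norm norm_minus_commute)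
qed

lemma gamma_continuous: "continuous_on S \<gamma>"
proof -
  have "dist (\<gamma> a) (\<gamma> b) \<le> 1 * dist a b" for a b
    using gamma_Lipschitz[of a b] gamma_Lipschitz[of b a]
    by (cases "a \<le> b") (auto simp: dist_norm norm_minus_commute)
  then have "1-lipschitz_on S \<gamma>" by (intro lipschitz_onI) auto
  then show ?thesis by (rule lipschitz_on_continuous_on)
qed

lemma gamma_inj_period:
  assumes "0 \<le> s" "s < L" "0 \<le> t" "t < L" "\<gamma> s = \<gamma> t"
  shows "s = t"
proof -
  have "s / L \<in> {0..1}" "t / L \<in> {0..1}" "\<gamma> (L * (s / L)) = \<gamma> (L * (t / L))"
    using assms L_pos by (auto simp: field_simps)
  then have "s / L = t / L \<or> s / L = 0 \<and> t / L = 1 \<or> s / L = 1 \<and> t / L = 0"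
    using gamma_simple unfolding simple_path_def loop_free_def by blast
  then show ?thesis using assms L_pos by auto
qed

lemma gamma_eq_iff: "\<gamma> s = \<gamma> t \<longleftrightarrow> (\<exists>k::int. t = s + of_int k * L)"
proof
  assume eq: "\<gamma> s = \<gamma> t"
  obtain k where k: "0 \<le> s - of_int k * L" "s - of_int k * L < L" "\<gamma> (s - of_int k * L) = \<gamma> s"
    by (rule gamma_reduce)
  obtain l where l: "0 \<le> t - of_int l * L" "t - of_int l * L < L" "\<gamma> (t - of_int l * L) = \<gamma> t"
    by (rule gamma_reduce)
  have "s - of_int k * L = t - of_int l * L" using gamma_inj_period k l eq by simp
  then show "\<exists>k::int. t = s + of_int k * L" by (intro exI[of _ "l - k"]) (simp add: algebra_simps)
qed (use gamma_periodic_int in auto)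

lemma gamma_neq: "s < t \<Longrightarrow> t < s + L \<Longrightarrow> \<gamma> s \<noteq> \<gamma> t"
proof
  assume st: "s < t" "t < s + L" and "\<gamma> s = \<gamma> t"
  then obtain k :: int where k: "t = s + of_int k * L" using gamma_eq_iff by auto
  with st L_pos have "0 < of_int k * L" "of_int k * L < 1 * L" by auto
  then have "0 < (of_int k :: real)" "of_int k < (1::real)" using L_pos by (auto simp: zero_less_mult_iff)
  then have "0 < k" "k < 1" by auto
  then show False by simp
qed

section \<open>Chord angles of a convex curve\<close>

text \<open>The argument as seen from an interior point. It is injective because a ray from
  \<open>w\<close> meets the boundary only once; a continuous injective function is monotone, and
  winding number 1 fixes its sense and its increment.\<close>

lemma polar_lift:
  obtains w \<theta> where "w \<in> interior \<Omega>"
    "\<And>t. 0 \<le> t \<Longrightarrow> t \<le> L \<Longrightarrow> \<gamma> t = w + of_real (cmod (\<gamma> t - w)) * cis (\<theta> t)"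
    "\<And>s t. 0 \<le> s \<Longrightarrow> s < t \<Longrightarrow> t \<le> L \<Longrightarrow> \<theta> s < \<theta> t" "\<theta> L = \<theta> 0 + 2 * pi"
proof -
  obtain w where w: "w \<in> interior \<Omega>" using interior_nonempty by auto
  have "w \<notin> path_image (\<lambda>u. \<gamma> (L * u))" using w gamma_image by (auto simp: frontier_def)
  then obtain q where q: "path q"
    "pathfinish q - pathstart q = 2 * of_real pi * \<i> * winding_number (\<lambda>u. \<gamma> (L * u)) w"
    "\<And>u. u \<in> {0..1} \<Longrightarrow> \<gamma> (L * u) = w + exp (q u)"
    by (rule winding_number_as_continuous_log[OF simple_path_imp_path[OF gamma_simple]]) blast
  define h where "h = (\<lambda>u. Im (q u))"
  have h01: "h 1 = h 0 + 2 * pi"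
    using arg_cong[OF q(2), of Im] gamma_winding[OF w] by (simp add: h_def pathfinish_def pathstart_def)
  have conth: "continuous_on {0..u} h" if "u \<le> 1" for u
  proof (rule continuous_on_subset)
    show "continuous_on {0..1} h" using q(1) unfolding path_def h_def by (intro continuous_intros)
  qed (use that in auto)
  have pol: "\<gamma> (L * u) = w + of_real (cmod (\<gamma> (L * u) - w)) * cis (h u)" if "u \<in> {0..1}" for u
  proof -
    have e: "\<gamma> (L * u) - w = exp (q u)" using q(3)[OF that] by simp
    have p: "of_real (cmod (exp (q u))) * cis (h u) = exp (q u)" unfolding h_def by (simp add: exp_eq_polar norm_mult)
    show ?thesis unfolding e p by (rule q(3)[OF that])
  qed
  have shorter: False if "cmod (\<gamma> a - w) < cmod (\<gamma> b - w)"
      "\<gamma> a = w + of_real (cmod (\<gamma> a - w)) * c" "\<gamma> b = w + of_real (cmod (\<gamma> b - w)) * c" for a b c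
  proof -
    let ?x = "cmod (\<gamma> a - w) / cmod (\<gamma> b - w)"
    have pos: "cmod (\<gamma> b - w) > 0" using that(1) norm_ge_zero[of "\<gamma> a - w"] by linarith
    have "w + ?x *\<^sub>R (\<gamma> b - w) \<in> interior \<Omega>"
      using that(1) pos gamma_frontier[of b] frontier_subset_closed[OF closed]
      by (intro scaled_frontier_point_interior convex w) auto
    moreover have "w + ?x *\<^sub>R (\<gamma> b - w) = \<gamma> a"
    proof -
      have "\<gamma> b - w = of_real (cmod (\<gamma> b - w)) * c" unfolding diff_eq_eq by (rule trans[OF that(3) add.commute])
      then have "?x *\<^sub>R (\<gamma> b - w) = ?x *\<^sub>R (of_real (cmod (\<gamma> b - w)) * c)" by (rule arg_cong)
      also have "\<dots> = of_real (cmod (\<gamma> a - w)) * c" using pos by (simp add: scaleR_conv_of_real)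
      finally have eq: "?x *\<^sub>R (\<gamma> b - w) = of_real (cmod (\<gamma> a - w)) * c" .
      show ?thesis unfolding eq by (rule that(2)[symmetric])
    qed
    ultimately have "\<gamma> a \<in> interior \<Omega>" by (simp only:)
    then show False using gamma_frontier[of a] by (auto simp: frontier_def)
  qed
  have inj: "u = v" if "u \<in> {0..1}" "v \<in> {0..1}" "h u = h v" for u v
  proof -
    define ru rv where r: "ru = cmod (\<gamma> (L * u) - w)" "rv = cmod (\<gamma> (L * v) - w)"
    have pu: "\<gamma> (L * u) = w + of_real ru * cis (h u)" unfolding r by (rule pol[OF that(1)])
    have pv: "\<gamma> (L * v) = w + of_real rv * cis (h u)" unfolding r that(3) by (rule pol[OF that(2)])
    have "\<not> ru < rv" "\<not> rv < ru"
      using shorter[OF _ pu[unfolded r] pv[unfolded r]] shorter[OF _ pv[unfolded r] pu[unfolded r]] unfolding r by auto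
    then have "\<gamma> (L * u) = \<gamma> (L * v)" unfolding pu pv by simp
    then have "u = v \<or> u = 0 \<and> v = 1 \<or> u = 1 \<and> v = 0"
      using gamma_simple that unfolding simple_path_def loop_free_def by blast
    then show ?thesis using h01 that(3) by auto
  qed
  have inj_on: "inj_on h {0..1}" by (rule inj_onI) (rule inj)
  have first: "h 0 < h v \<and> (v < 1 \<longrightarrow> h v < h 1)" if "0 < v" "v \<le> 1" for v
  proof (cases "v = 1")
    case False
    then have "(h 0 < h v \<and> h v < h 1) \<or> (h 1 < h v \<and> h v < h 0)"
      using that by (intro continuous_inj_imp_mono conth inj_on_subset[OF inj_on]) auto
    then show ?thesis using h01 pi_gt_zero by linarith
  qed (use h01 in auto)
  have mono: "h u < h v" if "0 \<le> u" "u < v" "v \<le> 1" for u v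
  proof (cases "u = 0")
    case False
    then have "(h 0 < h u \<and> h u < h v) \<or> (h v < h u \<and> h u < h 0)"
      using that by (intro continuous_inj_imp_mono conth inj_on_subset[OF inj_on]) auto
    then show ?thesis using first[of v] that by auto
  qed (use first that in auto)
  show ?thesis
  proof (rule that[of w "\<lambda>t. h (t / L)"])
    show "\<gamma> t = w + of_real (cmod (\<gamma> t - w)) * cis (h (t / L))" if "0 \<le> t" "t \<le> L" for t
    proof -
      have e: "L * (t / L) = t" and m: "t / L \<in> {0..1}" using that L_pos by auto
      show ?thesis by (rule pol[OF m, unfolded e])
    qed
    show "h (s / L) < h (t / L)" if "0 \<le> s" "s < t" "t \<le> L" for s t
    proof (rule mono)
      show "0 \<le> s / L" "s / L < t / L" "t / L \<le> 1" using that L_pos by (auto simp: divide_strict_right_mono)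
    qed
    show "w \<in> interior \<Omega>" by (rule w)
    show "h (L / L) = h (0 / L) + 2 * pi" using h01 L_pos by simp
  qed
qed

lemma orient_gamma_period:
  assumes "0 \<le> t" "t < u" "u < v" "v < L"
  shows "0 \<le> orient (\<gamma> t) (\<gamma> u) (\<gamma> v)"
proof -
  obtain w \<theta> where w: "w \<in> interior \<Omega>"
    and pol: "\<And>t. 0 \<le> t \<Longrightarrow> t \<le> L \<Longrightarrow> \<gamma> t = w + of_real (cmod (\<gamma> t - w)) * cis (\<theta> t)"
    and mono: "\<And>s t. 0 \<le> s \<Longrightarrow> s < t \<Longrightarrow> t \<le> L \<Longrightarrow> \<theta> s < \<theta> t" and per: "\<theta> L = \<theta> 0 + 2 * pi"
    by (rule polar_lift) blast
  have pos: "cmod (\<gamma> x - w) > 0" for x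
    using gamma_frontier[of x] w by (auto simp: frontier_def)
  have "\<theta> v < \<theta> t + 2 * pi"
    using mono[of v L] mono[of 0 t] per assms by (cases "t = 0") auto
  moreover have eq: "w + of_real (cmod (\<gamma> x - w)) * cis (\<theta> x) = \<gamma> x" if "x \<in> {t, u, v}" for x
    using pol[of x, symmetric] assms that by auto
  ultimately have "0 \<le> orient (w + of_real (cmod (\<gamma> t - w)) * cis (\<theta> t)) (w + of_real (cmod (\<gamma> u - w)) * cis (\<theta> u)) (w + of_real (cmod (\<gamma> v - w)) * cis (\<theta> v))"
    using assms eq gamma_frontier
    by (intro orient_nonneg[OF convex w pos pos pos _ _ _ closed]) (auto intro: mono)
  then show ?thesis using eq by simp
qed

text \<open>Moving parameters beyond \<open>L\<close> back by one period permutes the triple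
  cyclically, which leaves its orientation unchanged.\<close>

lemma orient_gamma:
  assumes "t < u" "u < v" "v < t + L"
  shows "0 \<le> orient (\<gamma> t) (\<gamma> u) (\<gamma> v)"
proof -
  obtain k :: int where k: "0 \<le> t - of_int k * L" "t - of_int k * L < L" "\<gamma> (t - of_int k * L) = \<gamma> t"
    by (rule gamma_reduce)
  define t' u' v' where t': "t' = t - of_int k * L" and u': "u' = u - of_int k * L" and v': "v' = v - of_int k * L"
  have eq: "\<gamma> u' = \<gamma> u" "\<gamma> v' = \<gamma> v" "\<gamma> (u' - L) = \<gamma> u" "\<gamma> (v' - L) = \<gamma> v"
    using gamma_periodic_int[of u' k] gamma_periodic_int[of v' k] gamma_periodic[of "u' - L"] gamma_periodic[of "v' - L"]
    by (simp_all add: u' v')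
  have ord: "0 \<le> t'" "t' < L" "t' < u'" "u' < v'" "v' < t' + L" using assms k by (auto simp: t' u' v')
  consider "v' < L" | "u' < L" "L \<le> v'" | "L \<le> u'" by linarith
  then show ?thesis
  proof cases
    case 1
    then show ?thesis using orient_gamma_period[of t' u' v'] ord eq k by (simp add: t')
  next
    case 2
    then show ?thesis using orient_gamma_period[of "v' - L" t' u'] ord eq k by (simp add: t' orient_rotate)
  next
    case 3
    then show ?thesis using orient_gamma_period[of "u' - L" "v' - L" t'] ord eq k by (simp add: t' orient_rotate)
  qed
qed

text \<open>A continuous branch of the argument of \<open>\<gamma> u - \<gamma> t\<close>; meaningful for \<open>t < u < t + L\<close> only.\<close>

definition chord_angle :: "real \<Rightarrow> real \<Rightarrow> real" where
  "chord_angle = (SOME A. continuous_on {(t, u). t < u \<and> u < t + L} (\<lambda>(t, u). A t u) \<and>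
     (\<forall>t u. t < u \<and> u < t + L \<longrightarrow> \<gamma> u - \<gamma> t = of_real (cmod (\<gamma> u - \<gamma> t)) * cis (A t u)))"

text \<open>The pairs form a convex strip on which \<open>\<gamma> u - \<gamma> t\<close> has no
  zero, so one continuous logarithm exists on all of it.\<close>

lemma chord_angle_exists:
  "\<exists>A. continuous_on {(t, u). t < u \<and> u < t + L} (\<lambda>(t, u). A t u) \<and>
     (\<forall>t u. t < u \<and> u < t + L \<longrightarrow> \<gamma> u - \<gamma> t = of_real (cmod (\<gamma> u - \<gamma> t)) * cis (A t u))"
proof -
  let ?D = "{(t, u). t < u \<and> u < t + L} :: (real \<times> real) set"
  let ?f = "\<lambda>p. \<gamma> (snd p) - \<gamma> (fst p)"
  have "?D = {p. inner (- 1, 1) p > 0} \<inter> {p. inner (- 1, 1) p < L}"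
    by (auto simp: inner_Pair)
  then have "convex ?D"
    by (simp only:) (intro convex_Int convex_halfspace_lt convex_halfspace_gt)
  moreover have "continuous_on ?D ?f"
    by (intro continuous_intros continuous_on_compose2[OF gamma_continuous[of UNIV]]) auto
  moreover have "?f p \<noteq> 0" if "p \<in> ?D" for p
    using that gamma_neq[of "fst p" "snd p"] by auto
  ultimately obtain g where g: "continuous_on ?D g" "\<And>p. p \<in> ?D \<Longrightarrow> ?f p = exp (g p)"
    by (blast intro: continuous_logarithm_on_contractible convex_imp_contractible)
  show ?thesis
  proof (intro exI[of _ "\<lambda>t u. Im (g (t, u))"] conjI allI impI)
    have "continuous_on ?D (\<lambda>p. Im (g p))" using g(1) by (intro continuous_intros)
    then show "continuous_on ?D (\<lambda>(t, u). Im (g (t, u)))" by (simp add: case_prod_unfold)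
  next
    fix t u assume "t < u \<and> u < t + L"
    then have "\<gamma> u - \<gamma> t = exp (g (t, u))" using g(2)[of "(t, u)"] by simp
    then show "\<gamma> u - \<gamma> t = of_real (cmod (\<gamma> u - \<gamma> t)) * cis (Im (g (t, u)))"
      by (simp add: exp_eq_polar norm_mult)
  qed
qed

lemma continuous_chord_angle: "continuous_on {(t, u). t < u \<and> u < t + L} (\<lambda>(t, u). chord_angle t u)"
  and chord_polar: "t < u \<Longrightarrow> u < t + L \<Longrightarrow> \<gamma> u - \<gamma> t = of_real (cmod (\<gamma> u - \<gamma> t)) * cis (chord_angle t u)"
  using someI_ex[OF chord_angle_exists] unfolding chord_angle_def[symmetric] by auto

lemma continuous_chord_angle_snd: "continuous_on {t<..<t + L} (chord_angle t)"
proof -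
  have "continuous_on {t<..<t + L} (\<lambda>u. case (t, u) of (t, u) \<Rightarrow> chord_angle t u)"
    by (rule continuous_on_compose2[OF continuous_chord_angle]) (auto intro!: continuous_intros)
  then show ?thesis by simp
qed

lemma continuous_chord_angle_fst: "continuous_on {u - L<..<u} (\<lambda>t. chord_angle t u)"
proof -
  have "continuous_on {u - L<..<u} (\<lambda>t. case (t, u) of (t, u) \<Rightarrow> chord_angle t u)"
    by (rule continuous_on_compose2[OF continuous_chord_angle]) (auto intro!: continuous_intros)
  then show ?thesis by simp
qed

lemma sgn_chord: "t < u \<Longrightarrow> u < t + L \<Longrightarrow> sgn (\<gamma> u - \<gamma> t) = cis (chord_angle t u)"
proof -
  assume *: "t < u" "u < t + L"
  have "sgn (\<gamma> u - \<gamma> t) = sgn (of_real (cmod (\<gamma> u - \<gamma> t)) * cis (chord_angle t u))"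
    using arg_cong[OF chord_polar[OF *], of sgn] .
  also have "\<dots> = cis (chord_angle t u)"
    using gamma_neq[OF *] by (simp add: sgn_eq norm_mult)
  finally show ?thesis .
qed

text \<open>Up to a positive factor, the sine of the difference is the signed area of the triangle
  with parameters \<open>t\<close>, \<open>u\<close>, \<open>v\<close>.\<close>

lemma chord_angle_mono_snd:
  assumes "t < u" "u \<le> v" "v < t + L"
  shows "chord_angle t u \<le> chord_angle t v" "chord_angle t v \<le> chord_angle t u + pi"
proof -
  have "0 \<le> sin (chord_angle t v - chord_angle t u)" if "t < u" "u < v" "v < t + L" for u v
  proof -
    define p q where pq: "p = cmod (\<gamma> u - \<gamma> t)" "q = cmod (\<gamma> v - \<gamma> t)"
    have "p > 0" "q > 0" using gamma_neq[of t u] gamma_neq[of t v] that by (auto simp: pq)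
    have "orient (\<gamma> t) (\<gamma> u) (\<gamma> v) = Im (cnj (of_real p * cis (chord_angle t u)) * (of_real q * cis (chord_angle t v)))"
      unfolding orient_def pq using chord_polar[of t u, symmetric] chord_polar[of t v, symmetric] that by simp
    also have "\<dots> = p * q * sin (chord_angle t v - chord_angle t u)"
      by (simp add: sin_diff algebra_simps)
    finally show ?thesis using orient_gamma[OF that] mult_pos_pos[OF \<open>p > 0\<close> \<open>q > 0\<close>]
      zero_le_mult_iff[of "p * q"] by auto
  qed
  from continuous_sin_nonneg_imp_mono[OF continuous_chord_angle_snd this assms]
  show "chord_angle t u \<le> chord_angle t v" "chord_angle t v \<le> chord_angle t u + pi" by auto
qed

text \<open>The same inscribed triangle, now viewed from its last vertex.\<close>

lemma chord_angle_mono_fst: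
  assumes "v - L < s" "s \<le> t" "t < v"
  shows "chord_angle s v \<le> chord_angle t v" "chord_angle t v \<le> chord_angle s v + pi"
proof -
  have "0 \<le> sin (chord_angle t v - chord_angle s v)" if "v - L < s" "s < t" "t < v" for s t
  proof -
    define p q where pq: "p = cmod (\<gamma> v - \<gamma> s)" "q = cmod (\<gamma> v - \<gamma> t)"
    have "p > 0" "q > 0" using gamma_neq[of s v] gamma_neq[of t v] that by (auto simp: pq)
    have "orient (\<gamma> s) (\<gamma> t) (\<gamma> v) = Im (cnj (\<gamma> v - \<gamma> s) * (\<gamma> v - \<gamma> t))"
      by (simp add: orient_def algebra_simps)
    also have "\<dots> = Im (cnj (of_real p * cis (chord_angle s v)) * (of_real q * cis (chord_angle t v)))"
      unfolding pq using chord_polar[of s v, symmetric] chord_polar[of t v, symmetric] that by simp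
    also have "\<dots> = p * q * sin (chord_angle t v - chord_angle s v)"
      by (simp add: sin_diff algebra_simps)
    finally show ?thesis using orient_gamma[of s t v] that mult_pos_pos[OF \<open>p > 0\<close> \<open>q > 0\<close>]
      zero_le_mult_iff[of "p * q"] by auto
  qed
  from continuous_sin_nonneg_imp_mono[OF continuous_chord_angle_fst this assms]
  show "chord_angle s v \<le> chord_angle t v" "chord_angle t v \<le> chord_angle s v + pi" by auto
qed

text \<open>\<open>out_angle t\<close> and \<open>in_angle t\<close> are the angles \<open>\<alpha>\<^sub>+\<close> and \<open>\<alpha>\<^sub>-\<close> at \<open>\<gamma> t\<close>, whereas \<open>back_angle t\<close>
  is the direction in which the curve returns to \<open>\<gamma> t\<close>, seen from \<open>\<gamma> t\<close>.\<close>

definition out_angle :: "real \<Rightarrow> real" where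
  "out_angle t = (INF u\<in>{t<..<t + L}. chord_angle t u)"

definition back_angle :: "real \<Rightarrow> real" where
  "back_angle t = (SUP u\<in>{t<..<t + L}. chord_angle t u)"

definition in_angle :: "real \<Rightarrow> real" where
  "in_angle t = (SUP s\<in>{t - L<..<t}. chord_angle s t)"

lemma chord_angle_spread: "t < u \<Longrightarrow> u < t + L \<Longrightarrow> t < v \<Longrightarrow> v < t + L \<Longrightarrow> chord_angle t v \<le> chord_angle t u + pi"
  using chord_angle_mono_snd[of t u v] chord_angle_mono_snd[of t v u] pi_gt_zero by (cases "u \<le> v") auto

lemma chord_angle_spread_fst: "v - L < s \<Longrightarrow> s < v \<Longrightarrow> v - L < t \<Longrightarrow> t < v \<Longrightarrow> chord_angle t v \<le> chord_angle s v + pi"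
  using chord_angle_mono_fst[of v s t] chord_angle_mono_fst[of v t s] pi_gt_zero by (cases "s \<le> t") auto

lemma bdd_chord_angle:
  shows "bdd_below (chord_angle t ` {t<..<t + L})" "bdd_above (chord_angle t ` {t<..<t + L})"
    and "bdd_above ((\<lambda>s. chord_angle s t) ` {t - L<..<t})"
proof -
  show "bdd_below (chord_angle t ` {t<..<t + L})"
    using L_pos chord_angle_spread[of t _ "t + L / 2"] by (intro bdd_belowI[of _ "chord_angle t (t + L / 2) - pi"]) force
  show "bdd_above (chord_angle t ` {t<..<t + L})"
    using L_pos chord_angle_spread[of t "t + L / 2"] by (intro bdd_aboveI[of _ "chord_angle t (t + L / 2) + pi"]) force
  show "bdd_above ((\<lambda>s. chord_angle s t) ` {t - L<..<t})"
    using L_pos chord_angle_spread_fst[of t "t - L / 2"] by (intro bdd_aboveI[of _ "chord_angle (t - L / 2) t + pi"]) force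
qed

lemma out_angle_le: "t < u \<Longrightarrow> u < t + L \<Longrightarrow> out_angle t \<le> chord_angle t u"
  unfolding out_angle_def using bdd_chord_angle by (intro cINF_lower) auto

lemma back_angle_ge: "t < u \<Longrightarrow> u < t + L \<Longrightarrow> chord_angle t u \<le> back_angle t"
  unfolding back_angle_def using bdd_chord_angle by (intro cSUP_upper) auto

lemma in_angle_ge: "t - L < s \<Longrightarrow> s < t \<Longrightarrow> chord_angle s t \<le> in_angle t"
  unfolding in_angle_def using bdd_chord_angle by (intro cSUP_upper) auto

lemma tendsto_out_angle: "(chord_angle t \<longlongrightarrow> out_angle t) (at_right t)"
  unfolding out_angle_def using L_pos chord_angle_mono_snd bdd_chord_angle
  by (intro mono_on_tendsto_INF_at_right) (auto intro!: mono_onI)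

lemma tendsto_back_angle: "(chord_angle t \<longlongrightarrow> back_angle t) (at_left (t + L))"
  unfolding back_angle_def using L_pos chord_angle_mono_snd bdd_chord_angle
  by (intro mono_on_tendsto_SUP_at_left) (auto intro!: mono_onI)

lemma tendsto_in_angle: "((\<lambda>s. chord_angle s t) \<longlongrightarrow> in_angle t) (at_left t)"
  unfolding in_angle_def using L_pos chord_angle_mono_fst bdd_chord_angle
  by (intro mono_on_tendsto_SUP_at_left) (auto intro!: mono_onI)

lemma back_angle_le: "back_angle t \<le> out_angle t + pi"
proof -
  have "back_angle t - pi \<le> chord_angle t u" if "u \<in> {t<..<t + L}" for u
  proof -
    have "back_angle t \<le> chord_angle t u + pi"
      unfolding back_angle_def using L_pos chord_angle_spread that by (intro cSUP_least) auto
    then show ?thesis by simp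
  qed
  then have "back_angle t - pi \<le> out_angle t" unfolding out_angle_def using L_pos by (intro cINF_greatest) auto
  then show ?thesis by simp
qed

text \<open>Monotonicity in each variable leads from an incoming chord to an outgoing one by way of
  a chord that straddles \<open>\<gamma> t\<close>.\<close>

lemma in_le_out_angle: "in_angle t \<le> out_angle t"
proof -
  have "chord_angle s t \<le> chord_angle t u" if s: "t - L < s" "s < t" and u: "t < u" "u < t + L" for s u
  proof -
    \<comment> \<open>Staying below \<open>s + L\<close> as well as \<open>u\<close> keeps the
      straddling chord from \<open>s\<close> to \<open>v\<close> inside the strip.\<close>
    define v where "v = min u ((t + (s + L)) / 2)"
    have v: "t < v" "v \<le> u" "v < s + L" using s u by (auto simp: v_def min_def)
    have "chord_angle s t \<le> chord_angle s v" using s v by (intro chord_angle_mono_snd) auto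
    also have "\<dots> \<le> chord_angle t v" using s u v by (intro chord_angle_mono_fst) auto
    also have "\<dots> \<le> chord_angle t u" using v u by (intro chord_angle_mono_snd) auto
    finally show ?thesis .
  qed
  then show ?thesis unfolding in_angle_def out_angle_def
    using L_pos by (intro cSUP_least cINF_greatest) auto
qed

lemma out_angle_mono: "t \<le> u \<Longrightarrow> u < t + L \<Longrightarrow> out_angle t \<le> out_angle u"
  using out_angle_le[of t u] in_angle_ge[of u t] in_le_out_angle[of u] by (cases "t = u") auto

text \<open>Equality would give all chords from \<open>\<gamma> t\<close> one direction, so the
  boundary, and with it its convex hull \<open>\<Omega>\<close>, would lie on a line.\<close>

lemma out_less_back_angle: "out_angle t < back_angle t"
proof (rule ccontr)
  assume "\<not> out_angle t < back_angle t"
  then have const: "chord_angle t u = out_angle t" if "t < u" "u < t + L" for u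
    using out_angle_le[OF that] back_angle_ge[OF that] by linarith
  define n where "n = \<i> * cis (out_angle t)"
  have orth: "inner n (\<gamma> u - \<gamma> t) = 0" for u
  proof -
    obtain k where k: "0 \<le> (u - t) - of_int k * L" "(u - t) - of_int k * L < L"
      by (rule gamma_reduce[of "u - t"])
    define u' where "u' = u - of_int k * L"
    have "\<gamma> u' = \<gamma> u" using gamma_periodic_int[of u' k] by (simp add: u'_def)
    moreover have "inner n (\<gamma> u' - \<gamma> t) = 0"
    proof (cases "u' = t")
      case False
      then have u': "t < u'" "u' < t + L" using k by (auto simp: u'_def)
      have eq: "\<gamma> u' - \<gamma> t = of_real (cmod (\<gamma> u' - \<gamma> t)) * cis (out_angle t)"
        by (rule chord_polar[OF u', unfolded const[OF u']])
      have "inner n (of_real r * cis (out_angle t)) = 0" for r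
        by (simp add: n_def inner_complex_def)
      then show ?thesis by (subst eq)
    qed simp
    ultimately show ?thesis by simp
  qed
  have "n \<noteq> 0" by (simp add: n_def cis_neq_zero)
  have "frontier \<Omega> \<subseteq> {x. inner n x = inner n (\<gamma> t)}"
    using orth unfolding gamma_image_period[symmetric] by (auto simp: inner_diff_right)
  then have "convex hull (frontier \<Omega>) \<subseteq> {x. inner n x = inner n (\<gamma> t)}"
    by (intro hull_minimal convex_hyperplane)
  then have "interior \<Omega> \<subseteq> interior {x. inner n x = inner n (\<gamma> t)}"
    unfolding Krein_Milman_frontier[OF convex compact, symmetric] by (rule interior_mono)
  then show False using \<open>n \<noteq> 0\<close> interior_nonempty interior_hyperplane[of n "inner n (\<gamma> t)"] by blast
qed

end

section \<open>Tangents and corners\<close>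

lemma filterlim_shift_at_right: "filterlim (\<lambda>x::real. x + d) (at_right (a + d)) (at_right a)"
  by (auto simp: filterlim_at eventually_at_right_field intro!: tendsto_eq_intros exI[of _ "a + 1"])

lemma filterlim_shift_at_left: "filterlim (\<lambda>x::real. x + d) (at_left (a + d)) (at_left a)"
  by (auto simp: filterlim_at eventually_at_left_field intro!: tendsto_eq_intros exI[of _ "a - 1"])

context convex_body begin

lemma eventually_chord_right: "eventually (\<lambda>u. t < u \<and> u < t + L) (at_right t)"
  unfolding eventually_at_right_field using L_pos by (intro exI[of _ "t + L"]) auto

lemma eventually_chord_left: "eventually (\<lambda>u. t - L < u \<and> u < t) (at_left t)"
  unfolding eventually_at_left_field using L_pos by (intro exI[of _ "t - L"]) auto

lemma tendsto_secant_out: "((\<lambda>u. sgn (\<gamma> u - \<gamma> t)) \<longlongrightarrow> cis (out_angle t)) (at_right t)"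
proof (rule Lim_transform_eventually)
  show "((\<lambda>u. cis (chord_angle t u)) \<longlongrightarrow> cis (out_angle t)) (at_right t)"
    by (intro tendsto_cis tendsto_out_angle)
  show "eventually (\<lambda>u. cis (chord_angle t u) = sgn (\<gamma> u - \<gamma> t)) (at_right t)"
    using eventually_chord_right by eventually_elim (simp add: sgn_chord)
qed

lemma tendsto_secant_in: "((\<lambda>u. sgn (\<gamma> t - \<gamma> u)) \<longlongrightarrow> - cis (back_angle t)) (at_left t)"
proof (rule Lim_transform_eventually)
  show "((\<lambda>u. - cis (chord_angle t (u + L))) \<longlongrightarrow> - cis (back_angle t)) (at_left t)"
    by (intro tendsto_minus tendsto_cis filterlim_compose[OF tendsto_back_angle filterlim_shift_at_left])
  show "eventually (\<lambda>u. - cis (chord_angle t (u + L)) = sgn (\<gamma> t - \<gamma> u)) (at_left t)"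
    using eventually_chord_left
  proof eventually_elim
    case (elim u)
    then have "cis (chord_angle t (u + L)) = sgn (\<gamma> (u + L) - \<gamma> t)" by (simp add: sgn_chord)
    then show ?case by (simp add: gamma_periodic sgn_minus[symmetric])
  qed
qed

text \<open>Both sides are limits of the same secants: chords arriving at \<open>t\<close>, and, one
  period later and reversed, chords returning to it. The argument compares directions, not branches
  of the angle.\<close>

lemma cis_in_angle: "cis (in_angle t) = - cis (back_angle t)"
proof (rule tendsto_unique[OF trivial_limit_at_left_real])
  show "((\<lambda>u. sgn (\<gamma> t - \<gamma> u)) \<longlongrightarrow> cis (in_angle t)) (at_left t)"
  proof (rule Lim_transform_eventually)
    show "((\<lambda>u. cis (chord_angle u t)) \<longlongrightarrow> cis (in_angle t)) (at_left t)"
      by (intro tendsto_cis tendsto_in_angle)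
    show "eventually (\<lambda>u. cis (chord_angle u t) = sgn (\<gamma> t - \<gamma> u)) (at_left t)"
      using eventually_chord_left by eventually_elim (simp add: sgn_chord)
  qed
qed (rule tendsto_secant_in)

text \<open>Makes the description in \<open>tangent_out\<close> unique: it admits every parameter of
  a boundary point, and a shift by periods does not change the limit.\<close>

lemma cis_out_angle_cong:
  assumes "\<gamma> s = \<gamma> t"
  shows "cis (out_angle s) = cis (out_angle t)"
proof -
  obtain k :: int where k: "t = s + of_int k * L" using assms gamma_eq_iff by auto
  have "((\<lambda>u. sgn (\<gamma> (u + of_int k * L) - \<gamma> t)) \<longlongrightarrow> cis (out_angle t)) (at_right s)"
    using filterlim_compose[OF tendsto_secant_out[of t, unfolded k] filterlim_shift_at_right[of "of_int k * L" s]] k by simp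
  then have "((\<lambda>u. sgn (\<gamma> u - \<gamma> s)) \<longlongrightarrow> cis (out_angle t)) (at_right s)"
    by (simp add: gamma_periodic_int assms)
  from tendsto_unique[OF trivial_limit_at_right_real tendsto_secant_out this] show ?thesis .
qed

lemma cis_back_angle_cong:
  assumes "\<gamma> s = \<gamma> t"
  shows "cis (back_angle s) = cis (back_angle t)"
proof -
  obtain k :: int where k: "t = s + of_int k * L" using assms gamma_eq_iff by auto
  have "((\<lambda>u. sgn (\<gamma> t - \<gamma> (u + of_int k * L))) \<longlongrightarrow> - cis (back_angle t)) (at_left s)"
    using filterlim_compose[OF tendsto_secant_in[of t, unfolded k] filterlim_shift_at_left[of "of_int k * L" s]] k by simp
  then have "((\<lambda>u. sgn (\<gamma> s - \<gamma> u)) \<longlongrightarrow> - cis (back_angle t)) (at_left s)"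
    by (simp add: gamma_periodic_int assms)
  from tendsto_unique[OF trivial_limit_at_left_real tendsto_secant_in this] show ?thesis by simp
qed

lemma tangent_out_gamma: "tangent_out \<Omega> (\<gamma> t) = cis (out_angle t)"
  unfolding tangent_out_def
proof (rule the_equality)
  show "\<exists>s. \<gamma> s = \<gamma> t \<and> ((\<lambda>u. sgn (\<gamma> u - \<gamma> t)) \<longlongrightarrow> cis (out_angle t)) (at_right s)"
    using tendsto_secant_out by blast
next
  fix v assume "\<exists>s. \<gamma> s = \<gamma> t \<and> ((\<lambda>u. sgn (\<gamma> u - \<gamma> t)) \<longlongrightarrow> v) (at_right s)"
  then obtain s where s: "\<gamma> s = \<gamma> t" "((\<lambda>u. sgn (\<gamma> u - \<gamma> t)) \<longlongrightarrow> v) (at_right s)" by auto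
  from tendsto_unique[OF trivial_limit_at_right_real s(2)[folded s(1)] tendsto_secant_out]
  show "v = cis (out_angle t)" using cis_out_angle_cong[OF s(1)] by simp
qed

lemma tangent_in_gamma: "tangent_in \<Omega> (\<gamma> t) = - cis (back_angle t)"
  unfolding tangent_in_def
proof (rule the_equality)
  show "\<exists>s. \<gamma> s = \<gamma> t \<and> ((\<lambda>u. sgn (\<gamma> t - \<gamma> u)) \<longlongrightarrow> - cis (back_angle t)) (at_left s)"
    using tendsto_secant_in by blast
next
  fix v assume "\<exists>s. \<gamma> s = \<gamma> t \<and> ((\<lambda>u. sgn (\<gamma> t - \<gamma> u)) \<longlongrightarrow> v) (at_left s)"
  then obtain s where s: "\<gamma> s = \<gamma> t" "((\<lambda>u. sgn (\<gamma> t - \<gamma> u)) \<longlongrightarrow> v) (at_left s)" by auto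
  from tendsto_unique[OF trivial_limit_at_left_real s(2)[folded s(1)] tendsto_secant_in]
  show "v = - cis (back_angle t)" using cis_back_angle_cong[OF s(1)] by simp
qed

text \<open>The two sides agree modulo \<open>2 * pi\<close>, and both lie in
  \<open>[0, pi)\<close>, where the cosine is injective; for the right-hand side this is the bound
  on the spread of the chord angles at \<open>t\<close>.\<close>

lemma tangent_angles_diff:
  assumes "tangent_angles \<Omega> (\<gamma> t) a b"
  shows "b - a = out_angle t - back_angle t + pi"
proof -
  have ab: "cis a = - cis (back_angle t)" "cis b = cis (out_angle t)" "0 \<le> b - a" "b - a < pi"
    using assms by (auto simp: tangent_angles_def tangent_in_gamma tangent_out_gamma)
  have "cis (b - a) = cis b * cnj (cis a)" by (simp add: cis_cnj cis_mult)
  also have "\<dots> = cis (out_angle t - back_angle t + pi)"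
    unfolding ab by (simp add: cis_cnj cis_mult) (simp add: complex_eq_iff)
  finally have "cos (b - a) = cos (out_angle t - back_angle t + pi)" by (simp add: complex_eq_iff)
  then show ?thesis
    by (rule cos_inj_pi[rotated 4]) (use ab(3,4) back_angle_le[of t] out_less_back_angle[of t] in auto)
qed

text \<open>The incoming branch is \<open>back_angle t - pi\<close>, whose distance from
  \<open>out_angle t\<close> is bounded on both sides; \<open>cis_in_angle\<close> ties
  \<open>in_angle t\<close> to it only modulo \<open>2 * pi\<close>.\<close>

lemma tangent_angles_gamma: "tangent_angles \<Omega> (\<gamma> t) (back_angle t - pi) (out_angle t)"
  using back_angle_le[of t] out_less_back_angle[of t]
  by (auto simp: tangent_angles_def tangent_in_gamma tangent_out_gamma complex_eq_iff)

lemma interior_angle_gamma: "interior_angle \<Omega> (\<gamma> t) = back_angle t - out_angle t"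
  unfolding interior_angle_def
proof (rule the_equality)
  show "\<exists>am ap. tangent_angles \<Omega> (\<gamma> t) am ap \<and> back_angle t - out_angle t = pi - ap + am"
    using tangent_angles_gamma by (intro exI conjI) auto
next
  fix x assume "\<exists>am ap. tangent_angles \<Omega> (\<gamma> t) am ap \<and> x = pi - ap + am"
  then obtain am ap where "tangent_angles \<Omega> (\<gamma> t) am ap" "x = pi - ap + am" by blast
  then show "x = back_angle t - out_angle t" using tangent_angles_diff[of t am ap] by simp
qed

text \<open>By \<open>cis_in_angle\<close> the spread \<open>back_angle t - out_angle t\<close> is
  then an odd multiple of pi; as it lies in \<open>(0, pi]\<close>, it equals pi.\<close>

lemma not_corner_gamma:
  assumes "in_angle t = out_angle t"
  shows "\<not> corner \<Omega> (\<gamma> t)"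
proof -
  have "cis (out_angle t) = - cis (back_angle t)" using cis_in_angle[of t] unfolding assms .
  then have "cis (back_angle t - out_angle t) = cis pi"
    by (simp add: cis_divide[symmetric] cis_neq_zero divide_eq_eq)
  then have "cos (back_angle t - out_angle t) = cos pi" by (simp only: complex_eq_iff cis.simps)
  then have "back_angle t - out_angle t = pi"
    by (rule cos_inj_pi[rotated 4]) (use back_angle_le[of t] out_less_back_angle[of t] in auto)
  then have "ap - am = 0" if "tangent_angles \<Omega> (\<gamma> t) am ap" for am ap
    using tangent_angles_diff[OF that] by simp
  then show ?thesis unfolding corner_def by fastforce
qed

text \<open>Each side of an inscribed polygon is at most its projection on \<open>cis x\<close>
  divided by \<open>cos e\<close>. The projections telescope, and the supremum over all polygons is
  the arclength \<open>b - a\<close>.\<close>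

lemma chord_component_ge:
  assumes "a \<le> b" "b < a + L" "0 \<le> e" "e < pi / 2"
    and dir: "\<And>s v. a \<le> s \<Longrightarrow> s < v \<Longrightarrow> v \<le> b \<Longrightarrow> \<bar>chord_angle s v - x\<bar> \<le> e"
  shows "cos e * (b - a) \<le> Re ((\<gamma> b - \<gamma> a) * cnj (cis x))"
proof -
  define P where "P = (\<lambda>s. Re (\<gamma> s * cnj (cis x)))"
  have ce: "cos e > 0" using assms by (intro cos_gt_zero_pi) auto
  have step: "cos e * dist (\<gamma> s) (\<gamma> v) \<le> P v - P s" if "a \<le> s" "s \<le> v" "v \<le> b" for s v
  proof (cases "s = v")
    case False
    then have sv: "s < v" "v < s + L" using that assms by auto
    define r where "r = cmod (\<gamma> v - \<gamma> s)"
    have eq: "\<gamma> v - \<gamma> s = of_real r * cis (chord_angle s v)" unfolding r_def by (rule chord_polar[OF sv])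
    have "P v - P s = Re ((\<gamma> v - \<gamma> s) * cnj (cis x))" by (simp add: P_def algebra_simps)
    also have "\<dots> = r * cos (chord_angle s v - x)" unfolding eq by (simp add: cos_diff algebra_simps)
    finally have 1: "P v - P s = r * cos (chord_angle s v - x)" .
    have "\<bar>chord_angle s v - x\<bar> \<le> e" using dir that False by auto
    then have "cos e \<le> cos \<bar>chord_angle s v - x\<bar>" using assms by (intro cos_monotone_0_pi_le) auto
    then have "cos e \<le> cos (chord_angle s v - x)" by simp
    moreover have "dist (\<gamma> s) (\<gamma> v) = r" "r \<ge> 0" by (auto simp: r_def dist_norm norm_minus_commute)
    ultimately show ?thesis unfolding 1 by (simp add: mult.commute mult_left_mono)
  qed simp
  have mono: "P s \<le> P v" if "a \<le> s" "s \<le> v" "v \<le> b" for s v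
  proof -
    have "0 \<le> cos e * dist (\<gamma> s) (\<gamma> v)" using ce by simp
    then show ?thesis using step[OF that] by linarith
  qed
  have "ennreal (b - a) \<le> ennreal ((P b - P a) / cos e)"
    unfolding gamma_length[OF \<open>a \<le> b\<close>, symmetric] curve_length_def
  proof (rule SUP_least, clarify)
    fix ts assume ts: "sorted ts" "set ts \<subseteq> {a..b}"
    have mem: "a \<le> ts ! i" "ts ! i \<le> b" if "i < length ts" for i using ts(2) nth_mem[OF that] by auto
    have "(\<Sum>i<length ts - 1. ennreal (dist (\<gamma> (ts ! i)) (\<gamma> (ts ! Suc i))))
       \<le> (\<Sum>i<length ts - 1. ennreal ((P (ts ! Suc i) - P (ts ! i)) / cos e))"
    proof (intro sum_mono ennreal_leI)
      fix i assume "i \<in> {..<length ts - 1}"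
      then have "cos e * dist (\<gamma> (ts ! i)) (\<gamma> (ts ! Suc i)) \<le> P (ts ! Suc i) - P (ts ! i)"
        using ts mem by (intro step) (auto simp: sorted_nth_mono)
      then show "dist (\<gamma> (ts ! i)) (\<gamma> (ts ! Suc i)) \<le> (P (ts ! Suc i) - P (ts ! i)) / cos e"
        using ce by (simp add: field_simps)
    qed
    also have "\<dots> = ennreal (\<Sum>i<length ts - 1. (P (ts ! Suc i) - P (ts ! i)) / cos e)"
      using ts mem ce by (intro sum_ennreal divide_nonneg_pos) (auto intro!: mono simp: sorted_nth_mono)
    also have "(\<Sum>i<length ts - 1. (P (ts ! Suc i) - P (ts ! i)) / cos e) = (P (ts ! (length ts - 1)) - P (ts ! 0)) / cos e"
      by (simp add: sum_divide_distrib[symmetric] sum_lessThan_telescope[of "\<lambda>i. P (ts ! i)"])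
    also have "ennreal \<dots> \<le> ennreal ((P b - P a) / cos e)"
    proof (cases "ts = []")
      case False
      then have "P (ts ! (length ts - 1)) \<le> P b" "P a \<le> P (ts ! 0)"
        using mem[of 0] mem[of "length ts - 1"] by (auto intro!: mono)
      then show ?thesis using ce by (intro ennreal_leI divide_right_mono) auto
    next
      case True
      then show ?thesis using mono[of a b] \<open>a \<le> b\<close> ce by simp
    qed
    finally show "(\<Sum>i<length ts - 1. ennreal (dist (\<gamma> (ts ! i)) (\<gamma> (ts ! Suc i)))) \<le> ennreal ((P b - P a) / cos e)" .
  qed
  then have "b - a \<le> (P b - P a) / cos e"
    using mono[of a b] \<open>a \<le> b\<close> ce by (subst (asm) ennreal_le_iff) auto
  then have "cos e * (b - a) \<le> P b - P a" using ce by (simp add: field_simps)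
  also have "\<dots> = Re ((\<gamma> b - \<gamma> a) * cnj (cis x))" by (simp add: P_def algebra_simps)
  finally show ?thesis .
qed

text \<open>A vector of length at most \<open>h\<close> with component at least
  \<open>h * cos e\<close> along \<open>cis x\<close> differs from \<open>h *\<^sub>R cis x\<close>
  by at most \<open>e * h\<close>, since \<open>2 - 2 * cos e \<le> e\<^sup>2\<close>.\<close>

lemma chord_approx:
  assumes "a \<le> b" "b < a + L" "0 \<le> e" "e < pi / 2"
    and dir: "\<And>s v. a \<le> s \<Longrightarrow> s < v \<Longrightarrow> v \<le> b \<Longrightarrow> \<bar>chord_angle s v - x\<bar> \<le> e"
  shows "cmod (\<gamma> b - \<gamma> a - (b - a) *\<^sub>R cis x) \<le> e * (b - a)"
proof -
  define z where "z = \<gamma> b - \<gamma> a"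
  define h where "h = b - a"
  have z: "cmod z \<le> h" using gamma_Lipschitz[OF \<open>a \<le> b\<close>] by (simp add: z_def h_def)
  have re: "cos e * h \<le> Re (z * cnj (cis x))" unfolding z_def h_def by (rule chord_component_ge[OF assms])
  have "h \<ge> 0" using \<open>a \<le> b\<close> by (simp add: h_def)
  have square: "(Re z - h * c)\<^sup>2 + (Im z - h * s)\<^sup>2
      = (Re z)\<^sup>2 + (Im z)\<^sup>2 - 2 * h * (Re z * c + Im z * s) + h\<^sup>2 * (c\<^sup>2 + s\<^sup>2)" for c s
    by (simp add: power2_eq_square algebra_simps)
  have "(cmod (z - h *\<^sub>R cis x))\<^sup>2 = (cmod z)\<^sup>2 - 2 * h * Re (z * cnj (cis x)) + h\<^sup>2"
    unfolding cmod_power2 using square[of "cos x" "sin x"] by simp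
  also have "\<dots> \<le> h\<^sup>2 - 2 * h * (cos e * h) + h\<^sup>2"
  proof -
    have "(cmod z)\<^sup>2 \<le> h\<^sup>2" using z by (rule power_mono) simp
    moreover have "2 * h * (cos e * h) \<le> 2 * h * Re (z * cnj (cis x))"
      by (rule mult_left_mono[OF re]) (use \<open>h \<ge> 0\<close> in simp)
    ultimately show ?thesis by linarith
  qed
  also have "\<dots> = h\<^sup>2 * (2 - 2 * cos e)" by (simp add: power2_eq_square algebra_simps)
  also have "\<dots> \<le> h\<^sup>2 * e\<^sup>2" using cos_ge_quadratic[of e] by (intro mult_left_mono) auto
  also have "\<dots> = (e * h)\<^sup>2" by (simp add: power_mult_distrib)
  finally have "cmod (z - h *\<^sub>R cis x) \<le> e * h"
    by (rule power2_le_imp_le) (use \<open>h \<ge> 0\<close> \<open>0 \<le> e\<close> in auto)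
  then show ?thesis by (simp add: z_def h_def)
qed

text \<open>Two chords suffice: one from \<open>t\<close> to a later \<open>u\<close> bounds the
  angles from above, one from an earlier \<open>s\<close> to \<open>t\<close> bounds them from
  below. Continuity lets the end at \<open>t\<close> move a little, and monotonicity in both
  variables then controls all short chords near \<open>t\<close>.\<close>

lemma chord_angle_close:
  assumes "in_angle t = out_angle t" "e > 0"
  obtains d where "d > 0" "d < L / 2"
    "\<And>s v. t - d < s \<Longrightarrow> s < v \<Longrightarrow> v < t + d \<Longrightarrow> \<bar>chord_angle s v - out_angle t\<bar> \<le> e"
proof -
  have "eventually (\<lambda>u. chord_angle t u < out_angle t + e \<and> u < t + L / 2 \<and> t < u) (at_right t)"
  proof (rule eventually_conj)
    show "eventually (\<lambda>u. chord_angle t u < out_angle t + e) (at_right t)"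
      using \<open>e > 0\<close> by (intro order_tendstoD(2)[OF tendsto_out_angle]) simp
    show "eventually (\<lambda>u. u < t + L / 2 \<and> t < u) (at_right t)"
      unfolding eventually_at_right_field using L_pos by (intro exI[of _ "t + L / 2"]) auto
  qed
  then obtain u where u: "chord_angle t u < out_angle t + e" "u < t + L / 2" "t < u"
    using eventually_happens'[OF trivial_limit_at_right_real] by blast
  have "eventually (\<lambda>s. out_angle t - e < chord_angle s t \<and> t - L / 2 < s \<and> s < t) (at_left t)"
  proof (rule eventually_conj)
    show "eventually (\<lambda>s. out_angle t - e < chord_angle s t) (at_left t)"
      using \<open>e > 0\<close> assms(1) by (intro order_tendstoD(1)[OF tendsto_in_angle]) simp
    show "eventually (\<lambda>s. t - L / 2 < s \<and> s < t) (at_left t)"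
      unfolding eventually_at_left_field using L_pos by (intro exI[of _ "t - L / 2"]) auto
  qed
  then obtain s where s: "out_angle t - e < chord_angle s t" "t - L / 2 < s" "s < t"
    using eventually_happens'[OF trivial_limit_at_left_real] by blast
  have "isCont (\<lambda>s. chord_angle s u) t"
    using continuous_chord_angle_fst[of u] u L_pos by (simp add: continuous_on_eq_continuous_at)
  then have "eventually (\<lambda>s. chord_angle s u < out_angle t + e) (at t)"
    using u(1) by (auto simp: isCont_def dest: order_tendstoD)
  then obtain d1 where d1: "d1 > 0" "\<And>s. s \<noteq> t \<Longrightarrow> dist s t < d1 \<Longrightarrow> chord_angle s u < out_angle t + e"
    unfolding eventually_at by auto
  have "isCont (chord_angle s) t"
    using continuous_chord_angle_snd[of s] s L_pos by (simp add: continuous_on_eq_continuous_at)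
  then have "eventually (\<lambda>v. out_angle t - e < chord_angle s v) (at t)"
    using s(1) by (auto simp: isCont_def dest: order_tendstoD)
  then obtain d2 where d2: "d2 > 0" "\<And>v. v \<noteq> t \<Longrightarrow> dist v t < d2 \<Longrightarrow> out_angle t - e < chord_angle s v"
    unfolding eventually_at by auto
  define d where "d = Min {d1, d2, u - t, t - s}"
  have d: "d > 0" "d \<le> d1" "d \<le> d2" "d \<le> u - t" "d \<le> t - s" using d1 d2 u s by (auto simp: d_def)
  show ?thesis
  proof (rule that[of d])
    fix s' v' assume *: "t - d < s'" "s' < v'" "v' < t + d"
    have dist: "dist s' t < d1" "dist v' t < d2"
      unfolding dist_real_def abs_less_iff using * d by auto
    have "chord_angle s' v' \<le> chord_angle s' u" using * d u s by (intro chord_angle_mono_snd) auto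
    also have "\<dots> \<le> out_angle t + e"
      using d1(2)[of s'] u(1) dist by (cases "s' = t") auto
    finally have 1: "chord_angle s' v' \<le> out_angle t + e" .
    have "out_angle t - e \<le> chord_angle s v'"
      using d2(2)[of v'] s(1) dist by (cases "v' = t") auto
    also have "\<dots> \<le> chord_angle s' v'" using * d u s by (intro chord_angle_mono_fst) auto
    finally show "\<bar>chord_angle s' v' - out_angle t\<bar> \<le> e" using 1 by auto
  qed (use d u in auto)
qed

text \<open>Away from the corners the curve is differentiable with unit speed, since short arcs have
  chords in nearly one direction, so that their length is nearly the length of the chord.\<close>

lemma has_vector_derivative_gamma:
  assumes "in_angle t = out_angle t"
  shows "(\<gamma> has_vector_derivative cis (out_angle t)) (at t)"
  unfolding has_vector_derivative_def has_derivative_at_alt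
proof (intro conjI allI impI)
  show "bounded_linear (\<lambda>x. x *\<^sub>R cis (out_angle t))" by (rule bounded_linear_scaleR_left)
  fix e :: real assume "e > 0"
  \<comment> \<open>Capped at 1, which is below \<open>pi / 2\<close>, as
    \<open>chord_approx\<close> demands.\<close>
  define e' where "e' = min e 1"
  have e': "e' > 0" "e' \<le> e" "e' < pi / 2" using \<open>e > 0\<close> pi_gt3 by (auto simp: e'_def)
  obtain d where d: "d > 0" "d < L / 2"
    "\<And>s v. t - d < s \<Longrightarrow> s < v \<Longrightarrow> v < t + d \<Longrightarrow> \<bar>chord_angle s v - out_angle t\<bar> \<le> e'"
    by (rule chord_angle_close[OF assms \<open>e' > 0\<close>]) blast
  have "norm (\<gamma> y - \<gamma> t - (y - t) *\<^sub>R cis (out_angle t)) \<le> e * norm (y - t)" if y: "norm (y - t) < d" for y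
  proof (cases "t \<le> y")
    case True
    then have "cmod (\<gamma> y - \<gamma> t - (y - t) *\<^sub>R cis (out_angle t)) \<le> e' * (y - t)"
      using y d e' by (intro chord_approx) auto
    also have "\<dots> \<le> e * (y - t)" using e' True by (intro mult_right_mono) auto
    finally show ?thesis using True by simp
  next
    case False
    then have "cmod (\<gamma> t - \<gamma> y - (t - y) *\<^sub>R cis (out_angle t)) \<le> e' * (t - y)"
      using y d e' by (intro chord_approx) auto
    also have "\<dots> \<le> e * (t - y)" using e' False by (intro mult_right_mono) auto
    finally show ?thesis using False norm_minus_commute[of "\<gamma> t - \<gamma> y" "(t - y) *\<^sub>R cis (out_angle t)"]
      by (simp add: algebra_simps)
  qed
  then show "\<exists>d>0. \<forall>y. norm (y - t) < d \<longrightarrow> norm (\<gamma> y - \<gamma> t - (y - t) *\<^sub>R cis (out_angle t)) \<le> e * norm (y - t)"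
    using d(1) by blast
qed

text \<open>For \<open>s < u\<close> the chord between them gives
  \<open>out_angle s \<le> in_angle u\<close>. Where the monotone function \<open>out_angle\<close>
  is continuous, letting \<open>s\<close> tend to \<open>u\<close> closes the gap, so the exceptions
  are among its countably many jumps.\<close>

lemma countable_corners: "countable {u \<in> {a<..<a + L}. in_angle u \<noteq> out_angle u}"
proof (rule countable_subset)
  have mono: "mono_on {a<..<a + L} out_angle"
    by (intro mono_onI out_angle_mono) auto
  then show "countable {u \<in> {a<..<a + L}. \<not> isCont out_angle u}"
    by (intro mono_on_ctble_discont_open) auto
  have "in_angle u = out_angle u" if "u \<in> {a<..<a + L}" "isCont out_angle u" for u
  proof (rule antisym)
    have "(out_angle \<longlongrightarrow> out_angle u) (at_left u)"
      using that(2) by (simp add: isCont_def filterlim_at_split)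
    then show "out_angle u \<le> in_angle u"
    proof (rule tendsto_upperbound)
      show "eventually (\<lambda>s. out_angle s \<le> in_angle u) (at_left u)"
        using eventually_chord_left
      proof eventually_elim
        case (elim s)
        then show ?case using out_angle_le[of s u] in_angle_ge[of u s] by simp
      qed
    qed simp
  qed (rule in_le_out_angle)
  then show "{u \<in> {a<..<a + L}. in_angle u \<noteq> out_angle u} \<subseteq> {u \<in> {a<..<a + L}. \<not> isCont out_angle u}"
    by auto
qed

lemma np_density_gamma:
  assumes "in_angle u = out_angle u" "t < u" "u < t + L"
  shows "np_density \<Omega> (\<gamma> t) (\<gamma> u) = Im (cis (out_angle u) / (\<gamma> u - \<gamma> t)) / pi"
  using not_corner_gamma[OF assms(1)] gamma_neq[OF assms(2,3)]
  by (simp add: np_density_def outer_normal_def unit_tangent_def tangent_out_gamma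
      times_divide_eq_right[symmetric] del: times_divide_eq_right)

text \<open>Near \<open>u\<close> the angle is \<open>chord_angle t u\<close> plus the imaginary
  part of the principal logarithm of \<open>f\<close>, the chord normalised to 1 at
  \<open>u\<close>. Continuity keeps the change of angle below pi, so the branches agree.\<close>

lemma has_vector_derivative_chord_angle:
  assumes "in_angle u = out_angle u" "t < u" "u < t + L"
  shows "(chord_angle t has_vector_derivative pi * np_density \<Omega> (\<gamma> t) (\<gamma> u)) (at u)"
proof -
  define f where "f = (\<lambda>x. (\<gamma> x - \<gamma> t) / (\<gamma> u - \<gamma> t))"
  have nz: "\<gamma> u - \<gamma> t \<noteq> 0" using gamma_neq[OF assms(2,3)] by simp
  have "((\<lambda>x. \<gamma> x - \<gamma> t) has_vector_derivative cis (out_angle u) - 0) (at u)"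
    by (intro has_vector_derivative_diff has_vector_derivative_gamma[OF assms(1)] has_vector_derivative_const)
  then have f': "(f has_vector_derivative cis (out_angle u) / (\<gamma> u - \<gamma> t)) (at u)"
    unfolding f_def by (intro has_vector_derivative_divide) simp
  have fu: "f u = 1" using nz by (simp add: f_def)
  have "(Ln has_field_derivative 1) (at (f u) within f ` UNIV)"
    unfolding fu by (auto intro!: derivative_eq_intros)
  then have "(Ln \<circ> f has_vector_derivative (cis (out_angle u) / (\<gamma> u - \<gamma> t)) * 1) (at u)"
    by (intro field_vector_diff_chain_within f')
  then have "((\<lambda>x. Im ((Ln \<circ> f) x)) has_vector_derivative Im ((cis (out_angle u) / (\<gamma> u - \<gamma> t)) * 1)) (at u)"
    by (rule bounded_linear.has_vector_derivative[OF bounded_linear_Im])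
  then have "((\<lambda>x. chord_angle t u + Im ((Ln \<circ> f) x)) has_vector_derivative 0 + Im ((cis (out_angle u) / (\<gamma> u - \<gamma> t)) * 1)) (at u)"
    by (intro has_vector_derivative_add has_vector_derivative_const)
  then have D: "((\<lambda>x. chord_angle t u + Im ((Ln \<circ> f) x)) has_vector_derivative pi * np_density \<Omega> (\<gamma> t) (\<gamma> u)) (at u)"
    unfolding np_density_gamma[OF assms] by simp
  have "isCont (chord_angle t) u"
    using continuous_chord_angle_snd[of t] assms(2,3) by (simp add: continuous_on_eq_continuous_at)
  then have "eventually (\<lambda>x. dist (chord_angle t x) (chord_angle t u) < pi) (nhds u)"
  proof -
    assume "isCont (chord_angle t) u"
    then have "eventually (\<lambda>x. dist (chord_angle t x) (chord_angle t u) < pi) (at u)"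
      unfolding isCont_def by (rule tendstoD) simp
    then have "eventually (\<lambda>x. x \<noteq> u \<longrightarrow> dist (chord_angle t x) (chord_angle t u) < pi) (nhds u)"
      by (simp add: eventually_at_filter)
    then show ?thesis by (rule eventually_mono) auto
  qed
  moreover have "eventually (\<lambda>x. x \<in> {t<..<t + L}) (nhds u)"
    using assms by (intro eventually_nhds_in_open) auto
  ultimately have "eventually (\<lambda>x. chord_angle t u + Im ((Ln \<circ> f) x) = chord_angle t x) (nhds u)"
  proof eventually_elim
    case (elim x)
    define r where "r = cmod (\<gamma> x - \<gamma> t)"
    define q where "q = cmod (\<gamma> u - \<gamma> t)"
    have x: "t < x" "x < t + L" using elim by auto
    have r: "r > 0" "q > 0" using gamma_neq[of t x] gamma_neq[of t u] elim assms by (auto simp: r_def q_def)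
    have eqs: "\<gamma> x - \<gamma> t = of_real r * cis (chord_angle t x)" "\<gamma> u - \<gamma> t = of_real q * cis (chord_angle t u)"
      unfolding r_def q_def by (rule chord_polar[OF x] chord_polar[OF assms(2,3)])+
    have "f x = of_real (r / q) * cis (chord_angle t x - chord_angle t u)"
      unfolding f_def eqs by (simp add: cis_divide[symmetric])
    also have "\<dots> = exp (Complex (ln (r / q)) (chord_angle t x - chord_angle t u))"
      using r by (simp add: exp_eq_polar)
    finally have "Ln (f x) = Complex (ln (r / q)) (chord_angle t x - chord_angle t u)"
      using elim by (simp add: Ln_exp dist_real_def abs_less_iff)
    then show ?case by simp
  qed
  note ev = this
  have "((\<lambda>x. chord_angle t u + Im ((Ln \<circ> f) x)) has_vector_derivative pi * np_density \<Omega> (\<gamma> t) (\<gamma> u)) (at u)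
      \<longleftrightarrow> (chord_angle t has_vector_derivative pi * np_density \<Omega> (\<gamma> t) (\<gamma> u)) (at u)"
    using ev eventually_nhds_x_imp_x[OF ev] by (intro has_vector_derivative_cong_ev) auto
  then show ?thesis using D by blast
qed

end

section \<open>Tangent circles and the density\<close>

lemma inverse_antimono_ennreal: "x \<le> y \<Longrightarrow> inverse y \<le> inverse (x :: ennreal)"
proof (cases "x = 0 \<or> y = top")
  case False
  assume "x \<le> y"
  obtain r where r: "y = ennreal r" "0 \<le> r" using False by (cases y) auto
  obtain q where q: "x = ennreal q" "0 \<le> q" using False \<open>x \<le> y\<close> r by (cases x) (auto simp: top_unique)
  have "0 < q" "q \<le> r" using False \<open>x \<le> y\<close> q r by (auto simp: ennreal_le_iff order_less_le)
  then show ?thesis by (simp add: q r inverse_ennreal ennreal_leI le_imp_inverse_le)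
qed auto

text \<open>The piece over \<open>{0..<a}\<close> is moved by one period to
  \<open>{p..<p + a}\<close>.\<close>

lemma nn_integral_period_shift:
  fixes G :: "real \<Rightarrow> ennreal"
  assumes [measurable]: "G \<in> borel_measurable borel" and per: "\<And>x. G (x + p) = G x" and a: "0 \<le> a" "a \<le> p"
  shows "(\<integral>\<^sup>+x. G x * indicator {0..<p} x \<partial>lborel) = (\<integral>\<^sup>+x. G x * indicator {a..<a + p} x \<partial>lborel)"
proof -
  have "(\<integral>\<^sup>+x. G x * indicator {p..<p + a} x \<partial>lborel) = (\<integral>\<^sup>+x. G (p + 1 * x) * indicator {p..<p + a} (p + 1 * x) \<partial>lborel)"
    using nn_integral_real_affine[of "\<lambda>x. G x * indicator {p..<p + a} x" 1 p] by simp
  also have "\<dots> = (\<integral>\<^sup>+x. G x * indicator {0..<a} x \<partial>lborel)"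
    using per by (intro nn_integral_cong) (auto simp: indicator_def add.commute)
  finally have shift: "(\<integral>\<^sup>+x. G x * indicator {p..<p + a} x \<partial>lborel) = (\<integral>\<^sup>+x. G x * indicator {0..<a} x \<partial>lborel)" .
  have "(\<integral>\<^sup>+x. G x * indicator {0..<p} x \<partial>lborel) = (\<integral>\<^sup>+x. G x * indicator {0..<a} x + G x * indicator {a..<p} x \<partial>lborel)"
    using a by (intro nn_integral_cong) (auto simp: indicator_def)
  also have "\<dots> = (\<integral>\<^sup>+x. G x * indicator {p..<p + a} x \<partial>lborel) + (\<integral>\<^sup>+x. G x * indicator {a..<p} x \<partial>lborel)"
    unfolding shift by (intro nn_integral_add) auto
  also have "\<dots> = (\<integral>\<^sup>+x. G x * indicator {p..<p + a} x + G x * indicator {a..<p} x \<partial>lborel)"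
    by (intro nn_integral_add[symmetric]) auto
  also have "\<dots> = (\<integral>\<^sup>+x. G x * indicator {a..<a + p} x \<partial>lborel)"
    using a by (intro nn_integral_cong) (auto simp: indicator_def)
  finally show ?thesis .
qed

text \<open>In coordinates along the tangent direction \<open>T\<close>, a circle tangent at \<open>\<sigma>\<close> is centred at
  \<open>\<sigma> + \<i> q T\<close> with radius \<open>\<bar>q\<bar>\<close>, and \<open>q\<close> is determined by the point \<open>\<zeta>\<close>.\<close>

lemma tangent_circle_radius_unique:
  assumes T: "cmod T = 1" and v: "\<zeta> - \<sigma> = Complex a m * T" and "m > 0"
  shows "0 < r \<and> (\<exists>c. \<zeta> \<in> sphere c r \<and> sphere c r \<inter> {\<sigma> + of_real x * T | x. True} = {\<sigma>})
    \<longleftrightarrow> r = (a\<^sup>2 + m\<^sup>2) / (2 * m)"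
proof -
  have rot: "dist (\<sigma> + Complex p q * T) (\<sigma> + Complex p' q' * T) = sqrt ((p - p')\<^sup>2 + (q - q')\<^sup>2)" for p q p' q'
  proof -
    have "dist (\<sigma> + Complex p q * T) (\<sigma> + Complex p' q' * T) = cmod ((Complex p q - Complex p' q') * T)"
      by (simp add: dist_norm algebra_simps)
    also have "\<dots> = sqrt ((p - p')\<^sup>2 + (q - q')\<^sup>2)" unfolding norm_mult T by (simp add: cmod_def)
    finally show ?thesis .
  qed
  have z: "\<zeta> = \<sigma> + Complex a m * T" using v by (simp add: algebra_simps)
  have l: "of_real x * T = Complex x 0 * T" for x by (simp add: complex_of_real_def)
  show ?thesis
  proof
    assume "0 < r \<and> (\<exists>c. \<zeta> \<in> sphere c r \<and> sphere c r \<inter> {\<sigma> + of_real x * T | x. True} = {\<sigma>})"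
    then obtain c where r: "0 < r" and c: "\<zeta> \<in> sphere c r" "sphere c r \<inter> {\<sigma> + of_real x * T | x. True} = {\<sigma>}"
      by blast
    have "T \<noteq> 0" using T by auto
    define w where "w = (c - \<sigma>) / T"
    obtain p q where w: "w = Complex p q" by (cases w)
    have c_eq: "c = \<sigma> + Complex p q * T" unfolding w[symmetric] w_def using \<open>T \<noteq> 0\<close> by simp
    have Complex_zero: "Complex 0 0 = 0" by (simp add: complex_eq_iff)
    have "\<sigma> \<in> sphere c r" using c(2) by blast
    then have 1: "sqrt (p\<^sup>2 + q\<^sup>2) = r" using rot[of p q 0 0] Complex_zero by (simp add: c_eq)
    \<comment> \<open>Reflecting \<open>\<sigma>\<close> in the perpendicular from the centre to the
      line gives another common point of circle and line; tangency forces it back to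
      \<open>\<sigma>\<close>, so the centre lies on the normal.\<close>
    have "\<sigma> + of_real (2 * p) * T \<in> sphere c r"
      unfolding l using rot[of p q "2 * p" 0] 1 by (simp add: c_eq)
    then have "\<sigma> + of_real (2 * p) * T = \<sigma>" using c(2) by blast
    then have "p = 0" using \<open>T \<noteq> 0\<close> by simp
    have "sqrt ((0 - a)\<^sup>2 + (q - m)\<^sup>2) = r" using c(1) rot[of 0 q a m] by (simp add: c_eq z \<open>p = 0\<close>)
    then have "sqrt (a\<^sup>2 + (q - m)\<^sup>2) = sqrt (q\<^sup>2)" using 1 \<open>p = 0\<close> by simp
    then have "a\<^sup>2 + (q - m)\<^sup>2 = q\<^sup>2" by (simp only: real_sqrt_eq_iff)
    then have q: "2 * m * q = a\<^sup>2 + m\<^sup>2" by (simp add: power2_eq_square algebra_simps)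
    have "0 < a\<^sup>2 + m\<^sup>2" using \<open>m > 0\<close> by (simp add: add_nonneg_pos)
    then have "0 < q" using q \<open>m > 0\<close> zero_less_mult_pos[of "2 * m" q] by simp
    then have "r = q" using 1 \<open>p = 0\<close> by simp
    then show "r = (a\<^sup>2 + m\<^sup>2) / (2 * m)" using q \<open>m > 0\<close> by (simp add: field_simps)
  next
    assume r: "r = (a\<^sup>2 + m\<^sup>2) / (2 * m)"
    have "0 < a\<^sup>2 + m\<^sup>2" using \<open>m > 0\<close> by (simp add: add_nonneg_pos)
    then have "r > 0" using \<open>m > 0\<close> r by simp
    have "2 * m * r = a\<^sup>2 + m\<^sup>2" using r \<open>m > 0\<close> by simp
    then have am: "(0 - a)\<^sup>2 + (r - m)\<^sup>2 = r\<^sup>2" by (simp add: power2_eq_square algebra_simps)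
    show "0 < r \<and> (\<exists>c. \<zeta> \<in> sphere c r \<and> sphere c r \<inter> {\<sigma> + of_real x * T | x. True} = {\<sigma>})"
    proof (intro conjI exI[of _ "\<sigma> + Complex 0 r * T"])
      show "\<zeta> \<in> sphere (\<sigma> + Complex 0 r * T) r"
        using rot[of 0 r a m] am \<open>r > 0\<close> by (simp add: z)
      have on_line: "dist (\<sigma> + Complex 0 r * T) (\<sigma> + of_real x * T) = r \<longleftrightarrow> x = 0" for x
      proof -
        have "dist (\<sigma> + Complex 0 r * T) (\<sigma> + of_real x * T) = r \<longleftrightarrow> sqrt (x\<^sup>2 + r\<^sup>2) = sqrt (r\<^sup>2)"
          unfolding l using rot[of 0 r x 0] \<open>r > 0\<close> by simp
        then show ?thesis by (simp only: real_sqrt_eq_iff) simp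
      qed
      show "sphere (\<sigma> + Complex 0 r * T) r \<inter> {\<sigma> + of_real x * T | x. True} = {\<sigma>}"
      proof (intro equalityI subsetI)
        fix y assume "y \<in> sphere (\<sigma> + Complex 0 r * T) r \<inter> {\<sigma> + of_real x * T | x. True}"
        then obtain x where "y = \<sigma> + of_real x * T" "dist (\<sigma> + Complex 0 r * T) y = r"
          unfolding Int_iff mem_Collect_eq mem_sphere by blast
        then show "y \<in> {\<sigma>}" using on_line[of x] by simp
      next
        fix y assume "y \<in> {\<sigma>}"
        then have "y = \<sigma> + of_real 0 * T" by simp
        then show "y \<in> sphere (\<sigma> + Complex 0 r * T) r \<inter> {\<sigma> + of_real x * T | x. True}"
          using on_line[of 0] unfolding mem_sphere Int_iff mem_Collect_eq by blast
      qed
    qed (rule \<open>r > 0\<close>)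
  qed
qed

context convex_body begin

text \<open>\<open>F\<close> extends the chord angle continuously to the closed period; its end
  values are the outgoing and the returning direction.\<close>

lemma has_integral_np_density:
  "((\<lambda>u. pi * np_density \<Omega> (\<gamma> t) (\<gamma> u)) has_integral (back_angle t - out_angle t)) {t..t + L}"
proof -
  define F where "F = (\<lambda>x. if x \<le> t then out_angle t else if t + L \<le> x then back_angle t else chord_angle t x)"
  have "((\<lambda>u. pi * np_density \<Omega> (\<gamma> t) (\<gamma> u)) has_integral (F (t + L) - F t)) {t..t + L}"
  proof (rule fundamental_theorem_of_calculus_interior_countable[OF _ countable_corners[of t]])
    have Fev: "eventually (\<lambda>x. F x = chord_angle t x) (nhds x)" if "t < x" "x < t + L" for x
    proof (rule eventually_mono)
      show "eventually (\<lambda>y. y \<in> {t<..<t + L}) (nhds x)"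
        using that by (intro eventually_nhds_in_open) auto
    qed (auto simp: F_def)
    show "continuous_on {t..t + L} F"
    proof (rule continuous_on_IccI)
      have "eventually (\<lambda>u. chord_angle t u = F u) (at_right t)"
        using eventually_chord_right by eventually_elim (auto simp: F_def)
      moreover have "(chord_angle t \<longlongrightarrow> F t) (at_right t)" using tendsto_out_angle by (simp add: F_def)
      ultimately show "(F \<longlongrightarrow> F t) (at_right t)" by (rule Lim_transform_eventually[rotated])
    next
      have "eventually (\<lambda>u. chord_angle t u = F u) (at_left (t + L))"
        using eventually_chord_left[of "t + L"] by eventually_elim (auto simp: F_def)
      moreover have "(chord_angle t \<longlongrightarrow> F (t + L)) (at_left (t + L))" using tendsto_back_angle L_pos by (simp add: F_def)
      ultimately show "(F \<longlongrightarrow> F (t + L)) (at_left (t + L))" by (rule Lim_transform_eventually[rotated])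
    next
      fix x assume x: "t < x" "x < t + L"
      have "isCont (chord_angle t) x"
        using continuous_chord_angle_snd[of t] x by (simp add: continuous_on_eq_continuous_at)
      then show "F \<midarrow>x\<rightarrow> F x" using isCont_cong[OF Fev[OF x]] by (simp add: isCont_def)
    qed (use L_pos in simp)
    fix x assume "x \<in> {t<..<t + L} - {u \<in> {t<..<t + L}. in_angle u \<noteq> out_angle u}"
    then have x: "in_angle x = out_angle x" "t < x" "x < t + L" by auto
    have "(F has_vector_derivative pi * np_density \<Omega> (\<gamma> t) (\<gamma> x)) (at x)
        \<longleftrightarrow> (chord_angle t has_vector_derivative pi * np_density \<Omega> (\<gamma> t) (\<gamma> x)) (at x)"
      using Fev[OF x(2,3)] eventually_nhds_x_imp_x[OF Fev[OF x(2,3)]] by (intro has_vector_derivative_cong_ev) auto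
    then show "(F has_vector_derivative pi * np_density \<Omega> (\<gamma> t) (\<gamma> x)) (at x)"
      using has_vector_derivative_chord_angle[OF x] by blast
  qed (use L_pos in simp)
  then show ?thesis using L_pos by (simp add: F_def)
qed

lemma gamma_surj:
  assumes "z \<in> frontier \<Omega>"
  obtains t where "0 \<le> t" "t < L" "z = \<gamma> t"
proof -
  have "z \<in> \<gamma> ` {0..<L}" using assms gamma_image_period by simp
  then show ?thesis using that by auto
qed

lemma gamma_after:
  obtains s' where "u \<le> s'" "s' < u + L" "\<gamma> s' = \<gamma> s"
proof -
  obtain k :: int where k: "0 \<le> (s - u) - of_int k * L" "(s - u) - of_int k * L < L"
    by (rule gamma_reduce[of "s - u"])
  show ?thesis
    using k gamma_periodic_int[of s "- k"] by (intro that[of "s - of_int k * L"]) auto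
qed

text \<open>All chords from \<open>\<gamma> u\<close> make an angle between 0 and pi with the
  outgoing tangent, so the boundary lies to its left. This is the source of positivity of the
  density.\<close>

lemma support_line:
  "0 \<le> Im ((\<gamma> s - \<gamma> u) * cnj (cis (out_angle u)))"
proof -
  obtain s' where s': "u \<le> s'" "s' < u + L" "\<gamma> s' = \<gamma> s" by (rule gamma_after)
  have "0 \<le> Im ((\<gamma> s' - \<gamma> u) * cnj (cis (out_angle u)))"
  proof (cases "s' = u")
    case False
    then have lt: "u < s'" using s' by simp
    define r where "r = cmod (\<gamma> s' - \<gamma> u)"
    have eq: "\<gamma> s' - \<gamma> u = of_real r * cis (chord_angle u s')"
      unfolding r_def by (rule chord_polar[OF lt s'(2)])
    have "Im ((\<gamma> s' - \<gamma> u) * cnj (cis (out_angle u))) = r * sin (chord_angle u s' - out_angle u)"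
      unfolding eq by (simp add: sin_diff algebra_simps)
    moreover have "0 \<le> sin (chord_angle u s' - out_angle u)"
      using out_angle_le[OF lt s'(2)] back_angle_ge[OF lt s'(2)] back_angle_le[of u] by (intro sin_ge_zero) auto
    ultimately show ?thesis by (simp add: r_def)
  qed simp
  then show ?thesis using s' by simp
qed

lemma Im_divide_chord:
  fixes T :: complex
  assumes "cmod T = 1"
  shows "Im (T / (p - q)) = Im ((q - p) * cnj T) / (cmod (p - q))\<^sup>2"
proof -
  have "T / (p - q) = T * cnj (p - q) / of_real ((cmod (p - q))\<^sup>2)"
    by (rule complex_div_cnj[unfolded of_real_power[symmetric]])
  then have "Im (T / (p - q)) = Im (T * cnj (p - q)) / (cmod (p - q))\<^sup>2" by (simp only: Im_divide_of_real)
  also have "Im (T * cnj (p - q)) = Im ((q - p) * cnj T)" by (simp add: algebra_simps)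
  finally show ?thesis .
qed

lemma np_density_eq:
  assumes "\<not> corner \<Omega> (\<gamma> u)" "\<gamma> u \<noteq> \<gamma> s"
  shows "np_density \<Omega> (\<gamma> s) (\<gamma> u)
    = Im ((\<gamma> s - \<gamma> u) * cnj (cis (out_angle u))) / (cmod (\<gamma> u - \<gamma> s))\<^sup>2 / pi"
proof -
  have "np_density \<Omega> (\<gamma> s) (\<gamma> u) = 1 / pi * Re (- \<i> * (cis (out_angle u) / (\<gamma> u - \<gamma> s)))"
    using assms by (simp add: np_density_def outer_normal_def unit_tangent_def tangent_out_gamma)
  also have "Re (- \<i> * (cis (out_angle u) / (\<gamma> u - \<gamma> s))) = Im (cis (out_angle u) / (\<gamma> u - \<gamma> s))"
    by (simp del: times_divide_eq_right)
  finally show ?thesis by (simp add: Im_divide_chord)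
qed

lemma np_density_nonneg: "0 \<le> np_density \<Omega> (\<gamma> s) (\<gamma> u)"
proof (cases "corner \<Omega> (\<gamma> u) \<or> \<gamma> u = \<gamma> s")
  case False
  then show ?thesis using support_line[of s u] by (simp add: np_density_eq)
qed (auto simp: np_density_def)

text \<open>In the tangent frame at \<open>\<gamma> u\<close> the point \<open>\<gamma> s\<close>
  has coordinate \<open>v\<close>. Off the tangent line the radius is
  \<open>(cmod v)\<^sup>2 / (2 * Im v)\<close> and the density
  \<open>Im v / (cmod v)\<^sup>2 / pi\<close>, so the reciprocal of this single radius is the
  right-hand side; the supremum only lowers it.\<close>

lemma inverse_max_tangent_radius_le:
  assumes "\<not> corner \<Omega> (\<gamma> u)" "\<gamma> u \<noteq> \<gamma> s"
  shows "1 / max_tangent_radius \<Omega> (\<gamma> u) \<le> ennreal (2 * pi * np_density \<Omega> (\<gamma> s) (\<gamma> u))"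
proof -
  define T where "T = cis (out_angle u)"
  define v where "v = (\<gamma> s - \<gamma> u) * cnj T"
  have T: "cmod T = 1" "T * cnj T = 1" "cnj T * T = 1" by (auto simp: T_def cis_cnj cis_mult)
  have sv: "\<gamma> s - \<gamma> u = Complex (Re v) (Im v) * T" unfolding complex_surj v_def mult.assoc T by simp
  have line: "tangent_line \<Omega> (\<gamma> u) = {\<gamma> u + of_real x * T | x. True}"
    by (simp add: tangent_line_def unit_tangent_def tangent_out_gamma T_def)
  have cv: "cmod (\<gamma> u - \<gamma> s) = cmod v" using T by (simp add: v_def norm_mult norm_minus_commute)
  have dens: "np_density \<Omega> (\<gamma> s) (\<gamma> u) = Im v / (cmod v)\<^sup>2 / pi"
    using np_density_eq[OF assms] unfolding cv by (simp add: v_def T_def)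
  have "tangent_circle_radius \<Omega> (\<gamma> s) (\<gamma> u) \<le> max_tangent_radius \<Omega> (\<gamma> u)"
    unfolding max_tangent_radius_def using assms(2) gamma_frontier[of s] by (intro SUP_upper) auto
  then have "1 / max_tangent_radius \<Omega> (\<gamma> u) \<le> 1 / tangent_circle_radius \<Omega> (\<gamma> s) (\<gamma> u)"
    by (simp add: divide_ennreal_def inverse_antimono_ennreal)
  also have "\<dots> \<le> ennreal (2 * pi * np_density \<Omega> (\<gamma> s) (\<gamma> u))"
  proof (cases "\<gamma> s \<in> tangent_line \<Omega> (\<gamma> u)")
    case True
    then show ?thesis by (simp add: tangent_circle_radius_def)
  next
    case False
    have "Im v \<noteq> 0"
    proof
      assume "Im v = 0"
      then have "v = of_real (Re v)" by (simp add: complex_eq_iff)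
      then have "\<gamma> s = \<gamma> u + of_real (Re v) * T" using sv \<open>Im v = 0\<close> by (simp add: complex_of_real_def algebra_simps)
      then show False using False line by auto
    qed
    moreover have "Im v \<ge> 0" unfolding v_def T_def by (rule support_line)
    ultimately have "Im v > 0" by simp
    then have "tangent_circle_radius \<Omega> (\<gamma> s) (\<gamma> u) = ennreal ((cmod v)\<^sup>2 / (2 * Im v))"
      using False unfolding tangent_circle_radius_def line tangent_circle_radius_unique[OF T(1) sv \<open>Im v > 0\<close>]
      by (simp add: cmod_power2)
    then have "1 / tangent_circle_radius \<Omega> (\<gamma> s) (\<gamma> u) = ennreal (1 / ((cmod v)\<^sup>2 / (2 * Im v)))"
    proof -
      have "v \<noteq> 0" using \<open>Im v > 0\<close> by auto
      then have "0 < (cmod v)\<^sup>2 / (2 * Im v)" using \<open>Im v > 0\<close> by simp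
      then show ?thesis
        using divide_ennreal[of 1 "(cmod v)\<^sup>2 / (2 * Im v)"]
        unfolding \<open>tangent_circle_radius \<Omega> (\<gamma> s) (\<gamma> u) = _\<close> by simp
    qed
    also have "1 / ((cmod v)\<^sup>2 / (2 * Im v)) = 2 * pi * np_density \<Omega> (\<gamma> s) (\<gamma> u)" unfolding dens by simp
    finally show ?thesis by simp
  qed
  finally show ?thesis .
qed

section \<open>Measurability on the boundary\<close>

abbreviation "BM \<equiv> restrict_space borel (frontier \<Omega>)"

lemma measurable_gamma: "\<gamma> \<in> borel \<rightarrow>\<^sub>M BM"
  by (intro measurable_restrict_space2 borel_measurable_continuous_onI gamma_continuous) (auto intro: gamma_frontier)

lemma frontier_borel: "frontier \<Omega> \<in> sets borel"
  by (simp add: borel_closed)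

lemma space_BM: "space BM = frontier \<Omega>"
  by (simp add: space_restrict_space)

text \<open>Transports functions of the parameter, such as the tangent direction, to the
  boundary.\<close>

definition bd_parameter :: "complex \<Rightarrow> real" where "bd_parameter = the_inv_into {0..<L} \<gamma>"

lemma inj_on_gamma: "inj_on \<gamma> {0..<L}"
  by (auto intro!: inj_onI gamma_inj_period)

lemma bd_parameter_gamma: "0 \<le> t \<Longrightarrow> t < L \<Longrightarrow> bd_parameter (\<gamma> t) = t"
  unfolding bd_parameter_def by (rule the_inv_into_f_f[OF inj_on_gamma]) auto

lemma gamma_bd_parameter:
  assumes "z \<in> frontier \<Omega>"
  shows "\<gamma> (bd_parameter z) = z" "0 \<le> bd_parameter z" "bd_parameter z < L"
proof -
  obtain t where "0 \<le> t" "t < L" "z = \<gamma> t" by (rule gamma_surj[OF assms])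
  then show "\<gamma> (bd_parameter z) = z" "0 \<le> bd_parameter z" "bd_parameter z < L" by (simp_all add: bd_parameter_gamma)
qed

text \<open>Sublevel sets below \<open>L\<close> are images of compact intervals under
  \<open>\<gamma>\<close>, hence closed.\<close>

lemma measurable_bd_parameter: "bd_parameter \<in> BM \<rightarrow>\<^sub>M restrict_space borel {0..<L}"
proof (rule measurable_restrict_space2)
  show "bd_parameter \<in> space BM \<rightarrow> {0..<L}" using gamma_bd_parameter by (auto simp: space_BM)
  show "bd_parameter \<in> borel_measurable BM"
  proof (subst borel_measurable_iff_le, rule allI)
    fix a
    have "{w \<in> space BM. bd_parameter w \<le> a} = (if a < L then \<gamma> ` {0..a} else frontier \<Omega>)"
    proof (cases "a < L")
      case True
      have "w \<in> \<gamma> ` {0..a}" if "w \<in> frontier \<Omega>" "bd_parameter w \<le> a" for w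
        using gamma_bd_parameter[OF that(1)] that(2) by (intro image_eqI[of _ _ "bd_parameter w"]) auto
      then show ?thesis using True by (auto simp: space_BM bd_parameter_gamma gamma_frontier)
    next
      case False
      have "bd_parameter w \<le> a" if "w \<in> frontier \<Omega>" for w using gamma_bd_parameter(3)[OF that] False by linarith
      then show ?thesis using False by (auto simp: space_BM)
    qed
    moreover have "\<gamma> ` {0..a} \<in> sets BM"
    proof -
      have "compact (\<gamma> ` {0..a})" by (intro compact_continuous_image gamma_continuous compact_Icc)
      then have "\<gamma> ` {0..a} \<in> sets borel" by (intro borel_closed compact_imp_closed)
      then show ?thesis using frontier_borel gamma_frontier by (auto simp: sets_restrict_space_iff)
    qed
    moreover have "frontier \<Omega> \<in> sets BM" using sets.top[of BM] by (simp add: space_BM)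
    ultimately show "{w \<in> space BM. bd_parameter w \<le> a} \<in> sets BM" by simp
  qed
qed

lemma measurable_out_angle: "out_angle \<in> borel_measurable (restrict_space borel {0..<L})"
  by (intro borel_measurable_mono_on_fnc mono_onI out_angle_mono) auto

lemma countable_corner_set: "countable {z \<in> frontier \<Omega>. corner \<Omega> z}"
proof (rule countable_subset)
  \<comment> \<open>The parameter 0 is added because \<open>countable_corners\<close> covers only an
    open period.\<close>
  show "countable (\<gamma> ` insert 0 {u \<in> {0<..<0 + L}. in_angle u \<noteq> out_angle u})"
    by (intro countable_image countable_insert countable_corners)
  show "{z \<in> frontier \<Omega>. corner \<Omega> z} \<subseteq> \<gamma> ` insert 0 {u \<in> {0<..<0 + L}. in_angle u \<noteq> out_angle u}"
  proof clarify
    fix z assume z: "z \<in> frontier \<Omega>" "corner \<Omega> z"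
    obtain t where t: "0 \<le> t" "t < L" "z = \<gamma> t" by (rule gamma_surj[OF z(1)])
    then have "in_angle t \<noteq> out_angle t" using z(2) not_corner_gamma by auto
    then have "t \<in> insert 0 {u \<in> {0<..<0 + L}. in_angle u \<noteq> out_angle u}" using t by auto
    then show "z \<in> \<gamma> ` insert 0 {u \<in> {0<..<0 + L}. in_angle u \<noteq> out_angle u}" using t(3) by blast
  qed
qed

text \<open>Off a countable set the density is a Borel expression in the point and its tangent
  direction; the latter is measurable because \<open>out_angle\<close> is monotone on a
  period.\<close>

lemma measurable_np_density: "np_density \<Omega> \<zeta> \<in> borel_measurable BM"
proof -
  define C where "C = {z \<in> frontier \<Omega>. corner \<Omega> z \<or> z = \<zeta>}"
  have "countable C"
  proof (rule countable_subset)
    show "C \<subseteq> insert \<zeta> {z \<in> frontier \<Omega>. corner \<Omega> z}" by (auto simp: C_def)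
  qed (intro countable_insert countable_corner_set)
  moreover have "{z} \<in> sets BM" if "z \<in> C" for z
    using that frontier_borel by (auto simp: sets_restrict_space_iff C_def)
  ultimately have [measurable]: "C \<in> sets BM" by (rule sets.countable[rotated])
  have [measurable]: "(\<lambda>z. z) \<in> borel_measurable BM" by (intro measurable_restrict_space1) simp
  have [measurable]: "(\<lambda>z. out_angle (bd_parameter z)) \<in> borel_measurable BM"
    by (rule measurable_compose[OF measurable_bd_parameter measurable_out_angle])
  have "cis \<in> borel_measurable borel"
    by (intro borel_measurable_continuous_onI continuous_intros)
  then have [measurable]: "(\<lambda>z. cis (out_angle (bd_parameter z))) \<in> borel_measurable BM"
    by (rule measurable_compose[rotated]) measurable
  have "(\<lambda>z. if z \<in> C then 0 else 1 / pi * Re (- \<i> * cis (out_angle (bd_parameter z)) / (z - \<zeta>))) \<in> borel_measurable BM"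
    by measurable
  moreover have "np_density \<Omega> \<zeta> z = (if z \<in> C then 0 else 1 / pi * Re (- \<i> * cis (out_angle (bd_parameter z)) / (z - \<zeta>)))"
    if "z \<in> space BM" for z
    using that tangent_out_gamma[of "bd_parameter z"] gamma_bd_parameter[of z]
    by (simp add: np_density_def C_def space_BM outer_normal_def unit_tangent_def)
  ultimately show ?thesis by (subst measurable_cong) auto
qed

lemma nn_integral_arclength:
  assumes "f \<in> borel_measurable BM"
  shows "(\<integral>\<^sup>+z. f z \<partial>arclength_measure \<Omega>) = (\<integral>\<^sup>+t. f (\<gamma> t) * indicator {0..<L} t \<partial>lborel)"
proof -
  have "\<gamma> \<in> restrict_space lborel {0..<L} \<rightarrow>\<^sub>M BM"
    using measurable_gamma by (intro measurable_restrict_space1) simp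
  then have "(\<integral>\<^sup>+z. f z \<partial>arclength_measure \<Omega>) = (\<integral>\<^sup>+t. f (\<gamma> t) \<partial>restrict_space lborel {0..<L})"
    unfolding arclength_measure_def using assms by (intro nn_integral_distr) auto
  also have "\<dots> = (\<integral>\<^sup>+t. f (\<gamma> t) * indicator {0..<L} t \<partial>lborel)"
    by (intro nn_integral_restrict_space) auto
  finally show ?thesis .
qed

lemma measurable_np_density_gamma: "(\<lambda>t. np_density \<Omega> \<zeta> (\<gamma> t)) \<in> borel_measurable borel"
  by (rule measurable_compose[OF measurable_gamma measurable_np_density])

text \<open>The period of integration is moved to start at the parameter of \<open>\<zeta>\<close>,
  where \<open>has_integral_np_density\<close> applies.\<close>

lemma nn_integral_np_density:
  assumes "\<zeta> \<in> frontier \<Omega>"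
  shows "(\<integral>\<^sup>+t. ennreal (np_density \<Omega> \<zeta> (\<gamma> t)) * indicator {0..<L} t \<partial>lborel) = ennreal (interior_angle \<Omega> \<zeta> / pi)"
proof -
  obtain a where a: "0 \<le> a" "a < L" "\<zeta> = \<gamma> a" by (rule gamma_surj[OF assms])
  have [measurable]: "(\<lambda>t. np_density \<Omega> \<zeta> (\<gamma> t)) \<in> borel_measurable borel"
    by (rule measurable_np_density_gamma)
  have "((\<lambda>u. (1 / pi) * (pi * np_density \<Omega> \<zeta> (\<gamma> u))) has_integral (1 / pi) * interior_angle \<Omega> \<zeta>) {a..a + L}"
    unfolding a(3) interior_angle_gamma by (intro has_integral_mult_right has_integral_np_density)
  then have I: "((\<lambda>u. np_density \<Omega> \<zeta> (\<gamma> u)) has_integral interior_angle \<Omega> \<zeta> / pi) {a..a + L}" by simp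
  have "(\<integral>\<^sup>+t. ennreal (np_density \<Omega> \<zeta> (\<gamma> t)) * indicator {0..<L} t \<partial>lborel)
      = (\<integral>\<^sup>+t. ennreal (np_density \<Omega> \<zeta> (\<gamma> t)) * indicator {a..<a + L} t \<partial>lborel)"
  proof (rule nn_integral_period_shift)
    show "(\<lambda>t. ennreal (np_density \<Omega> \<zeta> (\<gamma> t))) \<in> borel_measurable borel" by measurable
  qed (use a in \<open>simp_all add: gamma_periodic\<close>)
  also have "\<dots> = (\<integral>\<^sup>+t. ennreal (np_density \<Omega> \<zeta> (\<gamma> t)) * indicator {a..a + L} t \<partial>lborel)"
  proof (rule nn_integral_cong_AE)
    show "AE t in lborel. ennreal (np_density \<Omega> \<zeta> (\<gamma> t)) * indicator {a..<a + L} t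
        = ennreal (np_density \<Omega> \<zeta> (\<gamma> t)) * indicator {a..a + L} t"
      using AE_lborel_singleton[of "a + L"] by eventually_elim (auto simp: indicator_def)
  qed
  also have "\<dots> = ennreal (interior_angle \<Omega> \<zeta> / pi)"
    by (rule nn_integral_has_integral_lebesgue'[OF _ I]) (simp add: a(3) np_density_nonneg)
  finally show ?thesis .
qed

section \<open>The measures as integrals over the parameter\<close>

text \<open>The point mass at \<open>\<zeta>\<close> is spread over the extra parameter interval \<open>[-1, 0)\<close>, so that integrals
  against \<open>np_measure\<close> become Lebesgue integrals on the line.\<close>

definition ext_weight :: "complex \<Rightarrow> real \<Rightarrow> real" where
  "ext_weight \<zeta> t = (1 - interior_angle \<Omega> \<zeta> / pi) * indicator {-1..<0} t
     + np_density \<Omega> \<zeta> (\<gamma> t) * indicator {0..<L} t"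

definition ext_curve :: "complex \<Rightarrow> real \<Rightarrow> complex" where
  "ext_curve \<zeta> t = (if t < 0 then \<zeta> else \<gamma> t)"

lemma interior_angle_bounds:
  assumes "\<zeta> \<in> frontier \<Omega>"
  shows "0 \<le> interior_angle \<Omega> \<zeta>" "interior_angle \<Omega> \<zeta> \<le> pi"
proof -
  obtain t where "\<zeta> = \<gamma> t" by (rule gamma_surj[OF assms])
  then show "0 \<le> interior_angle \<Omega> \<zeta>" "interior_angle \<Omega> \<zeta> \<le> pi"
    using out_less_back_angle[of t] back_angle_le[of t] by (auto simp: interior_angle_gamma)
qed

lemma np_density_frontier_nonneg: "\<zeta> \<in> frontier \<Omega> \<Longrightarrow> 0 \<le> np_density \<Omega> \<zeta> (\<gamma> u)"
  using gamma_surj[of \<zeta>] np_density_nonneg by metis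

lemma point_weight_nonneg: "\<zeta> \<in> frontier \<Omega> \<Longrightarrow> 0 \<le> 1 - interior_angle \<Omega> \<zeta> / pi"
  using interior_angle_bounds[of \<zeta>] by simp

lemma ext_weight_nonneg: "\<zeta> \<in> frontier \<Omega> \<Longrightarrow> 0 \<le> ext_weight \<zeta> t"
  unfolding ext_weight_def
  by (intro add_nonneg_nonneg mult_nonneg_nonneg point_weight_nonneg np_density_frontier_nonneg) auto

lemma measurable_ext_weight [measurable]: "ext_weight \<zeta> \<in> borel_measurable borel"
proof -
  note [measurable] = measurable_np_density_gamma
  show ?thesis unfolding ext_weight_def[abs_def] by measurable
qed

lemma measurable_ext_curve: "\<zeta> \<in> frontier \<Omega> \<Longrightarrow> ext_curve \<zeta> \<in> borel \<rightarrow>\<^sub>M BM"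
proof -
  assume "\<zeta> \<in> frontier \<Omega>"
  note [measurable] = measurable_gamma
  have [measurable]: "(\<lambda>t::real. \<zeta>) \<in> borel \<rightarrow>\<^sub>M BM"
    using \<open>\<zeta> \<in> frontier \<Omega>\<close> by (intro measurable_const) (simp add: space_BM)
  show ?thesis unfolding ext_curve_def[abs_def] by measurable
qed

lemma ennreal_ext_weight:
  assumes "\<zeta> \<in> frontier \<Omega>"
  shows "ennreal (ext_weight \<zeta> t) = ennreal (1 - interior_angle \<Omega> \<zeta> / pi) * indicator {-1..<0} t
     + ennreal (np_density \<Omega> \<zeta> (\<gamma> t)) * indicator {0..<L} t"
  using point_weight_nonneg[OF assms] np_density_frontier_nonneg[OF assms, of t]
  by (auto simp: ext_weight_def indicator_def)

text \<open>\<open>measure_of\<close> keeps the prescribed values only if these form a measure;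
  agreement with a push-forward settles countable additivity.\<close>

lemma np_measure_eq:
  assumes z: "\<zeta> \<in> frontier \<Omega>"
  shows "np_measure \<Omega> \<zeta> = distr (density lborel (\<lambda>t. ennreal (ext_weight \<zeta> t))) BM (ext_curve \<zeta>)" (is "_ = ?N")
proof -
  have ec [measurable]: "ext_curve \<zeta> \<in> borel \<rightarrow>\<^sub>M BM" by (rule measurable_ext_curve[OF z])
  have nd [measurable]: "np_density \<Omega> \<zeta> \<in> borel_measurable BM" by (rule measurable_np_density)
  note measurable_np_density_gamma[measurable]
  have eq: "ennreal (1 - interior_angle \<Omega> \<zeta> / pi) * indicator A \<zeta>
          + (\<integral>\<^sup>+\<sigma>\<in>A. ennreal (np_density \<Omega> \<zeta> \<sigma>) \<partial>arclength_measure \<Omega>) = emeasure ?N A"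
    if A [measurable]: "A \<in> sets BM" for A
  proof -
    have gA [measurable]: "{t. \<gamma> t \<in> A} \<in> sets borel"
      using measurable_sets[OF measurable_gamma A] by (simp add: vimage_def)
    have "emeasure ?N A = emeasure (density lborel (\<lambda>t. ennreal (ext_weight \<zeta> t))) (ext_curve \<zeta> -` A)"
      using ec A by (subst emeasure_distr) auto
    also have "\<dots> = (\<integral>\<^sup>+t. ennreal (ext_weight \<zeta> t) * indicator (ext_curve \<zeta> -` A) t \<partial>lborel)"
      using measurable_sets[OF ec A] by (intro emeasure_density) auto
    also have "\<dots> = (\<integral>\<^sup>+t. ennreal (1 - interior_angle \<Omega> \<zeta> / pi) * indicator A \<zeta> * indicator {-1..<0} t
        + ennreal (np_density \<Omega> \<zeta> (\<gamma> t)) * indicator {t. \<gamma> t \<in> A} t * indicator {0..<L} t \<partial>lborel)"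
      by (intro nn_integral_cong) (auto simp: ennreal_ext_weight[OF z] ext_curve_def indicator_def)
    also have "\<dots> = (\<integral>\<^sup>+t. ennreal (1 - interior_angle \<Omega> \<zeta> / pi) * indicator A \<zeta> * indicator {-1..<0::real} t \<partial>lborel)
        + (\<integral>\<^sup>+t. ennreal (np_density \<Omega> \<zeta> (\<gamma> t)) * indicator {t. \<gamma> t \<in> A} t * indicator {0..<L} t \<partial>lborel)"
      by (intro nn_integral_add) auto
    also have "(\<integral>\<^sup>+t. ennreal (1 - interior_angle \<Omega> \<zeta> / pi) * indicator A \<zeta> * indicator {-1..<0::real} t \<partial>lborel)
        = ennreal (1 - interior_angle \<Omega> \<zeta> / pi) * indicator A \<zeta>"
      by (subst nn_integral_cmult_indicator) auto
    also have "(\<integral>\<^sup>+t. ennreal (np_density \<Omega> \<zeta> (\<gamma> t)) * indicator {t. \<gamma> t \<in> A} t * indicator {0..<L} t \<partial>lborel)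
        = (\<integral>\<^sup>+t. ennreal (np_density \<Omega> \<zeta> (\<gamma> t)) * indicator A (\<gamma> t) * indicator {0..<L} t \<partial>lborel)"
      by (intro nn_integral_cong) (auto simp: indicator_def)
    also have "\<dots> = (\<integral>\<^sup>+\<sigma>\<in>A. ennreal (np_density \<Omega> \<zeta> \<sigma>) \<partial>arclength_measure \<Omega>)"
      by (rule nn_integral_arclength[symmetric]) measurable
    finally show ?thesis by simp
  qed
  have sig: "sigma_sets (frontier \<Omega>) (sets BM) = sets BM"
    using sets.sigma_sets_eq[of BM] by (simp add: space_BM)
  have "np_measure \<Omega> \<zeta> = measure_of (frontier \<Omega>) (sets BM) (emeasure ?N)"
    unfolding np_measure_def
  proof (rule measure_of_eq)
    show "sets BM \<subseteq> Pow (frontier \<Omega>)" using sets.space_closed[of BM] by (simp add: space_BM)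
  qed (simp add: sig eq)
  also have "\<dots> = measure_of (space ?N) (sets ?N) (emeasure ?N)" by (simp add: space_BM)
  also have "\<dots> = ?N" by (rule measure_of_of_measure)
  finally show ?thesis .
qed

text \<open>The density contributes the interior angle over pi, and the point mass is exactly what
  is missing to 1.\<close>

lemma nn_integral_ext_weight:
  assumes z: "\<zeta> \<in> frontier \<Omega>"
  shows "(\<integral>\<^sup>+t. ennreal (ext_weight \<zeta> t) \<partial>lborel) = 1"
proof -
  note measurable_np_density_gamma[measurable]
  have "(\<integral>\<^sup>+t. ennreal (ext_weight \<zeta> t) \<partial>lborel)
      = (\<integral>\<^sup>+t. ennreal (1 - interior_angle \<Omega> \<zeta> / pi) * indicator {-1..<0::real} t \<partial>lborel)
       + (\<integral>\<^sup>+t. ennreal (np_density \<Omega> \<zeta> (\<gamma> t)) * indicator {0..<L} t \<partial>lborel)"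
    unfolding ennreal_ext_weight[OF z] by (intro nn_integral_add) auto
  also have "\<dots> = ennreal (1 - interior_angle \<Omega> \<zeta> / pi) + ennreal (interior_angle \<Omega> \<zeta> / pi)"
    unfolding nn_integral_np_density[OF z] by (subst nn_integral_cmult_indicator) auto
  also have "\<dots> = 1"
    using point_weight_nonneg[OF z] interior_angle_bounds[OF z] by (subst ennreal_plus[symmetric]) auto
  finally show ?thesis .
qed

lemma ext_weight_integral:
  assumes z: "\<zeta> \<in> frontier \<Omega>"
  shows "integrable lborel (ext_weight \<zeta>)" "(\<integral>t. ext_weight \<zeta> t \<partial>lborel) = 1"
proof -
  have "has_bochner_integral lborel (ext_weight \<zeta>) 1"
    using nn_integral_ext_weight[OF z] ext_weight_nonneg[OF z]
    by (intro has_bochner_integral_nn_integral) auto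
  then show "integrable lborel (ext_weight \<zeta>)" "(\<integral>t. ext_weight \<zeta> t \<partial>lborel) = 1"
    by (auto simp: has_bochner_integral_iff)
qed

lemma measurable_frontier: "continuous_on (frontier \<Omega>) f \<Longrightarrow> f \<in> borel_measurable BM" for f :: "complex \<Rightarrow> complex"
  by (rule borel_measurable_continuous_on_restrict)

lemma np_operator_eq:
  assumes z: "\<zeta> \<in> frontier \<Omega>" and f: "continuous_on (frontier \<Omega>) f"
  shows "np_operator \<Omega> f \<zeta> = (\<integral>t. ext_weight \<zeta> t *\<^sub>R f (ext_curve \<zeta> t) \<partial>lborel)"
proof -
  have ec: "ext_curve \<zeta> \<in> density lborel (\<lambda>t. ennreal (ext_weight \<zeta> t)) \<rightarrow>\<^sub>M BM"
    using measurable_ext_curve[OF z] by simp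
  have "np_operator \<Omega> f \<zeta> = (\<integral>t. f (ext_curve \<zeta> t) \<partial>density lborel (\<lambda>t. ennreal (ext_weight \<zeta> t)))"
    unfolding np_operator_def np_measure_eq[OF z]
    by (rule integral_distr[OF ec measurable_frontier[OF f]])
  also have "\<dots> = (\<integral>t. ext_weight \<zeta> t *\<^sub>R f (ext_curve \<zeta> t) \<partial>lborel)"
    using measurable_compose[OF measurable_ext_curve[OF z] measurable_frontier[OF f]] ext_weight_nonneg[OF z]
    by (intro integral_density) auto
  finally show ?thesis .
qed

lemma frontier_nonempty: "frontier \<Omega> \<noteq> {}"
  using gamma_frontier[of 0] by auto

lemma bdd_above_norm_diff:
  assumes "continuous_on (frontier \<Omega>) f"
  shows "bdd_above ((\<lambda>z. cmod (f z - l)) ` frontier \<Omega>)"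
proof -
  have "compact ((\<lambda>z. cmod (f z - l)) ` frontier \<Omega>)"
    using assms compact by (intro compact_continuous_image continuous_intros compact_frontier)
  then show ?thesis by (intro bounded_imp_bdd_above compact_imp_bounded)
qed

text \<open>If all the measures \<open>\<mu>\<^sub>\<zeta>\<close> dominate one measure of mass \<open>m\<close>, then subtracting it
  contracts oscillations by the factor \<open>1 - m\<close>.\<close>

lemma np_operator_near_constant:
  fixes n :: "real \<Rightarrow> real"
  assumes [measurable]: "n \<in> borel_measurable borel" and n: "\<And>t. 0 \<le> n t" "\<And>t. t \<notin> {0..<L} \<Longrightarrow> n t = 0"
    and dom: "\<And>\<zeta>. \<zeta> \<in> frontier \<Omega> \<Longrightarrow> AE t in lborel. n t \<le> ext_weight \<zeta> t"
    and f: "continuous_on (frontier \<Omega>) f" and z: "\<zeta> \<in> frontier \<Omega>"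
  shows "cmod (np_operator \<Omega> f \<zeta> - (l + (\<integral>t. n t *\<^sub>R (f (\<gamma> t) - l) \<partial>lborel)))
     \<le> (1 - (\<integral>t. n t \<partial>lborel)) * (SUP z\<in>frontier \<Omega>. cmod (f z - l))"
proof -
  define M where "M = (SUP z\<in>frontier \<Omega>. cmod (f z - l))"
  have M: "cmod (f z - l) \<le> M" if "z \<in> frontier \<Omega>" for z
    unfolding M_def using bdd_above_norm_diff[OF f] that by (intro cSUP_upper)
  define h where "h = (\<lambda>t. f (ext_curve \<zeta> t) - l)"
  have ecf: "ext_curve \<zeta> t \<in> frontier \<Omega>" for t using z gamma_frontier by (simp add: ext_curve_def)
  have [measurable]: "(\<lambda>t. f (ext_curve \<zeta> t)) \<in> borel_measurable borel"
    by (rule measurable_compose[OF measurable_ext_curve[OF z] measurable_frontier[OF f]])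
  then have [measurable]: "h \<in> borel_measurable borel" unfolding h_def by measurable
  note w = ext_weight_integral[OF z]
  have hM: "cmod (h t) \<le> M" for t unfolding h_def by (rule M[OF ecf])
  have bound: "integrable lborel (\<lambda>t. g t *\<^sub>R h t)" if g: "integrable lborel g" for g :: "real \<Rightarrow> real"
  proof (rule Bochner_Integration.integrable_bound)
    show "integrable lborel (\<lambda>t. g t * M)" using g by simp
    have "g \<in> borel_measurable borel" using g by (simp add: borel_measurable_integrable)
    then show "(\<lambda>t. g t *\<^sub>R h t) \<in> borel_measurable lborel" by measurable
    show "AE t in lborel. norm (g t *\<^sub>R h t) \<le> norm (g t * M)"
      using hM by (intro AE_I2) (auto simp: abs_mult intro!: mult_left_mono order_trans[OF hM abs_ge_self])
  qed
  have ni: "integrable lborel n"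
  proof (rule Bochner_Integration.integrable_bound[OF w(1)])
    show "AE t in lborel. norm (n t) \<le> norm (ext_weight \<zeta> t)"
      using dom[OF z] by eventually_elim (use n(1) in \<open>simp add: order_trans[OF _ abs_ge_self]\<close>)
  qed simp
  have "np_operator \<Omega> f \<zeta> = (\<integral>t. ext_weight \<zeta> t *\<^sub>R h t + ext_weight \<zeta> t *\<^sub>R l \<partial>lborel)"
    unfolding np_operator_eq[OF z f] h_def by (simp add: scaleR_diff_right)
  also have "\<dots> = (\<integral>t. ext_weight \<zeta> t *\<^sub>R h t \<partial>lborel) + l"
    using bound[OF w(1)] w by (subst Bochner_Integration.integral_add) auto
  finally have 1: "np_operator \<Omega> f \<zeta> = (\<integral>t. ext_weight \<zeta> t *\<^sub>R h t \<partial>lborel) + l" .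
  \<comment> \<open>\<open>n\<close> vanishes at negative parameters, the only ones where
    \<open>ext_curve \<zeta>\<close> and \<open>\<gamma>\<close> can differ.\<close>
  have "(\<lambda>t. n t *\<^sub>R (f (\<gamma> t) - l)) = (\<lambda>t. n t *\<^sub>R h t)"
    using n(2) by (force simp: h_def ext_curve_def)
  then have "np_operator \<Omega> f \<zeta> - (l + (\<integral>t. n t *\<^sub>R (f (\<gamma> t) - l) \<partial>lborel))
      = (\<integral>t. ext_weight \<zeta> t *\<^sub>R h t - n t *\<^sub>R h t \<partial>lborel)"
    unfolding 1 using bound[OF w(1)] bound[OF ni] by (subst Bochner_Integration.integral_diff) auto
  also have "cmod \<dots> \<le> (\<integral>t. cmod (ext_weight \<zeta> t *\<^sub>R h t - n t *\<^sub>R h t) \<partial>lborel)"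
    by (rule integral_norm_bound)
  also have "\<dots> \<le> (\<integral>t. (ext_weight \<zeta> t - n t) * M \<partial>lborel)"
  proof (rule integral_mono_AE)
    show "integrable lborel (\<lambda>t. cmod (ext_weight \<zeta> t *\<^sub>R h t - n t *\<^sub>R h t))"
      using bound[OF w(1)] bound[OF ni] by (intro integrable_norm Bochner_Integration.integrable_diff)
    show "integrable lborel (\<lambda>t. (ext_weight \<zeta> t - n t) * M)" using w ni by simp
    show "AE t in lborel. cmod (ext_weight \<zeta> t *\<^sub>R h t - n t *\<^sub>R h t) \<le> (ext_weight \<zeta> t - n t) * M"
      using dom[OF z]
    proof eventually_elim
      case (elim t)
      have "cmod (ext_weight \<zeta> t *\<^sub>R h t - n t *\<^sub>R h t) = (ext_weight \<zeta> t - n t) * cmod (h t)"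
        using elim by (simp add: scaleR_diff_left[symmetric])
      also have "\<dots> \<le> (ext_weight \<zeta> t - n t) * M" using elim hM by (intro mult_left_mono) auto
      finally show ?case .
    qed
  qed
  also have "\<dots> = (1 - (\<integral>t. n t \<partial>lborel)) * M" using w ni by simp
  finally show ?thesis unfolding M_def .
qed

section \<open>The contraction estimate\<close>

lemma quotient_norm_le:
  assumes f: "bdd_above ((\<lambda>z. cmod (g z - l)) ` frontier \<Omega>)" and b: "\<And>z. z \<in> frontier \<Omega> \<Longrightarrow> cmod (g z - l) \<le> B"
  shows "quotient_norm (frontier \<Omega>) g \<le> B"
  unfolding quotient_norm_def
proof (rule cINF_lower2)
  obtain z0 where z0: "z0 \<in> frontier \<Omega>" using frontier_nonempty by auto
  show "(SUP z\<in>frontier \<Omega>. cmod (g z - l)) \<le> B" using b frontier_nonempty by (intro cSUP_least)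
  \<comment> \<open>A real infimum is a lower bound only for a family bounded below. Here 0 is a
    bound, once each supremum is known to be over a bounded set.\<close>
  have "0 \<le> (SUP z\<in>frontier \<Omega>. cmod (g z - k))" for k
  proof -
    have "cmod (g z - k) \<le> B + cmod (l - k)" if "z \<in> frontier \<Omega>" for z
      using b[OF that] norm_triangle_ineq[of "g z - l" "l - k"] by simp
    then have "bdd_above ((\<lambda>z. cmod (g z - k)) ` frontier \<Omega>)" by (intro bdd_aboveI2)
    then have "cmod (g z0 - k) \<le> (SUP z\<in>frontier \<Omega>. cmod (g z - k))" using z0 by (intro cSUP_upper)
    then show ?thesis by (rule order_trans[OF norm_ge_zero])
  qed
  then show "bdd_below (range (\<lambda>l. SUP z\<in>frontier \<Omega>. cmod (g z - l)))" by (intro bdd_belowI2)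
qed simp

lemma quotient_norm_np_operator:
  fixes n :: "real \<Rightarrow> real"
  assumes n: "n \<in> borel_measurable borel" "\<And>t. 0 \<le> n t" "\<And>t. t \<notin> {0..<L} \<Longrightarrow> n t = 0"
    and dom: "\<And>\<zeta>. \<zeta> \<in> frontier \<Omega> \<Longrightarrow> AE t in lborel. n t \<le> ext_weight \<zeta> t"
    and f: "continuous_on (frontier \<Omega>) f" and m: "(\<integral>t. n t \<partial>lborel) \<le> 1"
  shows "quotient_norm (frontier \<Omega>) (np_operator \<Omega> f) \<le> (1 - (\<integral>t. n t \<partial>lborel)) * quotient_norm (frontier \<Omega>) f"
proof -
  let ?q = "quotient_norm (frontier \<Omega>) (np_operator \<Omega> f)" and ?m = "\<integral>t. n t \<partial>lborel"
  \<comment> \<open>The constant subtracted from \<open>np_operator \<Omega> f\<close> depends on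
    \<open>l\<close> but not on the boundary point, so it is admissible in the quotient
    norm.\<close>
  have le: "?q \<le> (1 - ?m) * (SUP z\<in>frontier \<Omega>. cmod (f z - l))" for l
    using np_operator_near_constant[OF n dom f]
    by (intro quotient_norm_le[where l = "l + (\<integral>t. n t *\<^sub>R (f (\<gamma> t) - l) \<partial>lborel)"] bdd_aboveI2) auto
  \<comment> \<open>Passing to the infimum over \<open>l\<close> divides by \<open>1 - ?m\<close>,
    so mass 1 is treated apart.\<close>
  show ?thesis
  proof (cases "?m = 1")
    case True
    then show ?thesis using le[of 0] by simp
  next
    case False
    then have pos: "0 < 1 - ?m" using m by simp
    have "?q / (1 - ?m) \<le> (SUP z\<in>frontier \<Omega>. cmod (f z - l))" for l
      using le[of l] pos by (simp add: pos_divide_le_eq mult.commute)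
    then have "?q / (1 - ?m) \<le> quotient_norm (frontier \<Omega>) f"
      unfolding quotient_norm_def by (intro cINF_greatest) auto
    then show ?thesis using pos by (simp add: pos_divide_le_eq mult.commute)
  qed
qed

lemma integral_dominated_le_1:
  fixes n :: "real \<Rightarrow> real"
  assumes n: "n \<in> borel_measurable borel" "\<And>t. 0 \<le> n t"
    and dom: "\<And>\<zeta>. \<zeta> \<in> frontier \<Omega> \<Longrightarrow> AE t in lborel. n t \<le> ext_weight \<zeta> t"
  shows "integrable lborel n" "(\<integral>t. n t \<partial>lborel) \<le> 1"
proof -
  obtain z where z: "z \<in> frontier \<Omega>" using frontier_nonempty by auto
  note w = ext_weight_integral[OF z]
  show ni: "integrable lborel n"
  proof (rule Bochner_Integration.integrable_bound[OF w(1)])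
    show "AE t in lborel. norm (n t) \<le> norm (ext_weight z t)"
      using dom[OF z] by eventually_elim (use n(2) in \<open>simp add: order_trans[OF _ abs_ge_self]\<close>)
  qed (use n(1) in simp)
  have "(\<integral>t. n t \<partial>lborel) \<le> (\<integral>t. ext_weight z t \<partial>lborel)"
    by (rule integral_mono_AE[OF ni w(1) dom[OF z]])
  then show "(\<integral>t. n t \<partial>lborel) \<le> 1" using w(2) by simp
qed

lemma config_constant_le:
  fixes n :: "real \<Rightarrow> real"
  assumes n: "n \<in> borel_measurable borel" "\<And>t. 0 \<le> n t" "\<And>t. t \<notin> {0..<L} \<Longrightarrow> n t = 0"
    and dom: "\<And>\<zeta>. \<zeta> \<in> frontier \<Omega> \<Longrightarrow> AE t in lborel. n t \<le> ext_weight \<zeta> t"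
  shows "config_constant \<Omega> \<le> 1 - (\<integral>t. n t \<partial>lborel)"
  unfolding config_constant_def
proof (rule cSUP_least)
  have "quotient_norm (frontier \<Omega>) (\<lambda>z. 0) \<le> 0" by (rule quotient_norm_le[of _ 0]) auto
  then show "{g. continuous_on (frontier \<Omega>) g \<and> quotient_norm (frontier \<Omega>) g \<le> 1} \<noteq> {}"
    by (auto intro!: exI[of _ "\<lambda>z. 0"])
next
  fix g assume "g \<in> {g. continuous_on (frontier \<Omega>) g \<and> quotient_norm (frontier \<Omega>) g \<le> 1}"
  then have g: "continuous_on (frontier \<Omega>) g" "quotient_norm (frontier \<Omega>) g \<le> 1" by auto
  have m: "(\<integral>t. n t \<partial>lborel) \<le> 1" using integral_dominated_le_1[OF n(1,2) dom] by simp
  have "quotient_norm (frontier \<Omega>) (np_operator \<Omega> g) \<le> (1 - (\<integral>t. n t \<partial>lborel)) * quotient_norm (frontier \<Omega>) g"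
    by (rule quotient_norm_np_operator[OF n dom g(1) m])
  also have "\<dots> \<le> (1 - (\<integral>t. n t \<partial>lborel)) * 1" using g(2) m by (intro mult_left_mono) auto
  finally show "quotient_norm (frontier \<Omega>) (np_operator \<Omega> g) \<le> 1 - (\<integral>t. n t \<partial>lborel)" by simp
qed

lemma AE_gamma_regular: "AE t in lborel. t \<in> {0..<L} \<longrightarrow> \<not> corner \<Omega> (\<gamma> t) \<and> \<gamma> t \<noteq> \<zeta>"
proof (rule AE_I)
  let ?C = "bd_parameter ` {z \<in> frontier \<Omega>. corner \<Omega> z \<or> z = \<zeta>}"
  have "{z \<in> frontier \<Omega>. corner \<Omega> z \<or> z = \<zeta>} \<subseteq> insert \<zeta> {z \<in> frontier \<Omega>. corner \<Omega> z}" by auto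
  then have "countable ?C"
    by (intro countable_image countable_subset[OF _ countable_insert[OF countable_corner_set]])
  then show "emeasure lborel ?C = 0" "?C \<in> sets lborel"
    using countable_imp_null_set_lborel[of ?C] by auto
  have "t \<in> ?C" if "t \<in> {0..<L}" "corner \<Omega> (\<gamma> t) \<or> \<gamma> t = \<zeta>" for t
    using that bd_parameter_gamma[of t] gamma_frontier[of t] by (intro image_eqI[of _ _ "\<gamma> t"]) auto
  then show "{t \<in> space lborel. \<not> (t \<in> {0..<L} \<longrightarrow> \<not> corner \<Omega> (\<gamma> t) \<and> \<gamma> t \<noteq> \<zeta>)} \<subseteq> ?C"
    by blast
qed

text \<open>The lower integral is a supremum over simple functions, so no measurability of
  \<open>max_tangent_radius\<close> is needed.\<close>

lemma nn_integral_inverse_radius_le: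
  "(\<integral>\<^sup>+\<sigma>. 1 / max_tangent_radius \<Omega> \<sigma> \<partial>arclength_measure \<Omega>) \<le> ennreal (2 * pi * (1 - config_constant \<Omega>))"
  unfolding nn_integral_def
proof (rule SUP_least, clarify)
  let ?S = "arclength_measure \<Omega>"
  fix h assume h: "simple_function ?S h" "h \<le> (\<lambda>\<sigma>. 1 / max_tangent_radius \<Omega> \<sigma>)"
  have sets_S: "sets ?S = sets BM" by (simp add: arclength_measure_def)
  have hm: "h \<in> borel_measurable BM"
    using borel_measurable_simple_function[OF h(1)] measurable_cong_sets[OF sets_S refl] by blast
  have hg [measurable]: "(\<lambda>t. h (\<gamma> t)) \<in> borel_measurable borel"
    by (rule measurable_compose[OF measurable_gamma hm])
  \<comment> \<open>\<open>enn2real\<close> sends infinity to 0, which changes nothing almost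
    everywhere, since \<open>h\<close> is bounded by finite densities off a null set. The divisor
    \<open>2 * pi\<close> turns a reciprocal radius into a density.\<close>
  define n where "n = (\<lambda>t. enn2real (h (\<gamma> t)) / (2 * pi) * indicator {0..<L} t)"
  have n: "n \<in> borel_measurable borel" "\<And>t. 0 \<le> n t" "\<And>t. t \<notin> {0..<L} \<Longrightarrow> n t = 0"
  proof -
    show "n \<in> borel_measurable borel" unfolding n_def by measurable
  qed (auto simp: n_def)
  have hle: "h (\<gamma> t) \<le> ennreal (2 * pi * np_density \<Omega> \<zeta> (\<gamma> t))"
    if z: "\<zeta> \<in> frontier \<Omega>" and t: "\<not> corner \<Omega> (\<gamma> t) \<and> \<gamma> t \<noteq> \<zeta>" for \<zeta> t
  proof -
    obtain s where "\<zeta> = \<gamma> s" by (rule gamma_surj[OF z])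
    then show ?thesis
      using h(2) inverse_max_tangent_radius_le[of t s] t by (auto simp: le_fun_def intro: order_trans)
  qed
  have dom: "AE t in lborel. n t \<le> ext_weight \<zeta> t" if z: "\<zeta> \<in> frontier \<Omega>" for \<zeta>
    using AE_gamma_regular[of \<zeta>]
  proof eventually_elim
    case (elim t)
    show ?case
    proof (cases "t \<in> {0..<L}")
      case True
      have "enn2real (h (\<gamma> t)) \<le> 2 * pi * np_density \<Omega> \<zeta> (\<gamma> t)"
        using hle[OF z] elim True np_density_frontier_nonneg[OF z, of t] by (intro enn2real_leI) auto
      then show ?thesis using True by (simp add: n_def ext_weight_def field_simps)
    next
      case False
      then show ?thesis using n(3) ext_weight_nonneg[OF z] by simp
    qed
  qed
  \<comment> \<open>The density of any one boundary point shows that \<open>h\<close> is finite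
    almost everywhere along the curve.\<close>
  obtain z where z: "z \<in> frontier \<Omega>" using frontier_nonempty by auto
  note i = integral_dominated_le_1[OF n(1,2) dom]
  have "integral\<^sup>S ?S h = (\<integral>\<^sup>+\<sigma>. h \<sigma> \<partial>?S)" by (rule nn_integral_eq_simple_integral[OF h(1), symmetric])
  also have "\<dots> = (\<integral>\<^sup>+t. h (\<gamma> t) * indicator {0..<L} t \<partial>lborel)" by (rule nn_integral_arclength[OF hm])
  also have "\<dots> = (\<integral>\<^sup>+t. ennreal (2 * pi * n t) \<partial>lborel)"
  proof (rule nn_integral_cong_AE)
    show "AE t in lborel. h (\<gamma> t) * indicator {0..<L} t = ennreal (2 * pi * n t)"
      using AE_gamma_regular[of z]
    proof eventually_elim
      case (elim t)
      then have "t \<in> {0..<L} \<Longrightarrow> h (\<gamma> t) < top"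
        using hle[OF z, of t] by (auto intro: le_less_trans)
      then show ?case by (auto simp: n_def indicator_def)
    qed
  qed
  also have "\<dots> = ennreal (\<integral>t. 2 * pi * n t \<partial>lborel)"
    using i n(2) by (intro nn_integral_eq_integral) auto
  also have "\<dots> = ennreal (2 * pi * (\<integral>t. n t \<partial>lborel))" by simp
  also have "\<dots> \<le> ennreal (2 * pi * (1 - config_constant \<Omega>))"
    using config_constant_le[OF n dom] by (intro ennreal_leI mult_left_mono) auto
  finally show "integral\<^sup>S ?S h \<le> ennreal (2 * pi * (1 - config_constant \<Omega>))" .
qed

text \<open>The case of the zero measure. It makes the upper bound for the integral nonnegative
  before \<open>ennreal\<close> is applied, so that the bound can be read back as one between
  reals.\<close>

lemma config_constant_le_1: "config_constant \<Omega> \<le> 1"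
  using config_constant_le[of "\<lambda>t. 0"] ext_weight_nonneg by simp

end

theorem theorem6:
  fixes \<Omega> :: "complex set"
  assumes "compact \<Omega>" and "convex \<Omega>" and "interior \<Omega> \<noteq> {}"
  shows "ereal (config_constant \<Omega>)
           \<le> 1 - ereal (1 / (2 * pi))
                 * enn2ereal (\<integral>\<^sup>+\<sigma>. 1 / max_tangent_radius \<Omega> \<sigma> \<partial>arclength_measure \<Omega>)"
proof -
  interpret convex_body \<Omega> using assms by unfold_locales
  define I where "I = (\<integral>\<^sup>+\<sigma>. 1 / max_tangent_radius \<Omega> \<sigma> \<partial>arclength_measure \<Omega>)"
  have le: "I \<le> ennreal (2 * pi * (1 - config_constant \<Omega>))"
    unfolding I_def by (rule nn_integral_inverse_radius_le)
  \<comment> \<open>The bound is finite, so the integral is a real number and the subtraction of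
    extended reals is the ordinary one.\<close>
  then obtain r where r: "I = ennreal r" "0 \<le> r" by (cases I) (auto simp: top_unique)
  then have "r \<le> 2 * pi * (1 - config_constant \<Omega>)"
    using le config_constant_le_1 by (simp add: ennreal_le_iff)
  then have "config_constant \<Omega> \<le> 1 - 1 / (2 * pi) * r" by (simp add: field_simps)
  moreover have "1 - ereal (1 / (2 * pi)) * enn2ereal I = ereal (1 - 1 / (2 * pi) * r)"
    using r by (simp add: enn2ereal_ennreal one_ereal_def)
  ultimately show ?thesis unfolding I_def[symmetric] by simp
qed

end
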